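(* Let $k$ be an algebraically closed field, let $\operatorname{Spec}(A)$ be an affine $\mathbb{G}_m$-variety over $k$ with action $\beta$, written $(w,x)\mapsto w\bullet x$, and let $h\in A$ be such that $D(h)$ is a $\mathbb{G}_m$-stable open subvariety of $\operatorname{Spec}(A)$. The following are equivalent: (a) the variety $D(h)$ is a trivial $\mathbb{G}_m$-bundle over $D(h)//\mathbb{G}_m$; (b) there is a $\mathbb{G}_m$-equivariant, generically smooth, dominant morphism $\Psi: D(h)\to\mathbb{G}_m$ with connected fibres; (c) there is a rational function $g/h^{e}\in A_h^{\ast}$ which is a semi-invariant of weight one, i.e. $(g/h^{e})(w\bullet x)=w\,\bigl((g/h^{e})(x)\bigr)$ for all $w\in\mathbb{G}_m$ and $x\in D(h)$.
   Context: $D(h)\subseteq\operatorname{Spec}(A)$ is the principal open set where $h\neq 0$, with coordinate ring $A_h$; $A_h^{\ast}$ is the group of units of $A_h$. $D(h)//\mathbb{G}_m$ denotes the categorical quotient of $D(h)$ by $\mathbb{G}_m$. $D(h)$ is a trivial $\mathbb{G}_m$-bundle over $D(h)//\mathbb{G}_m$ if there is a $\mathbb{G}_m$-equivariant isomorphism $D(h)\cong\mathbb{G}_m\times (D(h)//\mathbb{G}_m)$, where $\mathbb{G}_m$ acts by multiplication on the first factor. In (b), $\mathbb{G}_m$ acts on the target $\mathbb{G}_m$ by multiplication. Varieties are integral. *)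

theory Defs
  imports "HOL-Analysis.Analysis" "HOL-Computational_Algebra.Polynomial"
begin

text \<open>
  Varieties are treated classically: an affine variety over an algebraically closed field is its
  set of closed points together with its coordinate ring, regarded as an algebra of functions on
  the points. Only the restriction of a function to the points matters, so \<open>reg X\<close> contains every
  total function whose restriction to \<open>pts X\<close> is regular.
\<close>

record ('p, 'k) function_space =
  pts :: "'p set"
  reg :: "('p \<Rightarrow> 'k) set"

inductive_set algebra_gen :: "('p \<Rightarrow> 'k::comm_ring_1) set \<Rightarrow> ('p \<Rightarrow> 'k) set"
  for S :: "('p \<Rightarrow> 'k) set" where
  const: "(\<lambda>_. c) \<in> algebra_gen S"
| gen: "f \<in> S \<Longrightarrow> f \<in> algebra_gen S"
| add: "f \<in> algebra_gen S \<Longrightarrow> g \<in> algebra_gen S \<Longrightarrow> (\<lambda>x. f x + g x) \<in> algebra_gen S"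
| mult: "f \<in> algebra_gen S \<Longrightarrow> g \<in> algebra_gen S \<Longrightarrow> (\<lambda>x. f x * g x) \<in> algebra_gen S"

definition functions_gen :: "'p set \<Rightarrow> ('p \<Rightarrow> 'k::comm_ring_1) set \<Rightarrow> ('p \<Rightarrow> 'k) set" where
  "functions_gen P S = {f. \<exists>g\<in>algebra_gen S. \<forall>x\<in>P. f x = g x}"

definition algebra_character ::
    "('p, 'k::comm_ring_1) function_space \<Rightarrow> (('p \<Rightarrow> 'k) \<Rightarrow> 'k) \<Rightarrow> bool" where
  "algebra_character X \<theta> \<longleftrightarrow>
     (\<forall>c. \<theta> (\<lambda>_. c) = c) \<and>
     (\<forall>f\<in>reg X. \<forall>g\<in>reg X. \<theta> (\<lambda>x. f x + g x) = \<theta> f + \<theta> g) \<and>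
     (\<forall>f\<in>reg X. \<forall>g\<in>reg X. \<theta> (\<lambda>x. f x * g x) = \<theta> f * \<theta> g) \<and>
     (\<forall>f\<in>reg X. \<forall>g\<in>reg X. (\<forall>x\<in>pts X. f x = g x) \<longrightarrow> \<theta> f = \<theta> g)"

text \<open>
  The coordinate ring is a finitely generated integral domain, and the points are exactly the
  \<open>k\<close>-algebra homomorphisms from it to \<open>k\<close>, i.e. the closed points of its spectrum.
\<close>

definition affine_variety :: "('p, 'k::alg_closed_field) function_space \<Rightarrow> bool" where
  "affine_variety X \<longleftrightarrow>
     pts X \<noteq> {} \<and>
     (\<exists>S. finite S \<and> reg X = functions_gen (pts X) S) \<and>
     (\<forall>f\<in>reg X. \<forall>g\<in>reg X. (\<forall>x\<in>pts X. f x * g x = 0) \<longrightarrow>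
        (\<forall>x\<in>pts X. f x = 0) \<or> (\<forall>x\<in>pts X. g x = 0)) \<and>
     (\<forall>\<theta>. algebra_character X \<theta> \<longrightarrow> (\<exists>!x. x \<in> pts X \<and> (\<forall>f\<in>reg X. \<theta> f = f x)))"

definition zariski :: "('p, 'k::comm_ring_1) function_space \<Rightarrow> 'p topology" where
  "zariski X = topology_generated_by ((\<lambda>f. {x \<in> pts X. f x \<noteq> 0}) ` reg X)"

definition principal_open ::
    "('p, 'k::field) function_space \<Rightarrow> ('p \<Rightarrow> 'k) \<Rightarrow> ('p, 'k) function_space" where
  "principal_open X h =
     (let D = {x \<in> pts X. h x \<noteq> 0}
      in \<lparr>pts = D, reg = {F. \<exists>g\<in>reg X. \<exists>e::nat. \<forall>x\<in>D. F x = g x / h x ^ e}\<rparr>)"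

definition affine_line :: "('k, 'k::comm_ring_1) function_space" where
  "affine_line = \<lparr>pts = UNIV, reg = range poly\<rparr>"

definition Gm :: "('k, 'k::field) function_space" where
  "Gm = principal_open affine_line (\<lambda>t. t)"

definition affine_space :: "nat \<Rightarrow> (nat \<Rightarrow> 'k, 'k::comm_ring_1) function_space" where
  "affine_space m =
     (let P = {z. \<forall>i\<ge>m. z i = 0}
      in \<lparr>pts = P, reg = functions_gen P ((\<lambda>i z. z i) ` {..<m})\<rparr>)"

text \<open>The regular functions on a product are the image of the tensor product.\<close>

definition product_variety ::
    "('p, 'k::comm_ring_1) function_space \<Rightarrow> ('q, 'k) function_space \<Rightarrow>
     ('p \<times> 'q, 'k) function_space" where
  "product_variety X Y =
     \<lparr>pts = pts X \<times> pts Y,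
      reg = {F. \<exists>(n::nat) f g. (\<forall>i<n. f i \<in> reg X \<and> g i \<in> reg Y) \<and>
               (\<forall>x\<in>pts X. \<forall>y\<in>pts Y. F (x, y) = (\<Sum>i<n. f i x * g i y))}\<rparr>"

definition morphism ::
    "('p, 'k) function_space \<Rightarrow> ('q, 'k) function_space \<Rightarrow> ('p \<Rightarrow> 'q) \<Rightarrow> bool" where
  "morphism X Y \<phi> \<longleftrightarrow> \<phi> ` pts X \<subseteq> pts Y \<and> (\<forall>f\<in>reg Y. (\<lambda>x. f (\<phi> x)) \<in> reg X)"

definition isomorphism ::
    "('p, 'k) function_space \<Rightarrow> ('q, 'k) function_space \<Rightarrow> ('p \<Rightarrow> 'q) \<Rightarrow> bool" where
  "isomorphism X Y \<phi> \<longleftrightarrow>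
     morphism X Y \<phi> \<and>
     (\<exists>\<psi>. morphism Y X \<psi> \<and> (\<forall>x\<in>pts X. \<psi> (\<phi> x) = x) \<and> (\<forall>y\<in>pts Y. \<phi> (\<psi> y) = y))"

definition closed_immersion ::
    "('p, 'k) function_space \<Rightarrow> ('q, 'k) function_space \<Rightarrow> ('p \<Rightarrow> 'q) \<Rightarrow> bool" where
  "closed_immersion X Y \<phi> \<longleftrightarrow>
     morphism X Y \<phi> \<and> (\<forall>g\<in>reg X. \<exists>f\<in>reg Y. \<forall>x\<in>pts X. g x = f (\<phi> x))"

definition unit_functions :: "('p, 'k::comm_ring_1) function_space \<Rightarrow> ('p \<Rightarrow> 'k) set" where
  "unit_functions X = {u \<in> reg X. \<exists>v\<in>reg X. \<forall>x\<in>pts X. u x * v x = 1}"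

subsection \<open>Actions of the multiplicative group\<close>

definition Gm_action ::
    "('p, 'k::field) function_space \<Rightarrow> ('k \<Rightarrow> 'p \<Rightarrow> 'p) \<Rightarrow> bool" where
  "Gm_action X act \<longleftrightarrow>
     morphism (product_variety Gm X) X (\<lambda>(w, x). act w x) \<and>
     (\<forall>x\<in>pts X. act 1 x = x) \<and>
     (\<forall>v\<in>pts Gm. \<forall>w\<in>pts Gm. \<forall>x\<in>pts X. act (v * w) x = act v (act w x))"

definition affine_Gm_variety ::
    "('p, 'k::alg_closed_field) function_space \<Rightarrow> ('k \<Rightarrow> 'p \<Rightarrow> 'p) \<Rightarrow> bool" where
  "affine_Gm_variety X act \<longleftrightarrow> affine_variety X \<and> Gm_action X act"

definition Gm_stable :: "('k::field \<Rightarrow> 'p \<Rightarrow> 'p) \<Rightarrow> 'p set \<Rightarrow> bool" where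
  "Gm_stable act U \<longleftrightarrow> (\<forall>w\<in>pts Gm. \<forall>x\<in>U. act w x \<in> U)"

definition Gm_equivariant ::
    "('p, 'k::field) function_space \<Rightarrow> ('k \<Rightarrow> 'p \<Rightarrow> 'p) \<Rightarrow> ('k \<Rightarrow> 'q \<Rightarrow> 'q) \<Rightarrow> ('p \<Rightarrow> 'q) \<Rightarrow> bool"
  where
  "Gm_equivariant X actX actY \<phi> \<longleftrightarrow> (\<forall>w\<in>pts Gm. \<forall>x\<in>pts X. \<phi> (actX w x) = actY w (\<phi> x))"

definition Gm_invariant ::
    "('p, 'k::field) function_space \<Rightarrow> ('k \<Rightarrow> 'p \<Rightarrow> 'p) \<Rightarrow> ('p \<Rightarrow> 'q) \<Rightarrow> bool" where
  "Gm_invariant X act \<phi> \<longleftrightarrow> (\<forall>w\<in>pts Gm. \<forall>x\<in>pts X. \<phi> (act w x) = \<phi> x)"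

definition semi_invariant_weight_one ::
    "('p, 'k::field) function_space \<Rightarrow> ('k \<Rightarrow> 'p \<Rightarrow> 'p) \<Rightarrow> ('p \<Rightarrow> 'k) \<Rightarrow> bool" where
  "semi_invariant_weight_one X act f \<longleftrightarrow> (\<forall>w\<in>pts Gm. \<forall>x\<in>pts X. f (act w x) = w * f x)"

subsection \<open>General varieties and categorical quotients\<close>

text \<open>
  A not necessarily affine variety is given by a finite atlas of affine charts whose point sets
  lie in a common type and which induce the same topology and the same regular functions on
  overlaps.
\<close>

definition regular_on :: "('p, 'k::field) function_space \<Rightarrow> 'p set \<Rightarrow> ('p \<Rightarrow> 'k) set" where
  "regular_on X U =
     {\<phi>. \<forall>x\<in>U. \<exists>g\<in>reg X. \<exists>h\<in>reg X. h x \<noteq> 0 \<and> (\<forall>y\<in>U. h y \<noteq> 0 \<longrightarrow> \<phi> y = g y / h y)}"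

definition atlas_pts :: "('p, 'k) function_space set \<Rightarrow> 'p set" where
  "atlas_pts Z = (\<Union>C\<in>Z. pts C)"

definition morphism_to_atlas ::
    "('p, 'k::field) function_space \<Rightarrow> ('q, 'k) function_space set \<Rightarrow> ('p \<Rightarrow> 'q) \<Rightarrow> bool" where
  "morphism_to_atlas X Z \<phi> \<longleftrightarrow>
     \<phi> ` pts X \<subseteq> atlas_pts Z \<and>
     (\<forall>C\<in>Z. openin (zariski X) {x \<in> pts X. \<phi> x \<in> pts C} \<and>
        (\<forall>f\<in>reg C. (\<lambda>x. f (\<phi> x)) \<in> regular_on X {x \<in> pts X. \<phi> x \<in> pts C}))"

definition compatible_charts ::
    "('p, 'k::field) function_space \<Rightarrow> ('p, 'k) function_space \<Rightarrow> bool" where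
  "compatible_charts C D \<longleftrightarrow>
     openin (zariski C) (pts C \<inter> pts D) \<and>
     openin (zariski D) (pts C \<inter> pts D) \<and>
     (\<forall>V. V \<subseteq> pts C \<inter> pts D \<longrightarrow>
        (openin (zariski C) V \<longleftrightarrow> openin (zariski D) V) \<and>
        (openin (zariski C) V \<longrightarrow> regular_on C V = regular_on D V))"

text \<open>
  Pairwise intersecting charts make the variety irreducible; the last clause is separatedness.
  Since a variety over the infinite field \<open>k\<close> has at most as many points as \<open>k\<close>, every variety is
  isomorphic to one whose points have type \<open>nat \<Rightarrow> 'k\<close>.
\<close>

definition variety :: "(nat \<Rightarrow> 'k, 'k::alg_closed_field) function_space set \<Rightarrow> bool" where
  "variety Z \<longleftrightarrow>
     finite Z \<and> Z \<noteq> {} \<and> (\<forall>C\<in>Z. affine_variety C) \<and>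
     (\<forall>C\<in>Z. \<forall>D\<in>Z. pts C \<inter> pts D \<noteq> {} \<and> compatible_charts C D) \<and>
     (\<forall>(Y :: (nat \<Rightarrow> 'k, 'k) function_space) \<phi> \<psi>.
        affine_variety Y \<longrightarrow> morphism_to_atlas Y Z \<phi> \<longrightarrow> morphism_to_atlas Y Z \<psi> \<longrightarrow>
        closedin (zariski Y) {y \<in> pts Y. \<phi> y = \<psi> y})"

text \<open>
  The quotient variety is required to be affine, as it always is for an affine \<open>X\<close>; the test
  objects are arbitrary varieties.
\<close>

definition categorical_quotient ::
    "('p, 'k::alg_closed_field) function_space \<Rightarrow> ('k \<Rightarrow> 'p \<Rightarrow> 'p) \<Rightarrow>
     ('q, 'k) function_space \<Rightarrow> ('p \<Rightarrow> 'q) \<Rightarrow> bool" where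
  "categorical_quotient X act Q \<pi> \<longleftrightarrow>
     affine_variety Q \<and> morphism X Q \<pi> \<and> Gm_invariant X act \<pi> \<and>
     (\<forall>(Z :: (nat \<Rightarrow> 'k, 'k) function_space set) \<psi>.
        variety Z \<longrightarrow> morphism_to_atlas X Z \<psi> \<longrightarrow> Gm_invariant X act \<psi> \<longrightarrow>
        (\<exists>\<eta>. morphism_to_atlas Q Z \<eta> \<and> (\<forall>x\<in>pts X. \<psi> x = \<eta> (\<pi> x)) \<and>
           (\<forall>\<eta>'. morphism_to_atlas Q Z \<eta>' \<longrightarrow> (\<forall>x\<in>pts X. \<psi> x = \<eta>' (\<pi> x)) \<longrightarrow>
              (\<forall>q\<in>pts Q. \<eta>' q = \<eta> q))))"

definition trivial_Gm_bundle ::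
    "('p, 'k::alg_closed_field) function_space \<Rightarrow> ('k \<Rightarrow> 'p \<Rightarrow> 'p) \<Rightarrow> bool" where
  "trivial_Gm_bundle X act \<longleftrightarrow>
     (\<exists>(Q :: (nat \<Rightarrow> 'k, 'k) function_space) \<pi> \<phi>.
        categorical_quotient X act Q \<pi> \<and>
        isomorphism X (product_variety Gm Q) \<phi> \<and>
        Gm_equivariant X act (\<lambda>w (s, q). (w * s, q)) \<phi>)"

subsection \<open>Smoothness, dominance and connected fibres\<close>

text \<open>
  \<open>partial_deriv F j\<close> is the partial derivative of a function on \<open>Y \<times> \<bbbA>\<^sup>m\<close> along the \<open>j\<close>-th
  coordinate of the second factor (\<open>j < m\<close>). The restriction of a regular function to such a
  coordinate line is a polynomial function, and its polynomial is unique because \<open>k\<close> is infinite.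
\<close>

definition partial_deriv :: "('q \<times> (nat \<Rightarrow> 'k::field) \<Rightarrow> 'k) \<Rightarrow> nat \<Rightarrow> 'q \<times> (nat \<Rightarrow> 'k) \<Rightarrow> 'k" where
  "partial_deriv F j p =
     poly (pderiv (THE q. \<forall>t. poly q t = F (fst p, (snd p)(j := t)))) (snd p j)"

text \<open>
  Smoothness of \<open>\<Psi> : X \<rightarrow> Y\<close> at \<open>x\<close> (as in Bosch, Luetkebohmert, Raynaud, Neron Models, Section 2.2):
  a neighbourhood \<open>U\<close> of \<open>x\<close> embeds over \<open>Y\<close> into some \<open>Y \<times> \<bbbA>\<^sup>m\<close>, the ideal of the image is generated
  locally at the image of \<open>x\<close> by functions \<open>f\<^sub>0, \<dots>, f\<^sub>r\<^sub>-\<^sub>1\<close>, and the relative differentials of these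
  functions are linearly independent there. After shrinking \<open>U\<close> and enlarging \<open>m\<close>, \<open>U\<close> is principal
  and the immersion is closed.
\<close>

definition smooth_at ::
    "('p, 'k::field) function_space \<Rightarrow> ('q, 'k) function_space \<Rightarrow> ('p \<Rightarrow> 'q) \<Rightarrow> 'p \<Rightarrow> bool" where
  "smooth_at X Y \<Psi> x \<longleftrightarrow>
     (\<exists>b\<in>reg X. b x \<noteq> 0 \<and>
       (\<exists>m (z :: 'p \<Rightarrow> nat \<Rightarrow> 'k).
         let U = principal_open X b; P = product_variety Y (affine_space m); j = (\<lambda>u. (\<Psi> u, z u))
         in closed_immersion U P j \<and>
           (\<exists>(r::nat) f.
              (\<forall>i<r. f i \<in> reg P \<and> (\<forall>u\<in>pts U. f i (j u) = 0)) \<and>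
              (\<forall>F\<in>reg P. (\<forall>u\<in>pts U. F (j u) = 0) \<longrightarrow>
                 (\<exists>c\<in>reg P. c (j x) \<noteq> 0 \<and>
                   (\<exists>a. (\<forall>i<r. a i \<in> reg P) \<and>
                      (\<forall>p\<in>pts P. c p * F p = (\<Sum>i<r. a i p * f i p))))) \<and>
              (\<forall>l. (\<forall>n<m. (\<Sum>i<r. l i * partial_deriv (f i) n (j x)) = 0) \<longrightarrow>
                 (\<forall>i<r. l i = 0)))))"

definition generically_smooth ::
    "('p, 'k::field) function_space \<Rightarrow> ('q, 'k) function_space \<Rightarrow> ('p \<Rightarrow> 'q) \<Rightarrow> bool" where
  "generically_smooth X Y \<Psi> \<longleftrightarrow>
     (\<exists>U. openin (zariski X) U \<and> zariski X closure_of U = pts X \<and> (\<forall>x\<in>U. smooth_at X Y \<Psi> x))"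

definition dominant ::
    "('p, 'k::field) function_space \<Rightarrow> ('q, 'k) function_space \<Rightarrow> ('p \<Rightarrow> 'q) \<Rightarrow> bool" where
  "dominant X Y \<Psi> \<longleftrightarrow> zariski Y closure_of (\<Psi> ` pts X) = pts Y"

definition connected_fibres ::
    "('p, 'k::field) function_space \<Rightarrow> ('q, 'k) function_space \<Rightarrow> ('p \<Rightarrow> 'q) \<Rightarrow> bool" where
  "connected_fibres X Y \<Psi> \<longleftrightarrow> (\<forall>y\<in>pts Y. connectedin (zariski X) {x \<in> pts X. \<Psi> x = y})"

end

theory Submission
  imports Defs
begin

text \<open>
  All three conditions say that \<open>D = D(h)\<close> carries a unit \<open>u\<close> of weight one. The first coordinate of a
  trivialisation is such a unit, an equivariant morphism to \<open>Gm\<close> is one, and a unit of \<open>A\<^sub>h\<close> is by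
  definition a fraction \<open>g / h ^ e\<close>. The work lies in going back from \<open>u\<close>.

  Before that, \<open>Gm\<close> has to act on \<open>D\<close> by regular maps. For \<open>x \<in> D\<close> the Laurent polynomial
  \<open>w \<mapsto> h (act w x)\<close> has no zeros, hence is a monomial, and irreducibility makes its exponent constant:
  \<open>h\<close> is homogeneous (\<open>stable_principal_open_homogeneous\<close>), so its inverse pulls back to a regular
  function (\<open>affine_Gm_variety_principal_open\<close>).

  Given \<open>u\<close>, each orbit meets the fibre \<open>u = 1\<close> in the single point \<open>act (1 / u x) x\<close>. This retraction
  \<open>D \<rightarrow> {u = 1}\<close> is a categorical quotient, and \<open>D\<close> is the product of \<open>Gm\<close> with it
  (\<open>categorical_quotient_s\<close>, \<open>isomorphism_product\<close>), which gives (a). For (b), \<open>u\<close> itself is surjective and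
  equivariant. Its fibres are irreducible, since functions on a fibre spread over \<open>D\<close> along the
  orbits (\<open>fibre_integral\<close>).

  Generic smoothness of \<open>u\<close> amounts to generic smoothness over \<open>k\<close> of the quotient \<open>V\<close>, embedded in
  affine space by generators of the ring of invariants. Because \<open>k\<close> is perfect, these coordinates can
  be ordered so that each is transcendental or separably algebraic over its predecessors
  (\<open>separating_order_exists\<close>). The minimal equations of the separable ones cut out \<open>V\<close> locally where
  their leading coefficients are nonzero, by pseudo-division, and their Jacobian matrix is triangular
  with nonzero diagonal on a smaller open set (\<open>generic_triangular_equations\<close>). The same equations
  cut out \<open>D\<close> in \<open>Gm \<times> \<bbbA>\<^sup>n\<close>, because \<open>Gm\<close> moves the first coordinate freely
  (\<open>vanishing_ideal_locally_generated\<close>).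
\<close>

section \<open>Algebras of functions and families of polynomials\<close>

text \<open>
  Over a finite field, adding one to the product of all linear polynomials gives a polynomial
  without roots.
\<close>

lemma infinite_alg_closed_field: "infinite (UNIV :: 'k::alg_closed_field set)"
proof
  assume fin: "finite (UNIV :: 'k set)"
  define p :: "'k poly" where "p = (\<Prod>a\<in>UNIV. [:- a, 1:]) + 1"
  have val: "poly p x = 1" for x
    using fin by (simp add: p_def poly_prod)
  have deg: "degree (\<Prod>a\<in>(UNIV::'k set). [:- a, 1:]) = card (UNIV :: 'k set)"
    by (subst degree_prod_eq_sum_degree) auto
  have "card (UNIV :: 'k set) > 0"
    using fin by (simp add: card_gt_0_iff)
  then have "degree p > 0"
    using deg unfolding p_def by (subst degree_add_eq_left) auto
  then show False
    using alg_closed_imp_poly_has_root[of p] val by auto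
qed

lemma poly_zero_of_cofinite_roots:
  fixes p :: "'k::alg_closed_field poly"
  assumes "finite E" and "\<And>t. t \<notin> E \<Longrightarrow> poly p t = 0"
  shows "p = 0"
proof (rule ccontr)
  assume "p \<noteq> 0"
  then have "finite ({t. poly p t = 0} \<union> E)"
    using assms(1) by (simp add: poly_roots_finite)
  moreover have "{t. poly p t = 0} \<union> E = UNIV"
    using assms(2) by auto
  ultimately show False
    using infinite_alg_closed_field by metis
qed

lemma poly_eq_of_cofinite:
  fixes p q :: "'k::alg_closed_field poly"
  assumes "finite E" and "\<And>t. t \<notin> E \<Longrightarrow> poly p t = poly q t"
  shows "p = q"
  using poly_zero_of_cofinite_roots[of E "p - q"] assms by simp

locale function_algebra =
  fixes A :: "('p \<Rightarrow> 'k::comm_ring_1) set"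
  assumes const: "(\<lambda>_. c) \<in> A"
    and add: "f \<in> A \<Longrightarrow> g \<in> A \<Longrightarrow> (\<lambda>x. f x + g x) \<in> A"
    and mult: "f \<in> A \<Longrightarrow> g \<in> A \<Longrightarrow> (\<lambda>x. f x * g x) \<in> A"
begin

lemma sum: "(\<And>i. i \<in> I \<Longrightarrow> f i \<in> A) \<Longrightarrow> (\<lambda>x. \<Sum>i\<in>I. f i x) \<in> A"
  by (induction I rule: infinite_finite_induct) (auto intro: const add)

lemma prod: "(\<And>i. i \<in> I \<Longrightarrow> f i \<in> A) \<Longrightarrow> (\<lambda>x. \<Prod>i\<in>I. f i x) \<in> A"
  by (induction I rule: infinite_finite_induct) (auto intro: const mult)

lemma power: "f \<in> A \<Longrightarrow> (\<lambda>x. f x ^ n) \<in> A"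
  by (induction n) (auto intro: const mult)

lemma pullback:
  assumes "f \<in> algebra_gen S" and "\<And>s. s \<in> S \<Longrightarrow> (\<lambda>x. s (\<phi> x)) \<in> A"
  shows "(\<lambda>x. f (\<phi> x)) \<in> A"
  using assms(1) by induction (auto intro: const add mult assms(2))

end

lemma function_algebra_algebra_gen: "function_algebra (algebra_gen S)"
  by unfold_locales (auto intro: algebra_gen.intros)

lemma algebra_gen_mono: "S \<subseteq> T \<Longrightarrow> algebra_gen S \<subseteq> algebra_gen T"
proof
  fix f assume "S \<subseteq> T" "f \<in> algebra_gen S"
  from this(2,1) show "f \<in> algebra_gen T"
    by induction (auto intro: algebra_gen.intros)
qed

lemma function_algebra_functions_gen: "function_algebra (functions_gen P S)"
proof -
  interpret function_algebra "algebra_gen S" by (rule function_algebra_algebra_gen)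
  show ?thesis
  proof
    show "(\<lambda>_. c) \<in> functions_gen P S" for c
      unfolding functions_gen_def by (auto intro!: bexI[OF _ const[of c]])
    show "(\<lambda>x. f x + g x) \<in> functions_gen P S"
      if fg: "f \<in> functions_gen P S" "g \<in> functions_gen P S" for f g
    proof -
      obtain f' g' where "f' \<in> algebra_gen S" "g' \<in> algebra_gen S"
        "\<forall>x\<in>P. f x = f' x" "\<forall>x\<in>P. g x = g' x"
        using fg unfolding functions_gen_def by blast
      then show ?thesis
        unfolding functions_gen_def by (auto intro!: bexI[OF _ add[of f' g']])
    qed
    show "(\<lambda>x. f x * g x) \<in> functions_gen P S"
      if fg: "f \<in> functions_gen P S" "g \<in> functions_gen P S" for f g
    proof -
      obtain f' g' where "f' \<in> algebra_gen S" "g' \<in> algebra_gen S"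
        "\<forall>x\<in>P. f x = f' x" "\<forall>x\<in>P. g x = g' x"
        using fg unfolding functions_gen_def by blast
      then show ?thesis
        unfolding functions_gen_def by (auto intro!: bexI[OF _ mult[of f' g']])
    qed
  qed
qed

lemma functions_gen_superset: "S \<subseteq> functions_gen P S"
  unfolding functions_gen_def by (auto intro: algebra_gen.gen)

lemma functions_gen_cong:
  "f \<in> functions_gen P S \<Longrightarrow> (\<And>x. x \<in> P \<Longrightarrow> g x = f x) \<Longrightarrow> g \<in> functions_gen P S"
  unfolding functions_gen_def by auto

text \<open>
  A polynomial with coefficients in an algebra of functions is handled as a function whose values
  are univariate polynomials over the field. Arithmetic, evaluation and \<open>pderiv\<close> are then pointwise,
  although rings of functions have zero divisors. The bound on the degree is what makes the
  family a polynomial.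
\<close>

definition poly_family :: "('p \<Rightarrow> 'k::comm_ring_1) set \<Rightarrow> ('p \<Rightarrow> 'k poly) set" where
  "poly_family A = {G. (\<forall>j. (\<lambda>x. coeff (G x) j) \<in> A) \<and> (\<exists>N. \<forall>x. degree (G x) \<le> N)}"

lemma poly_family_coeff: "G \<in> poly_family A \<Longrightarrow> (\<lambda>x. coeff (G x) j) \<in> A"
  by (simp add: poly_family_def)

lemma poly_altdef_bound: "degree p \<le> N \<Longrightarrow> poly p t = (\<Sum>j\<le>N. coeff p j * t ^ j)"
  for p :: "'k::comm_ring_1 poly"
  unfolding poly_altdef
  by (rule sum.mono_neutral_left) (auto simp: coeff_eq_0 le_less_trans)

context function_algebra
begin

lemma poly_family_const: "(\<lambda>_. p) \<in> poly_family A"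
  by (auto simp: poly_family_def const)

lemma poly_family_add:
  assumes "F \<in> poly_family A" "G \<in> poly_family A"
  shows "(\<lambda>x. F x + G x) \<in> poly_family A"
proof -
  obtain M N where "\<And>x. degree (F x) \<le> M" "\<And>x. degree (G x) \<le> N"
    using assms unfolding poly_family_def by auto
  then have "degree (F x + G x) \<le> max M N" for x
    by (meson degree_add_le le_max_iff_disj)
  then show ?thesis
    using assms unfolding poly_family_def by (auto intro: add)
qed

lemma poly_family_mult:
  assumes "F \<in> poly_family A" "G \<in> poly_family A"
  shows "(\<lambda>x. F x * G x) \<in> poly_family A"
proof -
  obtain M N where "\<And>x. degree (F x) \<le> M" "\<And>x. degree (G x) \<le> N"
    using assms unfolding poly_family_def by auto
  then have "degree (F x * G x) \<le> M + N" for x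
    by (meson add_mono degree_mult_le order_trans)
  then show ?thesis
    using assms unfolding poly_family_def
    by (auto simp: coeff_mult intro!: sum mult)
qed

lemma poly_family_monom:
  assumes "f \<in> A"
  shows "(\<lambda>x. monom (f x) n) \<in> poly_family A"
proof -
  have "(\<lambda>x. coeff (monom (f x) n) j) \<in> A" for j
    using assms const[of 0] by (cases "j = n") auto
  then show ?thesis
    unfolding poly_family_def using degree_monom_le by blast
qed

lemma poly_family_smult:
  assumes "f \<in> A" "G \<in> poly_family A"
  shows "(\<lambda>x. smult (f x) (G x)) \<in> poly_family A"
  using poly_family_mult[OF poly_family_monom[OF assms(1), of 0] assms(2)]
  by (simp add: monom_0)

lemma poly_family_diff:
  assumes "F \<in> poly_family A" "G \<in> poly_family A"
  shows "(\<lambda>x. F x - G x) \<in> poly_family A"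
  using poly_family_add[OF assms(1) poly_family_smult[OF const[of "-1"] assms(2)]] by simp

lemma poly_family_sum:
  "(\<And>i. i \<in> I \<Longrightarrow> F i \<in> poly_family A) \<Longrightarrow> (\<lambda>x. \<Sum>i\<in>I. F i x) \<in> poly_family A"
  by (induction I rule: infinite_finite_induct) (auto intro: poly_family_const poly_family_add)

lemma poly_family_eval:
  assumes "G \<in> poly_family B" "B \<subseteq> A" "y \<in> A"
  shows "(\<lambda>x. poly (G x) (y x)) \<in> A"
proof -
  obtain N where N: "\<And>x. degree (G x) \<le> N"
    using assms unfolding poly_family_def by auto
  show ?thesis
    unfolding poly_altdef_bound[OF N]
    using assms by (auto intro!: sum mult power dest: poly_family_coeff)
qed

lemma algebra_gen_insert:
  assumes "A = algebra_gen S" and f: "f \<in> algebra_gen (insert y S)"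
  shows "\<exists>G\<in>poly_family A. \<forall>x. f x = poly (G x) (y x)"
  using f
proof induction
  case (const c)
  show ?case by (rule bexI[OF _ poly_family_const[of "[:c:]"]]) auto
next
  case (gen f)
  show ?case
  proof (cases "f = y")
    case True
    show ?thesis by (rule bexI[OF _ poly_family_const[of "[:0, 1:]"]]) (auto simp: True)
  next
    case False
    then have "f \<in> A" using gen assms(1) by (auto intro: algebra_gen.gen)
    then show ?thesis
      by (intro bexI[OF _ poly_family_monom[of f 0]]) (auto simp: monom_0)
  qed
next
  case (add f g)
  then obtain F G where "F \<in> poly_family A" "G \<in> poly_family A"
    "\<forall>x. f x = poly (F x) (y x)" "\<forall>x. g x = poly (G x) (y x)" by auto
  then show ?case by (intro bexI[OF _ poly_family_add[of F G]]) auto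
next
  case (mult f g)
  then obtain F G where "F \<in> poly_family A" "G \<in> poly_family A"
    "\<forall>x. f x = poly (F x) (y x)" "\<forall>x. g x = poly (G x) (y x)" by auto
  then show ?case by (intro bexI[OF _ poly_family_mult[of F G]]) auto
qed

end

section \<open>Polynomial functions and their monomial expansions\<close>

definition polys :: "nat set \<Rightarrow> ((nat \<Rightarrow> 'k::comm_ring_1) \<Rightarrow> 'k) set" where
  "polys I = algebra_gen ((\<lambda>i z. z i) ` I)"

lemma function_algebra_polys: "function_algebra (polys I)"
  unfolding polys_def by (rule function_algebra_algebra_gen)

lemma coord_in_polys: "i \<in> I \<Longrightarrow> (\<lambda>z. z i) \<in> polys I"
  unfolding polys_def by (auto intro: algebra_gen.gen)

lemma polys_mono: "I \<subseteq> J \<Longrightarrow> polys I \<subseteq> polys J"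
  unfolding polys_def by (intro algebra_gen_mono image_mono)

lemma polys_local:
  assumes "f \<in> polys I" and "\<And>i. i \<in> I \<Longrightarrow> z i = z' i"
  shows "f z = f z'"
  using assms(1) unfolding polys_def by induction (auto simp: assms(2))

lemma poly_family_polys_local:
  assumes "G \<in> poly_family (polys I)" and "\<And>i. i \<in> I \<Longrightarrow> z i = z' i"
  shows "G z = G z'"
  using assms polys_local[OF poly_family_coeff[OF assms(1)], of z z'] by (auto intro!: poly_eqI)

lemma polys_insert:
  assumes "f \<in> polys (insert i I)"
  shows "\<exists>G\<in>poly_family (polys I). \<forall>z. f z = poly (G z) (z i)"
  using function_algebra.algebra_gen_insert[OF function_algebra_polys polys_def, of f "\<lambda>z. z i"] assms
  unfolding polys_def by simp

text \<open>
  Characteristic \<open>p\<close> forces formal polynomials into the argument: the choice of a relation of least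
  size, formal derivatives and \<open>p\<close>-th roots all refer to exponents.
\<close>

definition exponents :: "nat set \<Rightarrow> (nat \<Rightarrow> nat) set" where
  "exponents I = {\<alpha>. \<forall>i. i \<notin> I \<longrightarrow> \<alpha> i = 0}"

definition monomial_sum ::
    "nat set \<Rightarrow> (nat \<Rightarrow> nat) set \<Rightarrow> ((nat \<Rightarrow> nat) \<Rightarrow> 'k) \<Rightarrow> (nat \<Rightarrow> 'k) \<Rightarrow> 'k::comm_ring_1" where
  "monomial_sum I E c z = (\<Sum>\<alpha>\<in>E. c \<alpha> * (\<Prod>i\<in>I. z i ^ \<alpha> i))"

lemma monomial_sum_expansion:
  fixes f :: "(nat \<Rightarrow> 'k::comm_ring_1) \<Rightarrow> 'k"
  assumes I: "finite I" and f: "f \<in> polys I"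
  shows "\<exists>E c. finite E \<and> E \<subseteq> exponents I \<and> f = monomial_sum I E c"
  using f unfolding polys_def
proof induction
  case (const a)
  show ?case
    by (rule exI[of _ "{\<lambda>_. 0}"], rule exI[of _ "\<lambda>_. a"])
       (auto simp: exponents_def monomial_sum_def)
next
  case (gen f)
  then obtain i where i: "i \<in> I" "f = (\<lambda>z. z i)" by auto
  have "(\<Prod>j\<in>I. z j ^ ((\<lambda>_. 0)(i := 1)) j) = (\<Prod>j\<in>I. if j = i then z j else 1)" for z :: "nat \<Rightarrow> 'k"
    by (rule prod.cong) auto
  then show ?case
    using i I
    by (intro exI[of _ "{(\<lambda>_. 0)(i := 1)}"] exI[of _ "\<lambda>_. 1"])
       (auto simp: exponents_def monomial_sum_def)
next
  case (add f g)
  then obtain E c E' c' where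
    E: "finite E" "E \<subseteq> exponents I" "f = monomial_sum I E c" and
    E': "finite E'" "E' \<subseteq> exponents I" "g = monomial_sum I E' c'" by auto
  define b where "b = (\<lambda>\<alpha>. (if \<alpha> \<in> E then c \<alpha> else 0) + (if \<alpha> \<in> E' then c' \<alpha> else 0))"
  have "f z + g z = monomial_sum I (E \<union> E') b z" for z
  proof -
    have "f z = (\<Sum>\<alpha>\<in>E \<union> E'. (if \<alpha> \<in> E then c \<alpha> else 0) * (\<Prod>i\<in>I. z i ^ \<alpha> i))"
      unfolding E monomial_sum_def by (rule sum.mono_neutral_cong_left) (use E E' in auto)
    moreover have "g z = (\<Sum>\<alpha>\<in>E \<union> E'. (if \<alpha> \<in> E' then c' \<alpha> else 0) * (\<Prod>i\<in>I. z i ^ \<alpha> i))"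
      unfolding E' monomial_sum_def by (rule sum.mono_neutral_cong_left) (use E E' in auto)
    ultimately show ?thesis
      unfolding monomial_sum_def b_def by (simp add: sum.distrib distrib_right)
  qed
  then show ?case
    using E E' by (intro exI[of _ "E \<union> E'"] exI[of _ b]) auto
next
  case (mult f g)
  then obtain E c E' c' where
    E: "finite E" "E \<subseteq> exponents I" "f = monomial_sum I E c" and
    E': "finite E'" "E' \<subseteq> exponents I" "g = monomial_sum I E' c'" by auto
  define s where "s = (\<lambda>p::(nat \<Rightarrow> nat) \<times> (nat \<Rightarrow> nat). \<lambda>i. fst p i + snd p i)"
  define b where "b = (\<lambda>\<gamma>. \<Sum>p\<in>{p \<in> E \<times> E'. s p = \<gamma>}. c (fst p) * c' (snd p))"
  have "f z * g z = monomial_sum I (s ` (E \<times> E')) b z" for z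
  proof -
    have "f z * g z = (\<Sum>p\<in>E \<times> E'. c (fst p) * c' (snd p) * (\<Prod>i\<in>I. z i ^ s p i))"
      unfolding E E' monomial_sum_def sum_product sum.cartesian_product
      by (auto intro!: sum.cong simp: s_def power_add prod.distrib algebra_simps)
    also have "\<dots> = (\<Sum>\<gamma>\<in>s ` (E \<times> E'). \<Sum>p\<in>{p \<in> E \<times> E'. s p = \<gamma>}.
        c (fst p) * c' (snd p) * (\<Prod>i\<in>I. z i ^ s p i))"
      using E E' by (intro sum.image_gen) auto
    also have "\<dots> = monomial_sum I (s ` (E \<times> E')) b z"
      unfolding monomial_sum_def b_def sum_distrib_right by (auto intro!: sum.cong)
    finally show ?thesis .
  qed
  moreover have "s ` (E \<times> E') \<subseteq> exponents I"
    using E E' by (fastforce simp: exponents_def s_def)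
  ultimately show ?case
    using E E' by (intro exI[of _ "s ` (E \<times> E')"] exI[of _ b]) auto
qed

lemma monomial_sum_expansion_nonzero:
  fixes f :: "(nat \<Rightarrow> 'k::comm_ring_1) \<Rightarrow> 'k"
  assumes "finite I" and "f \<in> polys I"
  obtains E c where "finite E" "E \<subseteq> exponents I" "\<And>\<alpha>. \<alpha> \<in> E \<Longrightarrow> c \<alpha> \<noteq> 0" "f = monomial_sum I E c"
proof -
  obtain E c where E: "finite E" "E \<subseteq> exponents I" "f = monomial_sum I E c"
    using monomial_sum_expansion[OF assms] by auto
  have "monomial_sum I E c = monomial_sum I {\<alpha> \<in> E. c \<alpha> \<noteq> 0} c"
    unfolding monomial_sum_def using E(1) by (intro ext sum.mono_neutral_right) auto
  with E show ?thesis
    by (intro that[of "{\<alpha> \<in> E. c \<alpha> \<noteq> 0}" c]) auto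
qed

section \<open>Separating orders of generators\<close>

definition separable_over ::
    "('z \<Rightarrow> 'k::field) set \<Rightarrow> 'z set \<Rightarrow> ('z \<Rightarrow> 'k) \<Rightarrow> bool" where
  "separable_over A V y \<longleftrightarrow>
     (\<exists>G\<in>poly_family A. (\<forall>z\<in>V. poly (G z) (y z) = 0) \<and> (\<exists>z\<in>V. poly (pderiv (G z)) (y z) \<noteq> 0))"

definition transcendental_over ::
    "('z \<Rightarrow> 'k::field) set \<Rightarrow> 'z set \<Rightarrow> ('z \<Rightarrow> 'k) \<Rightarrow> bool" where
  "transcendental_over A V y \<longleftrightarrow>
     (\<forall>G\<in>poly_family A. (\<forall>z\<in>V. poly (G z) (y z) = 0) \<longrightarrow> (\<forall>z\<in>V. G z = 0))"

text \<open>
  Coefficients are nonzero on the nonempty set \<open>E\<close>, so this is a relation given by a nonzero formal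
  polynomial.
\<close>

definition monomial_relation ::
    "nat set \<Rightarrow> (nat \<Rightarrow> 'k::comm_ring_1) set \<Rightarrow> (nat \<Rightarrow> nat) set \<Rightarrow> ((nat \<Rightarrow> nat) \<Rightarrow> 'k) \<Rightarrow> bool" where
  "monomial_relation I V E c \<longleftrightarrow>
     finite E \<and> E \<noteq> {} \<and> E \<subseteq> exponents I \<and> (\<forall>\<alpha>\<in>E. c \<alpha> \<noteq> 0) \<and> (\<forall>z\<in>V. monomial_sum I E c z = 0)"

text \<open>
  The sum of all exponents takes the place of the degree: formal derivatives and \<open>p\<close>-th roots lower
  it as well, and it needs no maximum.
\<close>

definition exponent_weight :: "nat set \<Rightarrow> (nat \<Rightarrow> nat) set \<Rightarrow> nat" where
  "exponent_weight I E = (\<Sum>\<alpha>\<in>E. \<Sum>i\<in>I. \<alpha> i)"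

text \<open>
  A relation of weight zero would be a nonzero constant.
\<close>

lemma exponent_weight_pos:
  assumes I: "finite I" and V: "V \<noteq> {}" and R: "monomial_relation I V E c"
  shows "exponent_weight I E > 0"
proof (rule ccontr)
  assume "\<not> ?thesis"
  then have "\<forall>\<alpha>\<in>E. \<forall>i\<in>I. \<alpha> i = 0"
    using I R unfolding exponent_weight_def monomial_relation_def by (auto simp: sum_nonneg_eq_0_iff)
  then have "\<forall>\<alpha>\<in>E. \<alpha> = (\<lambda>_. 0)"
    using R unfolding monomial_relation_def exponents_def by blast
  then have "E \<subseteq> {\<lambda>_. 0}" by auto
  then have "E = {\<lambda>_. 0}"
    using R subset_singletonD unfolding monomial_relation_def by fast
  then show False
    using R V unfolding monomial_relation_def monomial_sum_def by auto
qed

text \<open>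
  Over a perfect field a polynomial all of whose partial derivatives vanish is a \<open>p\<close>-th power, and
  its root is a relation of smaller weight. So a relation of least weight has a nonzero partial
  derivative.
\<close>

lemma least_relation_has_derivative:
  fixes V :: "(nat \<Rightarrow> 'k::alg_closed_field) set"
  assumes I: "finite I" and V: "V \<noteq> {}" and R: "monomial_relation I V E c"
    and least: "\<And>E' c'. monomial_relation I V E' c' \<Longrightarrow> exponent_weight I E \<le> exponent_weight I E'"
  shows "\<exists>\<alpha>\<in>E. \<exists>i\<in>I. of_nat (\<alpha> i) \<noteq> (0::'k)"
proof (rule ccontr)
  assume "\<not> ?thesis"
  then have 0: "of_nat (\<alpha> i) = (0::'k)" if "\<alpha> \<in> E" "i \<in> I" for \<alpha> i
    using that by auto
  define p where "p = CHAR('k)"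
  have dvd: "p dvd \<alpha> i" if "\<alpha> \<in> E" for \<alpha> i
    using 0[OF that, of i] R that
    by (cases "i \<in> I") (auto simp: p_def of_nat_eq_0_iff_char_dvd monomial_relation_def exponents_def)
  have pos: "exponent_weight I E > 0"
    using exponent_weight_pos[OF I V R] .
  have "p \<noteq> 0"
  proof
    assume "p = 0"
    then have "exponent_weight I E = 0"
      using dvd by (auto simp: exponent_weight_def intro!: sum.neutral)
    with pos show False by simp
  qed
  then have p: "prime p"
    unfolding p_def by (intro prime_CHAR_semidom) auto
  define \<tau> where "\<tau> = (\<lambda>\<alpha>::nat \<Rightarrow> nat. \<lambda>i. \<alpha> i div p)"
  have \<tau>: "p * \<tau> \<alpha> i = \<alpha> i" if "\<alpha> \<in> E" for \<alpha> i
    using dvd[OF that] by (simp add: \<tau>_def)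
  have inj: "inj_on \<tau> E"
    by (rule inj_onI) (metis \<tau> ext)
  have "\<exists>b. b ^ p = c (\<lambda>i. p * \<beta> i)" for \<beta>
    using p by (intro nth_root_exists) (simp add: prime_gt_0_nat)
  then obtain c' where c': "\<And>\<beta>. c' \<beta> ^ p = c (\<lambda>i. p * \<beta> i)" by metis
  have c'\<tau>: "c' (\<tau> \<alpha>) ^ p = c \<alpha>" if "\<alpha> \<in> E" for \<alpha>
    using \<tau>[OF that] by (simp add: c')
  have root: "monomial_sum I (\<tau> ` E) c' z ^ p = monomial_sum I E c z" for z
  proof -
    have "monomial_sum I (\<tau> ` E) c' z = (\<Sum>\<alpha>\<in>E. c' (\<tau> \<alpha>) * (\<Prod>i\<in>I. z i ^ \<tau> \<alpha> i))"
      unfolding monomial_sum_def using inj by (simp add: sum.reindex)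
    then have "monomial_sum I (\<tau> ` E) c' z ^ p = (\<Sum>\<alpha>\<in>E. (c' (\<tau> \<alpha>) * (\<Prod>i\<in>I. z i ^ \<tau> \<alpha> i)) ^ p)"
      using p by (simp add: p_def freshmans_dream_sum)
    also have "\<dots> = (\<Sum>\<alpha>\<in>E. c \<alpha> * (\<Prod>i\<in>I. z i ^ (p * \<tau> \<alpha> i)))"
      by (intro sum.cong)
         (simp_all add: power_mult_distrib c'\<tau> prod_power_distrib mult.commute[of p] power_mult)
    also have "\<dots> = monomial_sum I E c z"
      unfolding monomial_sum_def by (intro sum.cong) (simp_all add: \<tau>)
    finally show ?thesis .
  qed
  have "monomial_relation I V (\<tau> ` E) c'"
    unfolding monomial_relation_def
  proof (intro conjI ballI)
    show "finite (\<tau> ` E)" "\<tau> ` E \<noteq> {}" "\<tau> ` E \<subseteq> exponents I"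
      using R by (auto simp: monomial_relation_def exponents_def \<tau>_def)
    show "c' \<beta> \<noteq> 0" if "\<beta> \<in> \<tau> ` E" for \<beta>
    proof -
      obtain \<alpha> where "\<alpha> \<in> E" "\<beta> = \<tau> \<alpha>" using \<open>\<beta> \<in> \<tau> ` E\<close> by auto
      then have "c' \<beta> ^ p \<noteq> 0"
        using R c'\<tau>[of \<alpha>] by (simp add: monomial_relation_def)
      then show ?thesis using \<open>p \<noteq> 0\<close> by (auto simp: power_0_left)
    qed
    show "monomial_sum I (\<tau> ` E) c' z = 0" if "z \<in> V" for z
      using root[of z] R that \<open>p \<noteq> 0\<close> by (auto simp: monomial_relation_def)
  qed
  then have "exponent_weight I E \<le> exponent_weight I (\<tau> ` E)"
    by (rule least)
  moreover have "exponent_weight I E = p * exponent_weight I (\<tau> ` E)"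
    unfolding exponent_weight_def using inj
    by (simp add: sum.reindex sum_distrib_left \<tau>)
  ultimately show False
    using pos prime_gt_1_nat[OF p] by (auto simp: mult_le_cancel2)
qed

text \<open>
  The partial derivative is itself a nonzero polynomial of smaller weight, so it does not vanish
  on \<open>V\<close>, which makes the relation a separable equation for the variable in question.
\<close>

lemma separable_of_least_relation:
  fixes V :: "(nat \<Rightarrow> 'k::alg_closed_field) set"
  assumes I: "finite I" and R: "monomial_relation I V E c"
    and least: "\<And>E' c'. monomial_relation I V E' c' \<Longrightarrow> exponent_weight I E \<le> exponent_weight I E'"
    and \<alpha>0: "\<alpha>0 \<in> E" and i: "i \<in> I" and ne: "of_nat (\<alpha>0 i) \<noteq> (0::'k)"
  shows "separable_over (polys (I - {i})) V (\<lambda>z. z i)"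
proof -
  interpret function_algebra "polys (I - {i}) :: ((nat \<Rightarrow> 'k) \<Rightarrow> 'k) set"
    by (rule function_algebra_polys)
  have fin: "finite E" using R by (simp add: monomial_relation_def)
  define m where "m = (\<lambda>\<alpha>. \<lambda>z::nat \<Rightarrow> 'k. \<Prod>j\<in>I - {i}. z j ^ \<alpha> j)"
  define G where "G = (\<lambda>z. \<Sum>\<alpha>\<in>E. monom (c \<alpha> * m \<alpha> z) (\<alpha> i))"
  have G: "G \<in> poly_family (polys (I - {i}))"
    unfolding G_def m_def
    by (intro poly_family_sum poly_family_monom mult const prod power coord_in_polys)
  have split: "(\<Prod>j\<in>I. z j ^ \<alpha> j) = z i ^ \<alpha> i * m \<alpha> z" for \<alpha> z
    unfolding m_def using I i by (rule prod.remove)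
  have val: "poly (G z) (z i) = monomial_sum I E c z" for z
    unfolding G_def monomial_sum_def split by (simp add: poly_sum poly_monom algebra_simps)
  define E1 where "E1 = {\<alpha> \<in> E. of_nat (\<alpha> i) \<noteq> (0::'k)}"
  define \<tau> where "\<tau> = (\<lambda>\<alpha>::nat \<Rightarrow> nat. \<alpha>(i := \<alpha> i - 1))"
  define c' where "c' = (\<lambda>\<beta>. of_nat (Suc (\<beta> i)) * c (\<beta>(i := Suc (\<beta> i))))"
  have pos: "\<alpha> i > 0" if "\<alpha> \<in> E1" for \<alpha>
    using that by (cases "\<alpha> i") (auto simp: E1_def)
  have restore: "(\<tau> \<alpha>)(i := Suc (\<tau> \<alpha> i)) = \<alpha>" if "\<alpha> \<in> E1" for \<alpha>
    using pos[OF that] by (auto simp: \<tau>_def)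
  have inj: "inj_on \<tau> E1"
    by (rule inj_onI) (metis restore)
  have c': "c' (\<tau> \<alpha>) = of_nat (\<alpha> i) * c \<alpha>" if "\<alpha> \<in> E1" for \<alpha>
    unfolding c'_def restore[OF that] using pos[OF that] by (simp add: \<tau>_def)
  have m\<tau>: "m (\<tau> \<alpha>) z = m \<alpha> z" for \<alpha> z
    unfolding m_def \<tau>_def by (intro prod.cong) auto
  have der: "poly (pderiv (G z)) (z i) = monomial_sum I (\<tau> ` E1) c' z" for z
  proof -
    have "poly (pderiv (G z)) (z i) = (\<Sum>\<alpha>\<in>E. of_nat (\<alpha> i) * (c \<alpha> * m \<alpha> z) * z i ^ (\<alpha> i - 1))"
      unfolding G_def by (simp add: higher_pderiv_sum[where n = 1, simplified] pderiv_monom poly_sum poly_monom)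
    also have "\<dots> = (\<Sum>\<alpha>\<in>E1. of_nat (\<alpha> i) * (c \<alpha> * m \<alpha> z) * z i ^ (\<alpha> i - 1))"
      using fin by (intro sum.mono_neutral_right) (auto simp: E1_def)
    also have "\<dots> = (\<Sum>\<alpha>\<in>E1. c' (\<tau> \<alpha>) * (z i ^ \<tau> \<alpha> i * m (\<tau> \<alpha>) z))"
      by (intro sum.cong) (simp_all add: c' m\<tau>, simp add: \<tau>_def algebra_simps)
    also have "\<dots> = monomial_sum I (\<tau> ` E1) c' z"
      unfolding monomial_sum_def split using inj by (simp add: sum.reindex)
    finally show ?thesis .
  qed
  have "\<exists>z\<in>V. poly (pderiv (G z)) (z i) \<noteq> 0"
  proof (rule ccontr)
    assume "\<not> ?thesis"
    moreover have "c' \<beta> \<noteq> 0" if "\<beta> \<in> \<tau> ` E1" for \<beta>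
      using that R by (auto simp: c' E1_def monomial_relation_def)
    moreover have "\<tau> ` E1 \<subseteq> exponents I"
      using R i by (auto simp: E1_def monomial_relation_def exponents_def \<tau>_def subset_iff
          split: if_splits)
    ultimately have "monomial_relation I V (\<tau> ` E1) c'"
      unfolding monomial_relation_def using \<alpha>0 ne fin by (auto simp: der E1_def)
    then have "exponent_weight I E \<le> exponent_weight I (\<tau> ` E1)"
      by (rule least)
    also have "\<dots> = (\<Sum>\<alpha>\<in>E1. \<Sum>j\<in>I. \<tau> \<alpha> j)"
      unfolding exponent_weight_def using inj by (simp add: sum.reindex)
    also have "\<dots> < (\<Sum>\<alpha>\<in>E1. \<Sum>j\<in>I. \<alpha> j)"
    proof (rule sum_strict_mono)
      show "finite E1" "E1 \<noteq> {}" using fin \<alpha>0 ne by (auto simp: E1_def)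
      show "(\<Sum>j\<in>I. \<tau> \<alpha> j) < (\<Sum>j\<in>I. \<alpha> j)" if "\<alpha> \<in> E1" for \<alpha>
        using I i pos[OF that] by (intro sum_strict_mono_ex1) (auto simp: \<tau>_def)
    qed
    also have "\<dots> \<le> exponent_weight I E"
      unfolding exponent_weight_def using fin by (intro sum_mono2) (auto simp: E1_def)
    finally show False by simp
  qed
  moreover have "\<forall>z\<in>V. poly (G z) (z i) = 0"
    using R by (auto simp: val monomial_relation_def)
  ultimately show ?thesis
    unfolding separable_over_def using G by blast
qed

definition separating_order :: "(nat \<Rightarrow> 'k::field) set \<Rightarrow> nat list \<Rightarrow> bool" where
  "separating_order V xs \<longleftrightarrow> distinct xs \<and>
     (\<forall>i<length xs. separable_over (polys (set (take i xs))) V (\<lambda>z. z (xs ! i)) \<or>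
        transcendental_over (polys (set (take i xs))) V (\<lambda>z. z (xs ! i)))"

lemma separating_order_snoc:
  "separating_order V (xs @ [i]) \<longleftrightarrow> separating_order V xs \<and> i \<notin> set xs \<and>
     (separable_over (polys (set xs)) V (\<lambda>z. z i) \<or> transcendental_over (polys (set xs)) V (\<lambda>z. z i))"
  unfolding separating_order_def by (auto simp: nth_append less_Suc_eq)

text \<open>
  A relation for \<open>z i\<close> is a polynomial that vanishes on \<open>V\<close>, hence everywhere; its coefficients do
  not involve \<open>z i\<close>, which can then be varied freely.
\<close>

lemma transcendental_of_independent:
  fixes V :: "(nat \<Rightarrow> 'k::alg_closed_field) set"
  assumes indep: "\<And>g. g \<in> polys I \<Longrightarrow> \<forall>z\<in>V. g z = 0 \<Longrightarrow> \<forall>z. g z = 0"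
    and J: "J \<subseteq> I" and i: "i \<in> I" "i \<notin> J"
  shows "transcendental_over (polys J) V (\<lambda>z. z i)"
  unfolding transcendental_over_def
proof (intro ballI impI)
  fix G z assume G: "G \<in> poly_family (polys J)" and 0: "\<forall>z\<in>V. poly (G z) (z i) = 0"
  interpret function_algebra "polys I :: ((nat \<Rightarrow> 'k) \<Rightarrow> 'k) set"
    by (rule function_algebra_polys)
  have "(\<lambda>z. poly (G z) (z i)) \<in> polys I"
    by (rule poly_family_eval[OF G polys_mono[OF J] coord_in_polys[OF i(1)]])
  then have van: "\<forall>z. poly (G z) (z i) = 0"
    using indep 0 by blast
  have "poly (G z) t = 0" for t
  proof -
    have "G (z(i := t)) = G z"
      by (rule poly_family_polys_local[OF G]) (use i in auto)
    then show ?thesis using van[rule_format, of "z(i := t)"] by simp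
  qed
  then show "G z = 0"
    by (intro poly_zero_of_cofinite_roots[of "{}"]) auto
qed

text \<open>
  This is the theorem of F. K. Schmidt that a finitely generated field over a perfect field is
  separably generated: if the variables in \<open>I\<close> satisfy a relation on \<open>V\<close>, one of them is separable
  over the others and is put last.
\<close>

lemma separating_order_exists:
  fixes V :: "(nat \<Rightarrow> 'k::alg_closed_field) set"
  assumes "finite I" and V: "V \<noteq> {}"
  shows "\<exists>xs. set xs = I \<and> separating_order V xs"
  using assms(1)
proof (induction I rule: finite_psubset_induct)
  case (psubset I)
  show ?case
  proof (cases "\<exists>E c. monomial_relation I V E c")
    case False
    have indep: "\<forall>z. g z = 0" if "g \<in> polys I" "\<forall>z\<in>V. g z = 0" for g
    proof -
      obtain E c where E: "finite E" "E \<subseteq> exponents I" "\<And>\<alpha>. \<alpha> \<in> E \<Longrightarrow> c \<alpha> \<noteq> 0"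
        "g = monomial_sum I E c"
        using monomial_sum_expansion_nonzero[OF \<open>finite I\<close> \<open>g \<in> polys I\<close>] by metis
      then have "E = {}"
        using False \<open>\<forall>z\<in>V. g z = 0\<close> unfolding monomial_relation_def by metis
      then show ?thesis
        using E(4) by (simp add: monomial_sum_def)
    qed
    obtain xs where xs: "set xs = I" "distinct xs"
      using finite_distinct_list[OF \<open>finite I\<close>] by blast
    have "transcendental_over (polys (set (take i xs))) V (\<lambda>z. z (xs ! i))" if "i < length xs" for i
    proof (rule transcendental_of_independent[OF indep])
      show "set (take i xs) \<subseteq> I" using xs set_take_subset by fast
      show "xs ! i \<in> I" using xs that by auto
      show "xs ! i \<notin> set (take i xs)"
        using xs(2) that by (auto simp: in_set_conv_nth nth_eq_iff_index_eq)
    qed auto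
    then show ?thesis
      using xs unfolding separating_order_def by blast
  next
    case True
    then obtain E c where R: "monomial_relation I V E c"
      and least: "\<And>E' c'. monomial_relation I V E' c' \<Longrightarrow> exponent_weight I E \<le> exponent_weight I E'"
      using ex_has_least_nat[of "\<lambda>(E, c). monomial_relation I V E c" _ "\<lambda>(E, c). exponent_weight I E"]
      by (metis (no_types, lifting) case_prod_conv surj_pair)
    obtain \<alpha> i where i: "\<alpha> \<in> E" "i \<in> I" "of_nat (\<alpha> i) \<noteq> (0::'k)"
      using least_relation_has_derivative[OF \<open>finite I\<close> V R] least by metis
    have sep: "separable_over (polys (I - {i})) V (\<lambda>z. z i)"
      by (rule separable_of_least_relation[OF \<open>finite I\<close> R _ i]) (rule least)
    have "I - {i} \<subset> I" using i by auto
    then obtain xs where "set xs = I - {i}" "separating_order V xs"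
      using psubset.IH by blast
    then have "set (xs @ [i]) = I \<and> separating_order V (xs @ [i])"
      using sep i by (auto simp: separating_order_snoc)
    then show ?thesis by blast
  qed
qed

section \<open>Triangular local equations\<close>

text \<open>
  The algebraic form of irreducibility: the restrictions of the functions to \<open>V\<close> have no zero
  divisors.
\<close>

definition integral_on :: "'z set \<Rightarrow> ('z \<Rightarrow> 'k::comm_ring_1) set \<Rightarrow> bool" where
  "integral_on V B \<longleftrightarrow>
     (\<forall>f\<in>B. \<forall>g\<in>B. (\<forall>z\<in>V. f z * g z = 0) \<longrightarrow> (\<forall>z\<in>V. f z = 0) \<or> (\<forall>z\<in>V. g z = 0))"

lemma integral_onD:
  "integral_on V B \<Longrightarrow> f \<in> B \<Longrightarrow> g \<in> B \<Longrightarrow> (\<And>z. z \<in> V \<Longrightarrow> f z * g z = 0) \<Longrightarrow>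
     (\<forall>z\<in>V. f z = 0) \<or> (\<forall>z\<in>V. g z = 0)"
  unfolding integral_on_def by blast

lemma integral_on_mono: "integral_on V B \<Longrightarrow> A \<subseteq> B \<Longrightarrow> integral_on V A"
  unfolding integral_on_def by blast

lemma integral_on_nonzero:
  assumes "integral_on V B" "f \<in> B" "g \<in> B" "\<exists>z\<in>V. f z \<noteq> 0" "\<exists>z\<in>V. g z \<noteq> 0"
  shows "\<exists>z\<in>V. f z * g z \<noteq> 0"
  using integral_onD[OF assms(1-3)] assms(4,5) by blast

lemma poly_family_pderiv:
  fixes A :: "('z \<Rightarrow> 'k::field) set"
  assumes A: "function_algebra A" and G: "G \<in> poly_family A"
  shows "(\<lambda>z. pderiv (G z)) \<in> poly_family A"
proof -
  interpret function_algebra A by fact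
  obtain N where N: "\<And>z. degree (G z) \<le> N"
    using G unfolding poly_family_def by auto
  have "degree (pderiv (G z)) \<le> N" for z
    by (rule degree_le) (use N[of z] in \<open>auto simp: coeff_pderiv coeff_eq_0\<close>)
  moreover have "(\<lambda>z. coeff (pderiv (G z)) j) \<in> A" for j
    unfolding coeff_pderiv using G by (intro mult const poly_family_coeff)
  ultimately show ?thesis unfolding poly_family_def by blast
qed

text \<open>
  The minimal polynomial of \<open>y\<close> over the fraction field of \<open>A\<close> with its denominators cleared. Its
  leading coefficient may vanish at some points of \<open>V\<close>, so \<open>d\<close> is not the degree of every \<open>f z\<close>.
\<close>

definition minimal_relation ::
    "('z \<Rightarrow> 'k::field) set \<Rightarrow> 'z set \<Rightarrow> ('z \<Rightarrow> 'k) \<Rightarrow> nat \<Rightarrow> ('z \<Rightarrow> 'k poly) \<Rightarrow> bool" where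
  "minimal_relation A V y d f \<longleftrightarrow>
     f \<in> poly_family A \<and> (\<forall>z\<in>V. poly (f z) (y z) = 0) \<and> (\<exists>z\<in>V. coeff (f z) d \<noteq> 0) \<and>
     (\<forall>z. \<forall>j>d. coeff (f z) j = 0) \<and>
     (\<forall>G\<in>poly_family A. (\<forall>z\<in>V. poly (G z) (y z) = 0) \<longrightarrow> (\<forall>z. \<forall>j\<ge>d. coeff (G z) j = 0) \<longrightarrow>
        (\<forall>z\<in>V. G z = 0))"

lemma minimal_relation_exists:
  assumes A: "function_algebra A" and G: "G \<in> poly_family A"
    and rel: "\<forall>z\<in>V. poly (G z) (y z) = 0" and ne: "\<exists>z\<in>V. G z \<noteq> 0"
  shows "\<exists>d f. minimal_relation A V y d f"
proof -
  interpret function_algebra A by fact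
  define P where "P d \<longleftrightarrow> (\<exists>f\<in>poly_family A. (\<forall>z\<in>V. poly (f z) (y z) = 0) \<and>
      (\<forall>z. \<forall>j\<ge>d. coeff (f z) j = 0) \<and> (\<exists>z\<in>V. f z \<noteq> 0))" for d
  obtain N where "\<And>z. degree (G z) \<le> N"
    using G unfolding poly_family_def by auto
  then have "\<forall>z. \<forall>j\<ge>Suc N. coeff (G z) j = 0"
    by (meson coeff_eq_0 le_less_trans not_less_eq_eq not_le)
  then have "P (Suc N)"
    unfolding P_def using G rel ne by blast
  then obtain m where m: "P m" "\<And>k. k < m \<Longrightarrow> \<not> P k"
    using exists_least_iff[of P] by blast
  have "m \<noteq> 0"
    using m(1) unfolding P_def by (metis leading_coeff_0_iff zero_le)
  then obtain d where d: "m = Suc d" by (cases m) auto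
  obtain f where f: "f \<in> poly_family A" "\<forall>z\<in>V. poly (f z) (y z) = 0"
      "\<forall>z. \<forall>j\<ge>Suc d. coeff (f z) j = 0" "\<exists>z\<in>V. f z \<noteq> 0"
    using m(1) unfolding P_def d by blast
  have notP: "\<forall>z\<in>V. g z = 0" if "g \<in> poly_family A" "\<forall>z\<in>V. poly (g z) (y z) = 0"
      "\<forall>z. \<forall>j\<ge>d. coeff (g z) j = 0" for g
    using m(2)[of d] that unfolding P_def d by blast
  have "\<exists>z\<in>V. coeff (f z) d \<noteq> 0"
  proof (rule ccontr)
    assume "\<not> ?thesis"
    then have 0: "coeff (f z) d = 0" if "z \<in> V" for z using that by auto
    (* A leading coefficient that vanishes on V can be dropped, which shortens the relation. *)
    define g where "g = (\<lambda>z. f z - monom (coeff (f z) d) d)"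
    have gf: "g z = f z" if "z \<in> V" for z
      using 0[OF that] by (simp add: g_def)
    have "\<forall>z\<in>V. g z = 0"
    proof (rule notP)
      show "g \<in> poly_family A"
        unfolding g_def by (intro poly_family_diff poly_family_monom poly_family_coeff f)
      show "\<forall>z\<in>V. poly (g z) (y z) = 0" using f gf by simp
      show "\<forall>z. \<forall>j\<ge>d. coeff (g z) j = 0"
      proof (intro allI impI)
        fix z j assume "d \<le> j"
        then show "coeff (g z) j = 0"
          using f(3) by (cases "j = d") (auto simp: g_def)
      qed
    qed
    then show False using f(4) gf by auto
  qed
  moreover have "\<forall>z. \<forall>j>d. coeff (f z) j = 0"
    using f(3) Suc_leI by blast
  ultimately have "minimal_relation A V y d f"
    unfolding minimal_relation_def using f notP by blast
  then show ?thesis by blast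
qed

text \<open>
  Division by \<open>f\<close> without inverting its leading coefficient: the terms of degree \<open>n\<close> cancel.
\<close>

lemma pseudo_division_step:
  fixes f G :: "'z \<Rightarrow> 'k::field poly"
  assumes A: "function_algebra A" and f: "f \<in> poly_family A" "\<forall>z. \<forall>j>d. coeff (f z) j = 0"
    and G: "G \<in> poly_family A" "\<forall>z. \<forall>j\<ge>Suc n. coeff (G z) j = 0" and "d \<le> n"
  defines "H \<equiv> \<lambda>z. smult (coeff (f z) d) (G z) - monom (coeff (G z) n) (n - d) * f z"
  shows "H \<in> poly_family A" and "\<forall>z. \<forall>j\<ge>n. coeff (H z) j = 0"
proof -
  interpret function_algebra A by fact
  show "H \<in> poly_family A"
    unfolding H_def using f(1) G(1)
    by (intro poly_family_diff poly_family_smult poly_family_mult poly_family_monom poly_family_coeff)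
  show "\<forall>z. \<forall>j\<ge>n. coeff (H z) j = 0"
  proof (intro allI impI)
    fix z j assume "j \<ge> n"
    show "coeff (H z) j = 0"
    proof (cases "j = n")
      case True
      then show ?thesis using \<open>d \<le> n\<close> by (simp add: H_def coeff_monom_mult)
    next
      case False
      then have "coeff (G z) j = 0" "coeff (f z) (j - (n - d)) = 0"
        using \<open>j \<ge> n\<close> \<open>d \<le> n\<close> f(2) G(2) by auto
      then show ?thesis by (simp add: H_def coeff_monom_mult)
    qed
  qed
qed

text \<open>
  By pseudo-division every relation becomes a multiple of the minimal one after multiplication by a
  power of the leading coefficient; if the derivative of the minimal relation vanished at \<open>y\<close>, so
  would that of every other.
\<close>

lemma minimal_relation_separable:
  assumes A: "function_algebra A" and B: "function_algebra B" "A \<subseteq> B" "y \<in> B" "integral_on V B"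
    and min: "minimal_relation A V y d f" and sep: "separable_over A V y"
  shows "\<exists>z\<in>V. poly (pderiv (f z)) (y z) \<noteq> 0"
proof (rule ccontr)
  assume "\<not> ?thesis"
  then have f': "poly (pderiv (f z)) (y z) = 0" if "z \<in> V" for z using that by auto
  interpret function_algebra A by fact
  interpret B: function_algebra B by fact
  note f = min[unfolded minimal_relation_def]
  have der: "\<forall>z\<in>V. poly (pderiv (G z)) (y z) = 0"
    if "G \<in> poly_family A" "\<forall>z\<in>V. poly (G z) (y z) = 0" "\<forall>z. \<forall>j\<ge>N. coeff (G z) j = 0" for G N
    using that
  proof (induction N arbitrary: G)
    case 0
    then have "G z = 0" for z by (intro poly_eqI) auto
    then show ?case by simp
  next
    case (Suc n)
    show ?case
    proof (cases "d \<le> n")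
      case False
      then have "\<forall>z. \<forall>j\<ge>d. coeff (G z) j = 0" using Suc.prems(3) by auto
      then have "\<forall>z\<in>V. G z = 0" using f Suc.prems by blast
      then show ?thesis by simp
    next
      case True
      define H where "H = (\<lambda>z. smult (coeff (f z) d) (G z) - monom (coeff (G z) n) (n - d) * f z)"
      have H: "H \<in> poly_family A" "\<forall>z. \<forall>j\<ge>n. coeff (H z) j = 0"
        using pseudo_division_step[OF A _ _ Suc.prems(1,3) True] f unfolding H_def by auto
      have "\<forall>z\<in>V. poly (H z) (y z) = 0"
        using f Suc.prems(2) by (simp add: H_def)
      then have "\<forall>z\<in>V. poly (pderiv (H z)) (y z) = 0"
        using Suc.IH H by blast
      then have 0: "coeff (f z) d * poly (pderiv (G z)) (y z) = 0" if "z \<in> V" for z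
        using f f' that by (simp add: H_def pderiv_diff pderiv_mult pderiv_smult)
      have "(\<lambda>z. poly (pderiv (G z)) (y z)) \<in> B"
        using B.poly_family_eval[OF poly_family_pderiv[OF A Suc.prems(1)] B(2,3)] .
      moreover have "(\<lambda>z. coeff (f z) d) \<in> B"
        using f B(2) poly_family_coeff by blast
      ultimately have "(\<forall>z\<in>V. coeff (f z) d = 0) \<or> (\<forall>z\<in>V. poly (pderiv (G z)) (y z) = 0)"
        using 0 by (intro integral_onD[OF B(4)]) auto
      then show ?thesis using f by auto
    qed
  qed
  obtain G where G: "G \<in> poly_family A" "\<forall>z\<in>V. poly (G z) (y z) = 0"
      "\<exists>z\<in>V. poly (pderiv (G z)) (y z) \<noteq> 0"
    using sep unfolding separable_over_def by blast
  obtain N where "\<And>z. degree (G z) \<le> N"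
    using G unfolding poly_family_def by auto
  then have "\<forall>z. \<forall>j\<ge>Suc N. coeff (G z) j = 0"
    by (meson coeff_eq_0 le_less_trans not_less_eq_eq not_le)
  then show False using der G by blast
qed

text \<open>
  The functions that lie in some ideal after localisation at \<open>z0\<close>. Saturation stands for dividing by
  functions that do not vanish at \<open>z0\<close>, so no fractions are formed.
\<close>

locale local_ideal = function_algebra B for B :: "('z \<Rightarrow> 'k::field) set" +
  fixes z0 :: 'z and L :: "('z \<Rightarrow> 'k) set"
  assumes zero: "(\<lambda>_. 0) \<in> L"
    and ideal_add: "f \<in> L \<Longrightarrow> g \<in> L \<Longrightarrow> (\<lambda>z. f z + g z) \<in> L"
    and ideal_mult: "b \<in> B \<Longrightarrow> f \<in> L \<Longrightarrow> (\<lambda>z. b z * f z) \<in> L"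
    and saturated: "c \<in> B \<Longrightarrow> c z0 \<noteq> 0 \<Longrightarrow> (\<lambda>z. c z * f z) \<in> L \<Longrightarrow> f \<in> L"
begin

lemma ideal_sum: "(\<And>i. i \<in> I \<Longrightarrow> f i \<in> L) \<Longrightarrow> (\<lambda>z. \<Sum>i\<in>I. f i z) \<in> L"
  by (induction I rule: infinite_finite_induct) (auto intro: zero ideal_add)

lemma poly_family_eval_ideal:
  assumes G: "G \<in> poly_family A" and coeffs: "\<And>j. (\<lambda>z. coeff (G z) j) \<in> L" and y: "y \<in> B"
  shows "(\<lambda>z. poly (G z) (y z)) \<in> L"
proof -
  obtain N where N: "\<And>z. degree (G z) \<le> N"
    using G unfolding poly_family_def by auto
  have "(\<lambda>z. y z ^ j * coeff (G z) j) \<in> L" for j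
    by (intro ideal_mult power y coeffs)
  then show ?thesis
    unfolding poly_altdef_bound[OF N] by (intro ideal_sum) (simp add: mult.commute)
qed

text \<open>
  The remainder of pseudo-division by the minimal relation has degree below \<open>d\<close>, so its coefficients
  vanish on \<open>V\<close> and so lie in \<open>L\<close>. The powers of the leading coefficient are divided out at \<open>z0\<close>.
\<close>

lemma reduction:
  assumes A: "function_algebra A" "A \<subseteq> B" and y: "y \<in> B"
    and vanish: "\<And>a. a \<in> A \<Longrightarrow> \<forall>z\<in>V. a z = 0 \<Longrightarrow> a \<in> L"
    and min: "minimal_relation A V y d f"
    and fL: "(\<lambda>z. poly (f z) (y z)) \<in> L" and lead: "coeff (f z0) d \<noteq> 0"
    and G: "G \<in> poly_family A" "\<forall>z\<in>V. poly (G z) (y z) = 0"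
  shows "(\<lambda>z. poly (G z) (y z)) \<in> L"
proof -
  note f = min[unfolded minimal_relation_def]
  interpret A: function_algebra A by fact
  have main: "(\<lambda>z. poly (G z) (y z)) \<in> L"
    if "G \<in> poly_family A" "\<forall>z\<in>V. poly (G z) (y z) = 0" "\<forall>z. \<forall>j\<ge>N. coeff (G z) j = 0" for G N
    using that
  proof (induction N arbitrary: G)
    case 0
    then have "G z = 0" for z by (intro poly_eqI) auto
    then show ?case by (simp add: zero)
  next
    case (Suc n)
    show ?case
    proof (cases "d \<le> n")
      case False
      then have "\<forall>z. \<forall>j\<ge>d. coeff (G z) j = 0" using Suc.prems(3) by auto
      then have "\<forall>z\<in>V. G z = 0" using f Suc.prems by blast
      then have "(\<lambda>z. coeff (G z) j) \<in> L" for j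
        by (intro vanish poly_family_coeff Suc.prems) auto
      then show ?thesis
        by (intro poly_family_eval_ideal[OF Suc.prems(1)] y)
    next
      case True
      define H where "H = (\<lambda>z. smult (coeff (f z) d) (G z) - monom (coeff (G z) n) (n - d) * f z)"
      have H: "H \<in> poly_family A" "\<forall>z. \<forall>j\<ge>n. coeff (H z) j = 0"
        using pseudo_division_step[OF A(1) _ _ Suc.prems(1,3) True] f unfolding H_def by auto
      have "\<forall>z\<in>V. poly (H z) (y z) = 0"
        using f Suc.prems(2) by (simp add: H_def)
      then have HL: "(\<lambda>z. poly (H z) (y z)) \<in> L"
        using Suc.IH H by blast
      have "(\<lambda>z. coeff (G z) n * y z ^ (n - d)) \<in> B"
        using Suc.prems(1) A(2) y by (intro mult power) (auto dest: poly_family_coeff)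
      from ideal_add[OF HL ideal_mult[OF this fL]]
      have cL: "(\<lambda>z. coeff (f z) d * poly (G z) (y z)) \<in> L"
        by (simp add: H_def poly_monom)
      have cB: "(\<lambda>z. coeff (f z) d) \<in> B"
        using f A(2) poly_family_coeff by blast
      show ?thesis
        by (rule saturated[OF cB lead cL])
    qed
  qed
  obtain N where "\<And>z. degree (G z) \<le> N"
    using G unfolding poly_family_def by auto
  then have "\<forall>z. \<forall>j\<ge>Suc N. coeff (G z) j = 0"
    by (meson coeff_eq_0 le_less_trans not_less_eq_eq not_le)
  then show ?thesis using main G by blast
qed

end

lemma local_ideal_pullback:
  assumes "local_ideal B z0 L" and A: "function_algebra A" and p: "\<And>f. f \<in> A \<Longrightarrow> (\<lambda>z. f (p z)) \<in> B"
  shows "local_ideal A (p z0) {f. (\<lambda>z. f (p z)) \<in> L}"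
proof -
  interpret local_ideal B z0 L by fact
  interpret A: function_algebra A by fact
  show ?thesis
  proof
    show "(\<lambda>_. 0) \<in> {f. (\<lambda>z. f (p z)) \<in> L}" by (simp add: zero)
    show "(\<lambda>y. f y + g y) \<in> {f. (\<lambda>z. f (p z)) \<in> L}"
      if "f \<in> {f. (\<lambda>z. f (p z)) \<in> L}" "g \<in> {f. (\<lambda>z. f (p z)) \<in> L}" for f g
      using that by (simp add: ideal_add)
    show "(\<lambda>y. b y * f y) \<in> {f. (\<lambda>z. f (p z)) \<in> L}"
      if "b \<in> A" "f \<in> {f. (\<lambda>z. f (p z)) \<in> L}" for b f
      using that p by (simp add: ideal_mult)
    show "f \<in> {f. (\<lambda>z. f (p z)) \<in> L}"
      if c: "c \<in> A" "c (p z0) \<noteq> 0" "(\<lambda>y. c y * f y) \<in> {f. (\<lambda>z. f (p z)) \<in> L}" for c f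
    proof -
      have "(\<lambda>z. c (p z) * f (p z)) \<in> L" using c(3) by simp
      from saturated[OF p[OF c(1)] c(2) this] show ?thesis by simp
    qed
  qed
qed

text \<open>
  The local generation condition from the definition of smoothness, as a set of functions. They are
  compared on \<open>P\<close> only.
\<close>

definition generated_ideal_at ::
    "('z \<Rightarrow> 'k::field) set \<Rightarrow> 'z set \<Rightarrow> nat \<Rightarrow> (nat \<Rightarrow> 'z \<Rightarrow> 'k) \<Rightarrow> 'z \<Rightarrow> ('z \<Rightarrow> 'k) set" where
  "generated_ideal_at B P r F z0 =
     {g. \<exists>c\<in>B. c z0 \<noteq> 0 \<and>
        (\<exists>a. (\<forall>i<r. a i \<in> B) \<and> (\<forall>p\<in>P. c p * g p = (\<Sum>i<r. a i p * F i p)))}"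

lemma generated_ideal_atI:
  assumes "c \<in> B" "c z0 \<noteq> 0" "\<And>i. i < r \<Longrightarrow> a i \<in> B"
    "\<And>p. p \<in> P \<Longrightarrow> c p * g p = (\<Sum>i<r. a i p * F i p)"
  shows "g \<in> generated_ideal_at B P r F z0"
  unfolding generated_ideal_at_def using assms by (auto intro!: bexI[of _ c] exI[of _ a])

lemma generated_ideal_atE:
  assumes "g \<in> generated_ideal_at B P r F z0"
  obtains c a where "c \<in> B" "c z0 \<noteq> 0" "\<And>i. i < r \<Longrightarrow> a i \<in> B"
    "\<And>p. p \<in> P \<Longrightarrow> c p * g p = (\<Sum>i<r. a i p * F i p)"
proof -
  have "\<exists>c\<in>B. c z0 \<noteq> 0 \<and>
      (\<exists>a. (\<forall>i<r. a i \<in> B) \<and> (\<forall>p\<in>P. c p * g p = (\<Sum>i<r. a i p * F i p)))"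
    using assms by (simp add: generated_ideal_at_def)
  then show thesis using that by blast
qed

lemma generated_ideal_at_cong:
  assumes "g \<in> generated_ideal_at B P r F z0" "\<And>p. p \<in> P \<Longrightarrow> g' p = g p"
  shows "g' \<in> generated_ideal_at B P r F z0"
  using assms unfolding generated_ideal_at_def by auto

lemma generator_in_generated_ideal_at:
  assumes B: "function_algebra B" and "k < r"
  shows "F k \<in> generated_ideal_at B P r F z0"
proof (rule generated_ideal_atI)
  show "(\<lambda>_. 1) \<in> B" "(\<lambda>_. if i = k then 1 else 0) \<in> B" for i
    by (rule function_algebra.const[OF B])+
  show "1 * F k p = (\<Sum>i<r. (if i = k then 1 else 0) * F i p)" for p
    using assms by (simp add: if_distrib[of "\<lambda>c. c * _"] cong: if_cong)
qed simp

lemma local_ideal_generated_ideal_at: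
  fixes B :: "('z \<Rightarrow> 'k::field) set"
  assumes B: "function_algebra B"
  shows "local_ideal B z0 (generated_ideal_at B P r F z0)"
proof -
  interpret function_algebra B by fact
  show ?thesis
  proof
    show "(\<lambda>_. 0) \<in> generated_ideal_at B P r F z0"
      by (rule generated_ideal_atI[of "\<lambda>_. 1" _ _ _ "\<lambda>_ _. 0"]) (auto intro: const)
  next
    fix f g assume f: "f \<in> generated_ideal_at B P r F z0" and g: "g \<in> generated_ideal_at B P r F z0"
    obtain c a where f: "c \<in> B" "c z0 \<noteq> 0" "\<And>i. i < r \<Longrightarrow> a i \<in> B"
      "\<And>p. p \<in> P \<Longrightarrow> c p * f p = (\<Sum>i<r. a i p * F i p)"
      using f by (rule generated_ideal_atE) blast
    obtain d b where g: "d \<in> B" "d z0 \<noteq> 0" "\<And>i. i < r \<Longrightarrow> b i \<in> B"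
      "\<And>p. p \<in> P \<Longrightarrow> d p * g p = (\<Sum>i<r. b i p * F i p)"
      using g by (rule generated_ideal_atE) blast
    show "(\<lambda>p. f p + g p) \<in> generated_ideal_at B P r F z0"
    proof (rule generated_ideal_atI)
      show "(\<lambda>p. c p * d p) \<in> B" by (intro mult f g)
      show "c z0 * d z0 \<noteq> 0" using f g by simp
      show "(\<lambda>p. d p * a i p + c p * b i p) \<in> B" if "i < r" for i
        using that by (intro add mult f g)
      show "c p * d p * (f p + g p) = (\<Sum>i<r. (d p * a i p + c p * b i p) * F i p)" if "p \<in> P" for p
      proof -
        have "c p * d p * (f p + g p) = d p * (c p * f p) + c p * (d p * g p)"
          by (simp add: algebra_simps)
        then show ?thesis
          by (simp add: f(4)[OF that] g(4)[OF that] sum_distrib_left sum.distrib distrib_right mult.assoc)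
      qed
    qed
  next
    fix b f assume b: "b \<in> B" and f: "f \<in> generated_ideal_at B P r F z0"
    obtain c a where f: "c \<in> B" "c z0 \<noteq> 0" "\<And>i. i < r \<Longrightarrow> a i \<in> B"
      "\<And>p. p \<in> P \<Longrightarrow> c p * f p = (\<Sum>i<r. a i p * F i p)"
      using f by (rule generated_ideal_atE) blast
    show "(\<lambda>p. b p * f p) \<in> generated_ideal_at B P r F z0"
    proof (rule generated_ideal_atI[OF f(1,2)])
      show "(\<lambda>p. b p * a i p) \<in> B" if "i < r" for i using that by (intro mult b f)
      show "c p * (b p * f p) = (\<Sum>i<r. b p * a i p * F i p)" if "p \<in> P" for p
      proof -
        have "c p * (b p * f p) = b p * (c p * f p)" by simp
        then show ?thesis by (simp add: f(4)[OF that] sum_distrib_left mult.assoc)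
      qed
    qed
  next
    fix d f assume d: "d \<in> B" "d z0 \<noteq> 0" and f: "(\<lambda>p. d p * f p) \<in> generated_ideal_at B P r F z0"
    obtain c a where f: "c \<in> B" "c z0 \<noteq> 0" "\<And>i. i < r \<Longrightarrow> a i \<in> B"
      "\<And>p. p \<in> P \<Longrightarrow> c p * (d p * f p) = (\<Sum>i<r. a i p * F i p)"
      using f by (rule generated_ideal_atE) blast
    show "f \<in> generated_ideal_at B P r F z0"
      by (rule generated_ideal_atI[of "\<lambda>p. c p * d p" _ _ _ a])
         (use f d in \<open>auto intro: mult simp: mult.assoc\<close>)
  qed
qed

definition local_equation ::
    "(nat \<Rightarrow> nat) \<Rightarrow> (nat \<Rightarrow> (nat \<Rightarrow> 'k) \<Rightarrow> 'k poly) \<Rightarrow> nat \<Rightarrow> (nat \<Rightarrow> 'k) \<Rightarrow> 'k::comm_ring_1" where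
  "local_equation e G i z = poly (G i z) (z (e i))"

text \<open>
  Invariance under updates of \<open>e j\<close> says that a variable occurs neither in the coefficients of its
  own equation nor in any earlier equation.
\<close>

definition triangular_equations ::
    "nat set \<Rightarrow> (nat \<Rightarrow> 'k::field) set \<Rightarrow> nat \<Rightarrow> (nat \<Rightarrow> nat) \<Rightarrow> (nat \<Rightarrow> (nat \<Rightarrow> 'k) \<Rightarrow> 'k poly) \<Rightarrow> bool"
  where
  "triangular_equations I V r e G \<longleftrightarrow>
     (\<forall>i<r. e i \<in> I \<and> local_equation e G i \<in> polys I \<and> (\<forall>z\<in>V. local_equation e G i z = 0) \<and>
        (\<forall>z t. G i (z(e i := t)) = G i z)) \<and>
     (\<forall>j<r. \<forall>i<j. \<forall>z t. local_equation e G i (z(e j := t)) = local_equation e G i z)"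

text \<open>
  Quantifying over all local ideals that contain the equations allows equations to be added and
  functions to be pulled back to a product without carrying coefficients along.
\<close>

definition generate_locally ::
    "nat set \<Rightarrow> (nat \<Rightarrow> 'k::field) set \<Rightarrow> nat \<Rightarrow> (nat \<Rightarrow> (nat \<Rightarrow> 'k) \<Rightarrow> 'k) \<Rightarrow> (nat \<Rightarrow> 'k) \<Rightarrow> bool" where
  "generate_locally I V r F z0 \<longleftrightarrow>
     (\<forall>L g. local_ideal (polys I) z0 L \<longrightarrow> (\<forall>i<r. F i \<in> L) \<longrightarrow>
        g \<in> polys I \<longrightarrow> (\<forall>z\<in>V. g z = 0) \<longrightarrow> g \<in> L)"

lemma generate_locallyD:
  "generate_locally I V r F z0 \<Longrightarrow> local_ideal (polys I) z0 L \<Longrightarrow> \<forall>i<r. F i \<in> L \<Longrightarrow>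
     g \<in> polys I \<Longrightarrow> \<forall>z\<in>V. g z = 0 \<Longrightarrow> g \<in> L"
  unfolding generate_locally_def by blast

text \<open>
  Induction along the order. A transcendental coordinate needs no equation, since every relation for
  it has coefficients that vanish on \<open>V\<close>; a separable one contributes its minimal relation. The
  factor that \<open>w\<close> gains in the second case is the leading coefficient of that relation, needed for
  pseudo-division, times its derivative, the new diagonal entry of the Jacobian matrix.
\<close>

theorem generic_triangular_equations:
  fixes V :: "(nat \<Rightarrow> 'k::field) set"
  assumes V: "V \<noteq> {}" and ord: "separating_order V xs" and int: "integral_on V (polys (set xs))"
  shows "\<exists>r e G. \<exists>w\<in>polys (set xs). triangular_equations (set xs) V r e G \<and> (\<exists>z\<in>V. w z \<noteq> 0) \<and>
     (\<forall>z0\<in>V. w z0 \<noteq> 0 \<longrightarrow> (\<forall>i<r. poly (pderiv (G i z0)) (z0 (e i)) \<noteq> 0) \<and>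
        generate_locally (set xs) V r (local_equation e G) z0)"
  using ord int
proof (induction xs rule: rev_induct)
  case Nil
  have w: "(\<lambda>_. 1) \<in> (polys {} :: ((nat \<Rightarrow> 'k) \<Rightarrow> 'k) set)"
    by (rule function_algebra.const[OF function_algebra_polys])
  have "g \<in> L" if L: "local_ideal (polys {}) z0 L" and g: "g \<in> polys {}" "\<forall>z\<in>V. g z = 0"
    for z0 :: "nat \<Rightarrow> 'k" and L g
  proof -
    obtain z1 where "z1 \<in> V" using V by blast
    then have "g z = 0" for z using polys_local[OF g(1), of z z1] g(2) by simp
    then have "g = (\<lambda>_. 0)" by auto
    then show ?thesis using local_ideal.zero[OF L] by simp
  qed
  then have "triangular_equations (set []) V 0 e G \<and> (\<exists>z\<in>V. (1::'k) \<noteq> 0) \<and>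
     (\<forall>z0\<in>V. (1::'k) \<noteq> 0 \<longrightarrow> (\<forall>i<0. poly (pderiv (G i z0)) (z0 (e i)) \<noteq> 0) \<and>
        generate_locally (set []) V 0 (local_equation e G) z0)" for e G
    using V by (auto simp: triangular_equations_def generate_locally_def)
  then show ?case
    using w by (intro exI[of _ "0::nat"] exI bexI[of _ "\<lambda>_. 1"]) auto
next
  case (snoc y xs)
  define I where "I = set xs"
  have I': "set (xs @ [y]) = insert y I" by (auto simp: I_def)
  have ord: "separating_order V xs" and y: "y \<notin> I"
    and step: "separable_over (polys I) V (\<lambda>z. z y) \<or> transcendental_over (polys I) V (\<lambda>z. z y)"
    using snoc.prems(1) by (auto simp: separating_order_snoc I_def)
  define B where "B = (polys (insert y I) :: ((nat \<Rightarrow> 'k) \<Rightarrow> 'k) set)"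
  have sub: "polys I \<subseteq> B" unfolding B_def by (intro polys_mono) auto
  have yB: "(\<lambda>z. z y) \<in> B" unfolding B_def by (intro coord_in_polys) auto
  have intB: "integral_on V B" using snoc.prems(2) unfolding B_def I' .
  interpret A: function_algebra "polys I :: ((nat \<Rightarrow> 'k) \<Rightarrow> 'k) set"
    by (rule function_algebra_polys)
  interpret B: function_algebra B unfolding B_def by (rule function_algebra_polys)
  obtain r e G w where w: "w \<in> polys I" "\<exists>z\<in>V. w z \<noteq> 0" and T: "triangular_equations I V r e G"
    and loc: "\<And>z0. z0 \<in> V \<Longrightarrow> w z0 \<noteq> 0 \<Longrightarrow> (\<forall>i<r. poly (pderiv (G i z0)) (z0 (e i)) \<noteq> 0) \<and>
        generate_locally I V r (local_equation e G) z0"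
    using snoc.IH[OF ord integral_on_mono[OF intB sub, unfolded I_def]] unfolding I_def by metis
  have van: "a \<in> L" if "z0 \<in> V" "w z0 \<noteq> 0" "local_ideal B z0 L" "\<forall>i<r. local_equation e G i \<in> L"
    "a \<in> polys I" "\<forall>z\<in>V. a z = 0" for z0 L a
  proof -
    have "local_ideal (polys I) z0 {f. (\<lambda>z. f z) \<in> L}"
      by (rule local_ideal_pullback[OF that(3) A.function_algebra_axioms]) (use sub in auto)
    then show ?thesis
      using loc[OF that(1,2)] that(4-6) unfolding generate_locally_def by simp
  qed
  show ?case
  proof (cases "separable_over (polys I) V (\<lambda>z. z y)")
    case False
    then have tr: "transcendental_over (polys I) V (\<lambda>z. z y)" using step by blast
    have "g \<in> L" if z0: "z0 \<in> V" "w z0 \<noteq> 0" and L: "local_ideal B z0 L"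
      and eqs: "\<forall>i<r. local_equation e G i \<in> L" and g: "g \<in> B" "\<forall>z\<in>V. g z = 0" for z0 L g
    proof -
      obtain H where H: "H \<in> poly_family (polys I)" "\<And>z. g z = poly (H z) (z y)"
        using polys_insert g(1) unfolding B_def by metis
      then have "\<forall>z\<in>V. H z = 0"
        using tr g(2) unfolding transcendental_over_def by metis
      then have "(\<lambda>z. coeff (H z) j) \<in> L" for j
        by (intro van[OF z0 L eqs] poly_family_coeff H) auto
      then have "(\<lambda>z. poly (H z) (z y)) \<in> L"
        by (intro local_ideal.poly_family_eval_ideal[OF L H(1) _ yB])
      moreover have "g = (\<lambda>z. poly (H z) (z y))" by (rule ext) (rule H(2))
      ultimately show ?thesis by simp
    qed
    then have "generate_locally (insert y I) V r (local_equation e G) z0"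
      if "z0 \<in> V" "w z0 \<noteq> 0" for z0
      using that unfolding generate_locally_def B_def by blast
    moreover have "triangular_equations (insert y I) V r e G"
      using T sub unfolding triangular_equations_def B_def by blast
    ultimately show ?thesis
      unfolding I' using w loc sub unfolding B_def by blast
  next
    case True
    obtain G0 where G0: "G0 \<in> poly_family (polys I)" "\<forall>z\<in>V. poly (G0 z) (z y) = 0"
      "\<exists>z\<in>V. poly (pderiv (G0 z)) (z y) \<noteq> 0"
      using True unfolding separable_over_def by blast
    then have "\<exists>z\<in>V. G0 z \<noteq> 0" by (metis pderiv_0 poly_0)
    then obtain d f where min: "minimal_relation (polys I) V (\<lambda>z. z y) d f"
      using minimal_relation_exists[OF A.function_algebra_axioms G0(1,2)] by blast
    note f = min[unfolded minimal_relation_def]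
    have der: "\<exists>z\<in>V. poly (pderiv (f z)) (z y) \<noteq> 0"
      by (rule minimal_relation_separable[OF A.function_algebra_axioms B.function_algebra_axioms
            sub yB intB min True])
    define e' where "e' = e(r := y)"
    define G' where "G' = G(r := f)"
    have eq_old: "local_equation e' G' i = local_equation e G i" if "i < r" for i
      using that by (auto simp: local_equation_def e'_def G'_def fun_eq_iff)
    have eq_new: "local_equation e' G' r = (\<lambda>z. poly (f z) (z y))"
      by (auto simp: local_equation_def e'_def G'_def fun_eq_iff)
    define w' where "w' = (\<lambda>z. w z * (coeff (f z) d * poly (pderiv (f z)) (z y)))"
    have dB: "(\<lambda>z. poly (pderiv (f z)) (z y)) \<in> B"
      using f by (intro B.poly_family_eval[OF poly_family_pderiv[OF A.function_algebra_axioms] sub yB]) auto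
    have cB: "(\<lambda>z. coeff (f z) d) \<in> B"
      using f sub poly_family_coeff by blast
    have w'B: "w' \<in> B"
      unfolding w'_def using w sub by (intro B.mult dB cB) auto
    have w'V: "\<exists>z\<in>V. w' z \<noteq> 0"
      unfolding w'_def
      by (intro integral_on_nonzero[OF intB] B.mult dB cB der) (use w sub f in auto)
    have T': "triangular_equations (insert y I) V (Suc r) e' G'"
      unfolding triangular_equations_def
    proof (intro conjI allI impI ballI)
      fix i assume "i < Suc r"
      then consider "i < r" | "i = r" by linarith
      note cas = this
      show "e' i \<in> insert y I"
        using cas T by cases (auto simp: e'_def triangular_equations_def)
      show "local_equation e' G' i \<in> polys (insert y I)"
      proof (cases rule: cas)
        case 1
        then show ?thesis using T sub by (auto simp: eq_old triangular_equations_def B_def)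
      next
        case 2
        then show ?thesis
          using f B.poly_family_eval[OF _ sub yB, of f] by (simp add: eq_new B_def)
      qed
      show "local_equation e' G' i z = 0" if "z \<in> V" for z
      proof (cases rule: cas)
        case 1
        then show ?thesis using T that by (auto simp: eq_old triangular_equations_def)
      next
        case 2
        then show ?thesis using f that by (simp add: eq_new)
      qed
      show "G' i (z(e' i := t)) = G' i z" for z t
      proof (cases rule: cas)
        case 1
        then show ?thesis using T by (auto simp: G'_def e'_def triangular_equations_def)
      next
        case 2
        have "f (z(y := t)) = f z"
          by (rule poly_family_polys_local[of f I]) (use f y in auto)
        then show ?thesis using 2 by (simp add: G'_def e'_def)
      qed
    next
      fix j i z t assume ij: "j < Suc r" "i < j"
      then consider "j < r" | "j = r" by linarith
      then show "local_equation e' G' i (z(e' j := t)) = local_equation e' G' i z"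
      proof cases
        case 1
        then have "e' j = e j" by (simp add: e'_def)
        then show ?thesis using 1 T ij by (auto simp: eq_old triangular_equations_def)
      next
        case 2
        then have "local_equation e G i \<in> polys I"
          using T ij by (auto simp: triangular_equations_def)
        then have "local_equation e G i (z(y := t)) = local_equation e G i z"
          by (rule polys_local) (use y in auto)
        moreover have "e' j = y" using 2 by (simp add: e'_def)
        ultimately show ?thesis using 2 ij by (simp add: eq_old)
      qed
    qed
    have "g \<in> L" if z0: "z0 \<in> V" "w' z0 \<noteq> 0" and L: "local_ideal B z0 L"
      and eqs: "\<forall>i<Suc r. local_equation e' G' i \<in> L" and g: "g \<in> B" "\<forall>z\<in>V. g z = 0" for z0 L g
    proof -
      have nz: "w z0 \<noteq> 0" "coeff (f z0) d \<noteq> 0" using z0 by (auto simp: w'_def)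
      have old: "\<forall>i<r. local_equation e G i \<in> L"
        using eqs eq_old by (metis less_Suc_eq)
      have new: "(\<lambda>z. poly (f z) (z y)) \<in> L"
        using eqs eq_new by (metis lessI)
      obtain H where H: "H \<in> poly_family (polys I)" "\<And>z. g z = poly (H z) (z y)"
        using polys_insert g(1) unfolding B_def by metis
      have "(\<lambda>z. poly (H z) (z y)) \<in> L"
        by (rule local_ideal.reduction[OF L A.function_algebra_axioms sub yB
              van[OF z0(1) nz(1) L old] min new nz(2) H(1)]) (use H g in auto)
      moreover have "g = (\<lambda>z. poly (H z) (z y))" by (rule ext) (rule H(2))
      ultimately show ?thesis by simp
    qed
    then have "generate_locally (insert y I) V (Suc r) (local_equation e' G') z0"
      if "z0 \<in> V" "w' z0 \<noteq> 0" for z0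
      using that unfolding generate_locally_def B_def by blast
    moreover have "poly (pderiv (G' i z0)) (z0 (e' i)) \<noteq> 0"
      if "z0 \<in> V" "w' z0 \<noteq> 0" "i < Suc r" for z0 i
      using that loc[of z0] by (cases "i = r") (auto simp: w'_def G'_def e'_def)
    ultimately show ?thesis
      unfolding I' using w'B w'V T' unfolding B_def by blast
  qed
qed

section \<open>Affine varieties, principal open subsets and products\<close>

lemma (in function_algebra) algebra_gen_subset: "S \<subseteq> A \<Longrightarrow> algebra_gen S \<subseteq> A"
  using pullback[of _ S "\<lambda>x. x"] by blast

lemma affine_variety_function_algebra: "affine_variety X \<Longrightarrow> function_algebra (reg X)"
  unfolding affine_variety_def using function_algebra_functions_gen by metis

lemma affine_variety_reg_cong:
  assumes "affine_variety X" "f \<in> reg X" "\<And>x. x \<in> pts X \<Longrightarrow> g x = f x"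
  shows "g \<in> reg X"
proof -
  obtain S where "reg X = functions_gen (pts X) S"
    using assms(1) unfolding affine_variety_def by auto
  then show ?thesis
    using functions_gen_cong[of f "pts X" S g] assms(2,3) by auto
qed

lemma affine_variety_integral: "affine_variety X \<Longrightarrow> integral_on (pts X) (reg X)"
  unfolding affine_variety_def integral_on_def by simp

lemma affine_variety_nonempty: "affine_variety X \<Longrightarrow> pts X \<noteq> {}"
  by (simp add: affine_variety_def)

lemma affine_variety_character:
  "affine_variety X \<Longrightarrow> algebra_character X \<theta> \<Longrightarrow> \<exists>!x. x \<in> pts X \<and> (\<forall>f\<in>reg X. \<theta> f = f x)"
  by (simp add: affine_variety_def)

text \<open>Evaluation at a point is a character, and a character belongs to only one point.\<close>

lemma affine_variety_separates:
  assumes X: "affine_variety X" and xy: "x \<in> pts X" "y \<in> pts X" "\<And>f. f \<in> reg X \<Longrightarrow> f x = f y"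
  shows "x = y"
proof -
  have "algebra_character X (\<lambda>f. f x)"
    using xy(1) unfolding algebra_character_def by auto
  from affine_variety_character[OF X this] show ?thesis
    using xy by blast
qed

lemma morphism_pts: "morphism X Y \<phi> \<Longrightarrow> x \<in> pts X \<Longrightarrow> \<phi> x \<in> pts Y"
  unfolding morphism_def by auto

lemma morphism_reg: "morphism X Y \<phi> \<Longrightarrow> f \<in> reg Y \<Longrightarrow> (\<lambda>x. f (\<phi> x)) \<in> reg X"
  unfolding morphism_def by auto

lemma pts_principal_open: "pts (principal_open X h) = {x \<in> pts X. h x \<noteq> 0}"
  by (simp add: principal_open_def Let_def)

lemma reg_principal_open:
  "reg (principal_open X h) =
     {F. \<exists>g\<in>reg X. \<exists>e::nat. \<forall>x\<in>pts (principal_open X h). F x = g x / h x ^ e}"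
  by (simp add: principal_open_def Let_def)

lemma reg_principal_openI:
  "g \<in> reg X \<Longrightarrow> (\<And>x. x \<in> pts X \<Longrightarrow> h x \<noteq> 0 \<Longrightarrow> F x = g x / h x ^ e) \<Longrightarrow>
     F \<in> reg (principal_open X h)"
  unfolding reg_principal_open pts_principal_open by blast

lemma reg_principal_openE:
  assumes "F \<in> reg (principal_open X h)"
  obtains g e where "g \<in> reg X" "\<And>x. x \<in> pts X \<Longrightarrow> h x \<noteq> 0 \<Longrightarrow> F x = g x / h x ^ e"
  using assms unfolding reg_principal_open pts_principal_open by auto

lemma reg_principal_open_restrict: "g \<in> reg X \<Longrightarrow> g \<in> reg (principal_open X h)"
  by (rule reg_principal_openI[of g _ _ _ 0]) auto

lemma reg_principal_open_inverse:
  assumes "function_algebra (reg X)"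
  shows "(\<lambda>x. 1 / h x) \<in> reg (principal_open X h)"
  by (rule reg_principal_openI[OF function_algebra.const[OF assms, of 1], of _ _ 1]) auto

lemma function_algebra_principal_open:
  assumes X: "function_algebra (reg X)" and h: "h \<in> reg X"
  shows "function_algebra (reg (principal_open X h))"
proof -
  interpret function_algebra "reg X" by fact
  show ?thesis
  proof
    show "(\<lambda>_. c) \<in> reg (principal_open X h)" for c
      by (intro reg_principal_open_restrict const)
    fix F G assume "F \<in> reg (principal_open X h)" "G \<in> reg (principal_open X h)"
    then obtain f d g e where
      f: "f \<in> reg X" "\<And>x. x \<in> pts X \<Longrightarrow> h x \<noteq> 0 \<Longrightarrow> F x = f x / h x ^ d" and
      g: "g \<in> reg X" "\<And>x. x \<in> pts X \<Longrightarrow> h x \<noteq> 0 \<Longrightarrow> G x = g x / h x ^ e"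
      by (elim reg_principal_openE) blast
    show "(\<lambda>x. F x + G x) \<in> reg (principal_open X h)"
    proof (rule reg_principal_openI)
      show "(\<lambda>x. f x * h x ^ e + g x * h x ^ d) \<in> reg X"
        by (intro add mult power f g h)
      show "F x + G x = (f x * h x ^ e + g x * h x ^ d) / h x ^ (d + e)"
        if "x \<in> pts X" "h x \<noteq> 0" for x
        using f(2)[OF that] g(2)[OF that] that by (simp add: field_simps power_add)
    qed
    show "(\<lambda>x. F x * G x) \<in> reg (principal_open X h)"
      by (rule reg_principal_openI[OF mult[OF f(1) g(1)], of _ _ "d + e"])
         (simp add: f g power_add)
  qed
qed

text \<open>
  A character of the localised ring restricts to one of the original ring, and it cannot vanish on
  the unit \<open>h\<close>, so its point lies in the open subset. Multiplying by \<open>h\<close> extends zero products from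
  the open subset to the whole variety.
\<close>

lemma affine_variety_principal_open:
  assumes X: "affine_variety X" and h: "h \<in> reg X" and ne: "pts (principal_open X h) \<noteq> {}"
  shows "affine_variety (principal_open X h)"
proof -
  define D where "D = principal_open X h"
  interpret function_algebra "reg X" by (rule affine_variety_function_algebra[OF X])
  interpret D: function_algebra "reg D"
    unfolding D_def by (rule function_algebra_principal_open[OF function_algebra_axioms h])
  have D: "x \<in> pts D \<longleftrightarrow> x \<in> pts X \<and> h x \<noteq> 0" for x
    by (simp add: D_def pts_principal_open)
  have res: "f \<in> reg D" if "f \<in> reg X" for f
    unfolding D_def by (rule reg_principal_open_restrict[OF that])
  have inv: "(\<lambda>x. 1 / h x) \<in> reg D"
    unfolding D_def by (rule reg_principal_open_inverse[OF function_algebra_axioms])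
  have fin: "\<exists>S. finite S \<and> reg D = functions_gen (pts D) S"
  proof -
    obtain S where S: "finite S" "reg X = functions_gen (pts X) S"
      using X unfolding affine_variety_def by auto
    define S' where "S' = insert (\<lambda>x. 1 / h x) S"
    interpret S': function_algebra "algebra_gen S'" by (rule function_algebra_algebra_gen)
    have "reg D \<subseteq> functions_gen (pts D) S'"
    proof
      fix F assume "F \<in> reg D"
      then obtain g e where g: "g \<in> reg X" "\<And>x. x \<in> pts X \<Longrightarrow> h x \<noteq> 0 \<Longrightarrow> F x = g x / h x ^ e"
        unfolding D_def by (elim reg_principal_openE) blast
      obtain g0 where g0: "g0 \<in> algebra_gen S" "\<forall>x\<in>pts X. g x = g0 x"
        using g(1) S(2) unfolding functions_gen_def by auto
      have mem: "(\<lambda>x. g0 x * (1 / h x) ^ e) \<in> algebra_gen S'"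
      proof (intro S'.mult S'.power)
        show "g0 \<in> algebra_gen S'" using g0 algebra_gen_mono[of S S'] by (auto simp: S'_def)
        show "(\<lambda>x. 1 / h x) \<in> algebra_gen S'" by (rule algebra_gen.gen) (simp add: S'_def)
      qed
      have "\<forall>x\<in>pts D. F x = g0 x * (1 / h x) ^ e"
        using g g0 by (simp add: D power_divide)
      then show "F \<in> functions_gen (pts D) S'"
        unfolding functions_gen_def by (intro CollectI bexI[OF _ mem])
    qed
    moreover have "functions_gen (pts D) S' \<subseteq> reg D"
    proof
      fix F assume "F \<in> functions_gen (pts D) S'"
      then obtain g where g: "g \<in> algebra_gen S'" "\<forall>x\<in>pts D. F x = g x"
        unfolding functions_gen_def by auto
      have "S' \<subseteq> reg D"
        using res inv functions_gen_superset S(2) unfolding S'_def by blast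
      then have "g \<in> reg D" using D.algebra_gen_subset g(1) by blast
      then show "F \<in> reg D"
        using g(2) unfolding D_def reg_principal_open by auto
    qed
    ultimately show ?thesis using S(1) by (intro exI[of _ S']) (auto simp: S'_def)
  qed
  have int: "(\<forall>x\<in>pts D. F x = 0) \<or> (\<forall>x\<in>pts D. G x = 0)"
    if FG: "F \<in> reg D" "G \<in> reg D" "\<forall>x\<in>pts D. F x * G x = 0" for F G
  proof -
    obtain f d where f: "f \<in> reg X" "\<And>x. x \<in> pts X \<Longrightarrow> h x \<noteq> 0 \<Longrightarrow> F x = f x / h x ^ d"
      using FG(1) unfolding D_def by (elim reg_principal_openE) blast
    obtain g e where g: "g \<in> reg X" "\<And>x. x \<in> pts X \<Longrightarrow> h x \<noteq> 0 \<Longrightarrow> G x = g x / h x ^ e"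
      using FG(2) unfolding D_def by (elim reg_principal_openE) blast
    have "(\<forall>x\<in>pts X. f x * h x = 0) \<or> (\<forall>x\<in>pts X. g x * h x = 0)"
    proof (rule integral_onD[OF affine_variety_integral[OF X]])
      show "(\<lambda>x. f x * h x) \<in> reg X" "(\<lambda>x. g x * h x) \<in> reg X"
        by (intro mult f g h)+
      show "f x * h x * (g x * h x) = 0" if "x \<in> pts X" for x
      proof (cases "h x = 0")
        case False
        then have "F x * G x = 0" using FG(3) that D by blast
        then show ?thesis using f(2)[OF that False] g(2)[OF that False] False by auto
      qed simp
    qed
    then show ?thesis using f g by (auto simp: D)
  qed
  have char: "\<exists>!x. x \<in> pts D \<and> (\<forall>f\<in>reg D. \<theta> f = f x)" if \<theta>: "algebra_character D \<theta>" for \<theta>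
  proof -
    have c: "\<theta> (\<lambda>_. c) = c" for c
      using \<theta> unfolding algebra_character_def by blast
    have m: "\<theta> (\<lambda>x. f x * g x) = \<theta> f * \<theta> g" if "f \<in> reg D" "g \<in> reg D" for f g
      using \<theta> that unfolding algebra_character_def by blast
    have eq: "\<theta> f = \<theta> g" if "f \<in> reg D" "g \<in> reg D" "\<And>x. x \<in> pts D \<Longrightarrow> f x = g x" for f g
      using \<theta> that unfolding algebra_character_def by blast
    have "algebra_character X \<theta>"
      using \<theta> res unfolding algebra_character_def by (auto simp: D)
    from affine_variety_character[OF X this] obtain x where
      x: "x \<in> pts X" "\<And>f. f \<in> reg X \<Longrightarrow> \<theta> f = f x" and
      uniq: "\<And>y. y \<in> pts X \<Longrightarrow> (\<forall>f\<in>reg X. \<theta> f = f y) \<Longrightarrow> y = x"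
      by blast
    have "\<theta> h * \<theta> (\<lambda>x. 1 / h x) = \<theta> (\<lambda>x. h x * (1 / h x))"
      using m[OF res[OF h] inv] by simp
    also have "\<dots> = \<theta> (\<lambda>_. 1)"
      by (rule eq[OF D.mult[OF res[OF h] inv] D.const]) (simp add: D)
    finally have "h x \<noteq> 0" using c[of 1] x(2)[OF h] by auto
    have "\<theta> F = F x" if F: "F \<in> reg D" for F
    proof -
      obtain f e where f: "f \<in> reg X" "\<And>x. x \<in> pts X \<Longrightarrow> h x \<noteq> 0 \<Longrightarrow> F x = f x / h x ^ e"
        using F unfolding D_def by (elim reg_principal_openE) blast
      have he: "(\<lambda>x. h x ^ e) \<in> reg X" by (intro power h)
      have "\<theta> F * \<theta> (\<lambda>x. h x ^ e) = \<theta> (\<lambda>x. F x * h x ^ e)"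
        using m[OF F res[OF he]] by simp
      also have "\<dots> = \<theta> f"
        by (rule eq) (use F res he f in \<open>auto intro!: D.mult simp: D\<close>)
      finally have "\<theta> F * h x ^ e = f x" using x(2)[OF he] x(2)[OF f(1)] by simp
      then have "\<theta> F = f x / h x ^ e" using \<open>h x \<noteq> 0\<close> by (simp add: eq_divide_eq)
      then show ?thesis using f(2)[OF x(1) \<open>h x \<noteq> 0\<close>] by simp
    qed
    moreover have "y = x" if "y \<in> pts D \<and> (\<forall>f\<in>reg D. \<theta> f = f y)" for y
      by (rule uniq) (use that D res in auto)
    moreover have "x \<in> pts D" using x(1) \<open>h x \<noteq> 0\<close> D by blast
    ultimately show ?thesis by (intro ex1I[of _ x]) simp_all
  qed
  show ?thesis
    using ne fin int char unfolding affine_variety_def D_def[symmetric] by blast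
qed

lemma pts_product: "pts (product_variety X Y) = pts X \<times> pts Y"
  by (simp add: product_variety_def)

text \<open>
  With an arbitrary finite index set, sums and products of tensors are indexed by disjoint unions
  and cartesian products.
\<close>

lemma reg_productI:
  assumes I: "finite I" and fg: "\<And>i. i \<in> I \<Longrightarrow> f i \<in> reg X \<and> g i \<in> reg Y"
    and F: "\<And>x y. x \<in> pts X \<Longrightarrow> y \<in> pts Y \<Longrightarrow> F (x, y) = (\<Sum>i\<in>I. f i x * g i y)"
  shows "F \<in> reg (product_variety X Y)"
proof -
  obtain b where b: "bij_betw b {0..<card I} I"
    using ex_bij_betw_nat_finite[OF I] by blast
  have "(\<Sum>i\<in>I. f i x * g i y) = (\<Sum>j<card I. f (b j) x * g (b j) y)" for x y
    using sum.reindex_bij_betw[OF b, of "\<lambda>i. f i x * g i y"] by (simp add: lessThan_atLeast0)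
  moreover have "f (b j) \<in> reg X \<and> g (b j) \<in> reg Y" if "j < card I" for j
    using fg bij_betwE[OF b] that by auto
  ultimately show ?thesis
    unfolding product_variety_def using F
    by (auto intro!: exI[of _ "card I"] exI[of _ "\<lambda>j. f (b j)"] exI[of _ "\<lambda>j. g (b j)"])
qed

lemma reg_productE:
  assumes "F \<in> reg (product_variety X Y)"
  obtains n :: nat and f g where "\<And>i. i < n \<Longrightarrow> f i \<in> reg X" "\<And>i. i < n \<Longrightarrow> g i \<in> reg Y"
    "\<And>x y. x \<in> pts X \<Longrightarrow> y \<in> pts Y \<Longrightarrow> F (x, y) = (\<Sum>i<n. f i x * g i y)"
proof -
  have "\<exists>(n::nat) f g. (\<forall>i<n. f i \<in> reg X \<and> g i \<in> reg Y) \<and>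
      (\<forall>x\<in>pts X. \<forall>y\<in>pts Y. F (x, y) = (\<Sum>i<n. f i x * g i y))"
    using assms by (simp add: product_variety_def)
  then show thesis using that by blast
qed

lemma reg_product_cong:
  assumes "F \<in> reg (product_variety X Y)" "\<And>p. p \<in> pts (product_variety X Y) \<Longrightarrow> G p = F p"
  shows "G \<in> reg (product_variety X Y)"
  using assms(1)
proof (rule reg_productE)
  fix n :: nat and f g
  assume "\<And>i. i < n \<Longrightarrow> f i \<in> reg X" "\<And>i. i < n \<Longrightarrow> g i \<in> reg Y"
    "\<And>x y. x \<in> pts X \<Longrightarrow> y \<in> pts Y \<Longrightarrow> F (x, y) = (\<Sum>i<n. f i x * g i y)"
  then show ?thesis
    by (intro reg_productI[of "{..<n}" f _ g]) (auto simp: assms(2) pts_product)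
qed

lemma function_algebra_product:
  assumes X: "function_algebra (reg X)" and Y: "function_algebra (reg Y)"
  shows "function_algebra (reg (product_variety X Y))"
proof -
  interpret X: function_algebra "reg X" by fact
  interpret Y: function_algebra "reg Y" by fact
  show ?thesis
  proof
    show "(\<lambda>_. c) \<in> reg (product_variety X Y)" for c
      by (rule reg_productI[of "{()}" "\<lambda>_ _. c" _ "\<lambda>_ _. 1"]) (auto intro: X.const Y.const)
    fix F G assume FG: "F \<in> reg (product_variety X Y)" "G \<in> reg (product_variety X Y)"
    obtain m :: nat and f g where F: "\<And>i. i < m \<Longrightarrow> f i \<in> reg X" "\<And>i. i < m \<Longrightarrow> g i \<in> reg Y"
      "\<And>x y. x \<in> pts X \<Longrightarrow> y \<in> pts Y \<Longrightarrow> F (x, y) = (\<Sum>i<m. f i x * g i y)"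
      using FG(1) by (rule reg_productE) blast
    obtain n :: nat and f' g' where G: "\<And>i. i < n \<Longrightarrow> f' i \<in> reg X" "\<And>i. i < n \<Longrightarrow> g' i \<in> reg Y"
      "\<And>x y. x \<in> pts X \<Longrightarrow> y \<in> pts Y \<Longrightarrow> G (x, y) = (\<Sum>i<n. f' i x * g' i y)"
      using FG(2) by (rule reg_productE) blast
    show "(\<lambda>p. F p + G p) \<in> reg (product_variety X Y)"
    proof (rule reg_productI)
      show "finite ({..<m} <+> {..<n})" by simp
      show "case_sum f f' i \<in> reg X \<and> case_sum g g' i \<in> reg Y" if "i \<in> {..<m} <+> {..<n}" for i
        using that F G by (auto split: sum.split)
      show "F (x, y) + G (x, y) = (\<Sum>i\<in>{..<m} <+> {..<n}. case_sum f f' i x * case_sum g g' i y)"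
        if "x \<in> pts X" "y \<in> pts Y" for x y
        using F(3)[OF that] G(3)[OF that] by (simp add: sum.Plus comp_def)
    qed
    show "(\<lambda>p. F p * G p) \<in> reg (product_variety X Y)"
    proof (rule reg_productI)
      show "finite ({..<m} \<times> {..<n})" by simp
      show "(\<lambda>(i, j) x. f i x * f' j x) p \<in> reg X \<and> (\<lambda>(i, j) y. g i y * g' j y) p \<in> reg Y"
        if "p \<in> {..<m} \<times> {..<n}" for p
        using that F G by (auto intro: X.mult Y.mult)
      show "F (x, y) * G (x, y) =
          (\<Sum>p\<in>{..<m} \<times> {..<n}. (\<lambda>(i, j) x. f i x * f' j x) p x * (\<lambda>(i, j) y. g i y * g' j y) p y)"
        if "x \<in> pts X" "y \<in> pts Y" for x y
        unfolding F(3)[OF that] G(3)[OF that] sum_product sum.cartesian_product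
        by (intro sum.cong) (auto simp: algebra_simps)
    qed
  qed
qed

lemma reg_product_fst:
  assumes "function_algebra (reg Y)" "f \<in> reg X"
  shows "(\<lambda>p. f (fst p)) \<in> reg (product_variety X Y)"
  by (rule reg_productI[of "{()}" "\<lambda>_. f" _ "\<lambda>_ _. 1"])
     (auto intro: assms function_algebra.const)

lemma reg_product_snd:
  assumes "function_algebra (reg X)" "g \<in> reg Y"
  shows "(\<lambda>p. g (snd p)) \<in> reg (product_variety X Y)"
  by (rule reg_productI[of "{()}" "\<lambda>_ _. 1" _ "\<lambda>_. g"])
     (auto intro: assms function_algebra.const)

text \<open>
  A pair of morphisms is a morphism into the product. Functions are unconstrained outside the points,
  so the pullback only agrees with a member of \<open>A\<close> where the pair lands in the product.
\<close>

lemma reg_product_pullback: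
  assumes A: "function_algebra A" and F: "F \<in> reg (product_variety X Y)"
    and a: "\<And>f. f \<in> reg X \<Longrightarrow> (\<lambda>u. f (a u)) \<in> A" and b: "\<And>g. g \<in> reg Y \<Longrightarrow> (\<lambda>u. g (b u)) \<in> A"
  shows "\<exists>G\<in>A. \<forall>u. a u \<in> pts X \<longrightarrow> b u \<in> pts Y \<longrightarrow> F (a u, b u) = G u"
proof -
  interpret function_algebra A by fact
  obtain m :: nat and f g where F: "\<And>i. i < m \<Longrightarrow> f i \<in> reg X" "\<And>i. i < m \<Longrightarrow> g i \<in> reg Y"
    "\<And>x y. x \<in> pts X \<Longrightarrow> y \<in> pts Y \<Longrightarrow> F (x, y) = (\<Sum>i<m. f i x * g i y)"
    using F by (rule reg_productE) blast
  then show ?thesis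
    by (intro bexI[of _ "\<lambda>u. \<Sum>i<m. f i (a u) * g i (b u)"]) (auto intro!: sum mult a b)
qed

subsection \<open>The multiplicative group\<close>

lemma pts_Gm: "pts Gm = {t. t \<noteq> 0}"
  by (simp add: Gm_def affine_line_def pts_principal_open)

lemma function_algebra_affine_line:
  "function_algebra (reg (affine_line :: ('k, 'k::comm_ring_1) function_space))"
  unfolding affine_line_def
proof
  show "(\<lambda>_. c) \<in> reg \<lparr>pts = UNIV, reg = range poly\<rparr>" for c :: 'k
    using rangeI[of poly "[:c:]"] by (auto simp: fun_eq_iff image_iff intro!: exI[of _ "[:c:]"])
  fix f g :: "'k \<Rightarrow> 'k"
  assume "f \<in> reg \<lparr>pts = UNIV, reg = range poly\<rparr>" "g \<in> reg \<lparr>pts = UNIV, reg = range poly\<rparr>"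
  then obtain p q where "f = poly p" "g = poly q" by auto
  then show "(\<lambda>x. f x + g x) \<in> reg \<lparr>pts = UNIV, reg = range poly\<rparr>"
    "(\<lambda>x. f x * g x) \<in> reg \<lparr>pts = UNIV, reg = range poly\<rparr>"
    by (auto simp: fun_eq_iff image_iff intro: exI[of _ "p + q"] exI[of _ "p * q"])
qed

lemma id_reg_affine_line: "(\<lambda>t. t) \<in> reg affine_line"
  by (auto simp: affine_line_def fun_eq_iff image_iff intro!: exI[of _ "[:0, 1:]"])

lemma function_algebra_Gm: "function_algebra (reg Gm)"
  unfolding Gm_def
  by (rule function_algebra_principal_open[OF function_algebra_affine_line id_reg_affine_line])

lemma id_reg_Gm: "(\<lambda>t. t) \<in> reg Gm"
  unfolding Gm_def by (rule reg_principal_open_restrict[OF id_reg_affine_line])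

lemma inverse_reg_Gm: "(\<lambda>t. 1 / t) \<in> reg Gm"
  unfolding Gm_def by (rule reg_principal_open_inverse[OF function_algebra_affine_line])

lemma reg_GmE:
  assumes "f \<in> reg Gm"
  obtains p e where "\<And>t. t \<noteq> 0 \<Longrightarrow> f t = poly p t / t ^ e"
proof -
  obtain g e where g: "g \<in> reg affine_line"
    "\<And>t. t \<in> pts affine_line \<Longrightarrow> t \<noteq> 0 \<Longrightarrow> f t = g t / t ^ e"
    using assms unfolding Gm_def by (rule reg_principal_openE) blast
  moreover obtain p where "g = poly p" using g(1) by (auto simp: affine_line_def)
  ultimately show thesis using that[of p e] by (simp add: affine_line_def)
qed

text \<open>
  A unit is a morphism to \<open>Gm\<close>: powers of the inverse \<open>v\<close> replace the denominators.
\<close>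

lemma reg_Gm_pullback:
  assumes A: "function_algebra A" and u: "u \<in> A" and v: "v \<in> A" and f: "f \<in> reg Gm"
  shows "\<exists>G\<in>A. \<forall>x. u x * v x = 1 \<longrightarrow> f (u x) = G x"
proof -
  interpret function_algebra A by fact
  obtain p e where f: "\<And>t. t \<noteq> 0 \<Longrightarrow> f t = poly p t / t ^ e"
    using f by (rule reg_GmE) blast
  have G: "(\<lambda>x. poly p (u x) * v x ^ e) \<in> A"
    by (intro mult power v poly_family_eval[OF poly_family_const order_refl u])
  have "f (u x) = poly p (u x) * v x ^ e" if "u x * v x = 1" for x
  proof -
    have "u x \<noteq> 0" using that by auto
    moreover have "v x = 1 / u x"
      using that \<open>u x \<noteq> 0\<close> by (simp add: eq_divide_eq mult.commute)
    ultimately show ?thesis using f by (simp add: power_divide)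
  qed
  then show ?thesis by (intro bexI[OF _ G]) simp
qed

text \<open>
  The powers of \<open>t\<close> in the denominators of finitely many tensors have a common multiple.
\<close>

lemma reg_Gm_product_Laurent:
  assumes Y: "function_algebra (reg Y)" and F: "F \<in> reg (product_variety Gm Y)"
  shows "\<exists>N. \<exists>C\<in>poly_family (reg Y). \<forall>t. t \<noteq> 0 \<longrightarrow> (\<forall>y\<in>pts Y. F (t, y) = poly (C y) t / t ^ N)"
proof -
  interpret function_algebra "reg Y" by fact
  obtain m :: nat and f g where F: "\<And>i. i < m \<Longrightarrow> f i \<in> reg Gm" "\<And>i. i < m \<Longrightarrow> g i \<in> reg Y"
    "\<And>x y. x \<in> pts Gm \<Longrightarrow> y \<in> pts Y \<Longrightarrow> F (x, y) = (\<Sum>i<m. f i x * g i y)"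
    using F by (rule reg_productE) blast
  have "\<exists>p e. \<forall>t. t \<noteq> 0 \<longrightarrow> f i t = poly p t / t ^ e" if "i < m" for i
    by (rule reg_GmE[OF F(1)[OF that]]) blast
  then have "\<forall>i. \<exists>p e. i < m \<longrightarrow> (\<forall>t. t \<noteq> 0 \<longrightarrow> f i t = poly p t / t ^ e)" by blast
  then obtain p e where pe: "\<And>i t. i < m \<Longrightarrow> t \<noteq> 0 \<Longrightarrow> f i t = poly (p i) t / t ^ e i"
    unfolding choice_iff by blast
  define N where "N = (\<Sum>i<m. e i)"
  define C where "C = (\<lambda>y. \<Sum>i<m. smult (g i y) (p i * monom 1 (N - e i)))"
  have C: "C \<in> poly_family (reg Y)"
    unfolding C_def by (intro poly_family_sum poly_family_smult poly_family_const F) auto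
  have "F (t, y) = poly (C y) t / t ^ N" if t: "t \<noteq> 0" and y: "y \<in> pts Y" for t y
  proof -
    have "f i t * g i y = poly (smult (g i y) (p i * monom 1 (N - e i))) t / t ^ N" if i: "i < m" for i
    proof -
      have "e i \<le> N" unfolding N_def using i by (intro member_le_sum) auto
      then have "t ^ N = t ^ e i * t ^ (N - e i)" by (simp flip: power_add)
      then show ?thesis using t by (simp add: pe[OF i t] poly_monom)
    qed
    then show ?thesis
      using F(3)[of t y] t y by (simp add: pts_Gm C_def poly_sum sum_divide_distrib)
  qed
  then show ?thesis using C by blast
qed

section \<open>The Zariski topology\<close>

lemma topspace_zariski: "function_algebra (reg X) \<Longrightarrow> topspace (zariski X) = pts X"
  unfolding zariski_def topology_generated_by_topspace
  using function_algebra.const[of "reg X" 1] by fastforce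

lemma openin_zariski_basic: "f \<in> reg X \<Longrightarrow> openin (zariski X) {x \<in> pts X. f x \<noteq> 0}"
  unfolding zariski_def by (rule topology_generated_by_Basis) auto

text \<open>
  The basic open sets are closed under intersection, because functions can be multiplied.
\<close>

lemma openin_zariskiE:
  fixes X :: "('p, 'k::field) function_space"
  assumes X: "function_algebra (reg X)" and U: "openin (zariski X) U" and x: "x \<in> U"
  shows "\<exists>f\<in>reg X. f x \<noteq> 0 \<and> {y \<in> pts X. f y \<noteq> 0} \<subseteq> U"
proof -
  interpret function_algebra "reg X" by fact
  have "generate_topology_on ((\<lambda>f. {x \<in> pts X. f x \<noteq> 0}) ` reg X) U"
    using U unfolding zariski_def openin_topology_generated_by_iff .
  then show ?thesis using x
  proof (induction arbitrary: x)
    case (Int a b)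
    obtain f where "f \<in> reg X" "f x \<noteq> 0" "{y \<in> pts X. f y \<noteq> 0} \<subseteq> a"
      using Int.IH(1)[of x] Int.prems by auto
    moreover obtain g where "g \<in> reg X" "g x \<noteq> 0" "{y \<in> pts X. g y \<noteq> 0} \<subseteq> b"
      using Int.IH(2)[of x] Int.prems by auto
    ultimately show ?case by (intro bexI[OF _ mult[of f g]]) auto
  next
    case (UN K)
    obtain k where k: "k \<in> K" "x \<in> k" using UN.prems by blast
    then obtain f where "f \<in> reg X" "f x \<noteq> 0" "{y \<in> pts X. f y \<noteq> 0} \<subseteq> k"
      using UN.IH[OF k] by blast
    then show ?case using k(1) by (intro bexI[of _ f]) auto
  qed auto
qed

lemma openin_zariski_morphism:
  fixes X :: "('p, 'k::field) function_space" and Y :: "('q, 'k) function_space"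
  assumes X: "function_algebra (reg X)" and Y: "function_algebra (reg Y)"
    and \<phi>: "morphism X Y \<phi>" and U: "openin (zariski Y) U"
  shows "openin (zariski X) {x \<in> pts X. \<phi> x \<in> U}"
proof (subst openin_subopen, intro ballI)
  fix x assume x: "x \<in> {x \<in> pts X. \<phi> x \<in> U}"
  then obtain f where f: "f \<in> reg Y" "f (\<phi> x) \<noteq> 0" "{y \<in> pts Y. f y \<noteq> 0} \<subseteq> U"
    using openin_zariskiE[OF Y U, of "\<phi> x"] by auto
  show "\<exists>T. openin (zariski X) T \<and> x \<in> T \<and> T \<subseteq> {x \<in> pts X. \<phi> x \<in> U}"
    by (rule exI[of _ "{x \<in> pts X. f (\<phi> x) \<noteq> 0}"])
       (use x f openin_zariski_basic[OF morphism_reg[OF \<phi> f(1)]] morphism_pts[OF \<phi>] in auto)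
qed

text \<open>
  Two open sets contain the nonvanishing loci of two functions, whose product is not zero on \<open>F\<close>.
\<close>

lemma integral_on_open_inter:
  fixes X :: "('p, 'k::field) function_space"
  assumes X: "function_algebra (reg X)" and F: "F \<subseteq> pts X" "integral_on F (reg X)"
    and U: "openin (zariski X) U" "U \<inter> F \<noteq> {}" and V: "openin (zariski X) V" "V \<inter> F \<noteq> {}"
  shows "U \<inter> V \<inter> F \<noteq> {}"
proof -
  obtain x y where x: "x \<in> U" "x \<in> F" and y: "y \<in> V" "y \<in> F" using U V by blast
  obtain f where f: "f \<in> reg X" "f x \<noteq> 0" "{z \<in> pts X. f z \<noteq> 0} \<subseteq> U"
    using openin_zariskiE[OF X U(1) x(1)] by blast
  obtain g where g: "g \<in> reg X" "g y \<noteq> 0" "{z \<in> pts X. g z \<noteq> 0} \<subseteq> V"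
    using openin_zariskiE[OF X V(1) y(1)] by blast
  obtain z where "z \<in> F" "f z * g z \<noteq> 0"
    using integral_on_nonzero[OF F(2) f(1) g(1)] f g x y by blast
  then have "z \<in> U \<inter> V \<inter> F" using F(1) f(3) g(3) by auto
  then show ?thesis by blast
qed

lemma integral_on_connectedin:
  fixes X :: "('p, 'k::field) function_space"
  assumes X: "function_algebra (reg X)" and F: "F \<subseteq> pts X" "integral_on F (reg X)"
  shows "connectedin (zariski X) F"
  unfolding connectedin
  using integral_on_open_inter[OF X F] F(1) topspace_zariski[OF X] by blast

lemma integral_on_dense:
  fixes X :: "('p, 'k::field) function_space"
  assumes X: "function_algebra (reg X)" and int: "integral_on (pts X) (reg X)"
    and U: "openin (zariski X) U" "U \<noteq> {}"
  shows "zariski X closure_of U = pts X"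
proof -
  have "U \<subseteq> pts X" using openin_subset[OF U(1)] topspace_zariski[OF X] by simp
  then have "y \<in> zariski X closure_of U" if "y \<in> pts X" for y
    unfolding in_closure_of topspace_zariski[OF X]
    using integral_on_open_inter[OF X order_refl int U(1)] U(2) that by blast
  then show ?thesis
    using closure_of_subset_topspace[of "zariski X" U] topspace_zariski[OF X] by blast
qed

lemma regular_on_pullback:
  assumes \<phi>: "morphism Y Z \<phi>" and f: "f \<in> regular_on Z U"
  shows "(\<lambda>y. f (\<phi> y)) \<in> regular_on Y {y \<in> pts Y. \<phi> y \<in> U}"
proof -
  have "\<exists>g\<in>reg Y. \<exists>h\<in>reg Y. h x \<noteq> 0 \<and> (\<forall>y\<in>{y \<in> pts Y. \<phi> y \<in> U}. h y \<noteq> 0 \<longrightarrow> f (\<phi> y) = g y / h y)"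
    if x: "\<phi> x \<in> U" for x
  proof -
    obtain g h where "g \<in> reg Z" "h \<in> reg Z" "h (\<phi> x) \<noteq> 0" "\<forall>y\<in>U. h y \<noteq> 0 \<longrightarrow> f y = g y / h y"
      using f x unfolding regular_on_def by blast
    then show ?thesis
      by (intro bexI[of _ "\<lambda>y. g (\<phi> y)"] bexI[of _ "\<lambda>y. h (\<phi> y)"] morphism_reg[OF \<phi>]) auto
  qed
  then show ?thesis unfolding regular_on_def by blast
qed

lemma morphism_to_atlas_comp:
  assumes Y: "function_algebra (reg Y)" and X: "function_algebra (reg X')"
    and \<phi>: "morphism Y X' \<phi>" and \<psi>: "morphism_to_atlas X' Z \<psi>"
  shows "morphism_to_atlas Y Z (\<lambda>y. \<psi> (\<phi> y))"
proof -
  have eq: "{y \<in> pts Y. \<psi> (\<phi> y) \<in> pts C} = {y \<in> pts Y. \<phi> y \<in> {x \<in> pts X'. \<psi> x \<in> pts C}}" for C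
    using morphism_pts[OF \<phi>] by auto
  have "openin (zariski Y) {y \<in> pts Y. \<psi> (\<phi> y) \<in> pts C}" if "C \<in> Z" for C
    unfolding eq using \<psi> that unfolding morphism_to_atlas_def
    by (intro openin_zariski_morphism[OF Y X \<phi>]) auto
  moreover have "(\<lambda>y. f (\<psi> (\<phi> y))) \<in> regular_on Y {y \<in> pts Y. \<psi> (\<phi> y) \<in> pts C}"
    if "C \<in> Z" "f \<in> reg C" for C f
    unfolding eq using \<psi> that unfolding morphism_to_atlas_def
    by (intro regular_on_pullback[OF \<phi>]) auto
  moreover have "(\<lambda>y. \<psi> (\<phi> y)) ` pts Y \<subseteq> atlas_pts Z"
    using \<psi> morphism_pts[OF \<phi>] unfolding morphism_to_atlas_def by auto
  ultimately show ?thesis unfolding morphism_to_atlas_def by blast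
qed

section \<open>The action on a stable principal open subset\<close>

lemma Gm_action_pts: "Gm_action X act \<Longrightarrow> w \<noteq> 0 \<Longrightarrow> x \<in> pts X \<Longrightarrow> act w x \<in> pts X"
  unfolding Gm_action_def using morphism_pts[of "product_variety Gm X" X "\<lambda>(w, x). act w x" "(w, x)"]
  by (simp add: pts_product pts_Gm)

lemma Gm_action_one: "Gm_action X act \<Longrightarrow> x \<in> pts X \<Longrightarrow> act 1 x = x"
  by (simp add: Gm_action_def)

lemma Gm_action_mult:
  "Gm_action X act \<Longrightarrow> v \<noteq> 0 \<Longrightarrow> w \<noteq> 0 \<Longrightarrow> x \<in> pts X \<Longrightarrow> act v (act w x) = act (v * w) x"
  by (simp add: Gm_action_def pts_Gm)

lemma Gm_action_reg:
  assumes "Gm_action X act" "f \<in> reg X"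
  shows "(\<lambda>p. f (act (fst p) (snd p))) \<in> reg (product_variety Gm X)"
  using assms morphism_reg[of "product_variety Gm X" X "\<lambda>(w, x). act w x" f]
  unfolding Gm_action_def by (simp add: case_prod_unfold)

lemma no_nonzero_roots_imp_monom:
  fixes p :: "'k::alg_closed_field poly"
  assumes nz: "\<And>t. t \<noteq> 0 \<Longrightarrow> poly p t \<noteq> 0"
  shows "\<exists>c m. p = monom c m"
proof -
  have "p \<noteq> 0" using nz[of 1] by auto
  then obtain q where q: "p = [:- 0, 1:] ^ order 0 p * q" "\<not> [:- 0, 1:] dvd q"
    using order_decomp[of p 0] by blast
  have "poly q t \<noteq> 0" for t
  proof (cases "t = 0")
    case True
    then show ?thesis using q(2) by (simp add: poly_eq_0_iff_dvd)
  next
    case False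
    then show ?thesis using nz[of t] by (subst (asm) q(1)) auto
  qed
  then have "degree q = 0"
    using alg_closed_imp_poly_has_root[of q] by blast
  then obtain c where "q = [:c:]" by (elim degree_eq_zeroE)
  then have "p = monom c (order 0 p)"
    using q(1) by (simp add: monom_altdef)
  then show ?thesis by blast
qed

text \<open>
  For \<open>x\<close> in \<open>D(h)\<close> the Laurent polynomial \<open>w \<mapsto> h (act w x)\<close> has no zero, so it is a single
  monomial, whose exponent is the same for all \<open>x\<close> because the variety is irreducible. This makes
  \<open>h\<close> homogeneous, and \<open>1 / h (act w x)\<close> is regular without an appeal to the Nullstellensatz.
\<close>

lemma stable_principal_open_homogeneous:
  fixes X :: "('p, 'k::alg_closed_field) function_space" and act :: "'k \<Rightarrow> 'p \<Rightarrow> 'p"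
  assumes X: "affine_variety X" and act: "Gm_action X act" and h: "h \<in> reg X"
    and ne: "pts (principal_open X h) \<noteq> {}"
    and stable: "Gm_stable act (pts (principal_open X h))"
  shows "\<exists>m N::nat. \<forall>w x. w \<noteq> 0 \<longrightarrow> x \<in> pts (principal_open X h) \<longrightarrow> h (act w x) = h x * (w ^ m / w ^ N)"
proof -
  interpret function_algebra "reg X" by (rule affine_variety_function_algebra[OF X])
  obtain N C where C: "C \<in> poly_family (reg X)"
    and hC': "\<forall>w. w \<noteq> 0 \<longrightarrow> (\<forall>x\<in>pts X. h (act w x) = poly (C x) w / w ^ N)"
    using reg_Gm_product_Laurent[OF function_algebra_axioms Gm_action_reg[OF act h]] by auto
  have hC: "h (act w x) = poly (C x) w / w ^ N" if "w \<noteq> 0" "x \<in> pts X" for w x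
    using hC' that by blast
  have D: "x \<in> pts (principal_open X h) \<longleftrightarrow> x \<in> pts X \<and> h x \<noteq> 0" for x
    by (simp add: pts_principal_open)
  have mono: "\<exists>c m. C x = monom c m" if x: "x \<in> pts (principal_open X h)" for x
  proof (rule no_nonzero_roots_imp_monom)
    fix w :: 'k assume w: "w \<noteq> 0"
    then have "h (act w x) \<noteq> 0"
      using stable x unfolding Gm_stable_def by (auto simp: D pts_Gm)
    then show "poly (C x) w \<noteq> 0" using hC[OF w] x D by auto
  qed
  obtain x0 where x0: "x0 \<in> pts (principal_open X h)" using ne by blast
  obtain c0 m where m: "C x0 = monom c0 m" using mono[OF x0] by blast
  have "c0 \<noteq> 0"
  proof
    assume "c0 = 0"
    then have "h (act 1 x0) = 0" using hC[of 1 x0] x0 m by (simp add: D)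
    then show False using x0 Gm_action_one[OF act, of x0] by (simp add: D)
  qed
  have other: "coeff (C x) n = 0" if "n \<noteq> m" "x \<in> pts (principal_open X h)" for n x
  proof -
    have "(\<forall>x\<in>pts X. coeff (C x) m = 0) \<or> (\<forall>x\<in>pts X. coeff (C x) n * h x = 0)"
    proof (rule integral_onD[OF affine_variety_integral[OF X]])
      show "(\<lambda>x. coeff (C x) m) \<in> reg X" "(\<lambda>x. coeff (C x) n * h x) \<in> reg X"
        by (intro mult poly_family_coeff[OF C] h)+
      fix x assume x: "x \<in> pts X"
      show "coeff (C x) m * (coeff (C x) n * h x) = 0"
      proof (cases "h x = 0")
        case False
        then obtain c k where "C x = monom c k" using mono[of x] x D by blast
        then show ?thesis using \<open>n \<noteq> m\<close> by simp
      qed simp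
    qed
    moreover have "coeff (C x0) m \<noteq> 0" "x0 \<in> pts X" using m \<open>c0 \<noteq> 0\<close> x0 D by auto
    ultimately have "\<forall>x\<in>pts X. coeff (C x) n * h x = 0" by blast
    then show ?thesis using that(2) D by auto
  qed
  have "h (act w x) = h x * (w ^ m / w ^ N)"
    if w: "w \<noteq> 0" and x: "x \<in> pts (principal_open X h)" for w x
  proof -
    have Cx: "C x = monom (coeff (C x) m) m"
      using other x by (intro poly_eqI) auto
    have "poly (C x) t = coeff (C x) m * t ^ m" for t
      by (subst Cx) (simp add: poly_monom)
    then have val: "h (act t x) = coeff (C x) m * t ^ m / t ^ N" if "t \<noteq> 0" for t
      using hC[OF that] x D by simp
    have "coeff (C x) m = h x"
      using val[of 1] Gm_action_one[OF act, of x] x D by simp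
    then show ?thesis using val[OF w] by simp
  qed
  then show ?thesis by blast
qed

text \<open>
  By homogeneity \<open>1 / h (act w x)\<close> is \<open>1 / h x\<close> times a power of \<open>w\<close>, hence regular on \<open>Gm \<times> D(h)\<close>.
\<close>

lemma affine_Gm_variety_principal_open:
  fixes X :: "('p, 'k::alg_closed_field) function_space" and act :: "'k \<Rightarrow> 'p \<Rightarrow> 'p"
  assumes X: "affine_Gm_variety X act" and h: "h \<in> reg X"
    and ne: "pts (principal_open X h) \<noteq> {}"
    and stable: "Gm_stable act (pts (principal_open X h))"
  shows "affine_Gm_variety (principal_open X h) act"
proof -
  define D where "D = principal_open X h"
  have V: "affine_variety X" and act: "Gm_action X act"
    using X by (auto simp: affine_Gm_variety_def)
  have VD: "affine_variety D"
    unfolding D_def by (rule affine_variety_principal_open[OF V h ne])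
  have D: "x \<in> pts D \<longleftrightarrow> x \<in> pts X \<and> h x \<noteq> 0" for x
    by (simp add: D_def pts_principal_open)
  interpret X: function_algebra "reg X" by (rule affine_variety_function_algebra[OF V])
  interpret D: function_algebra "reg D" by (rule affine_variety_function_algebra[OF VD])
  interpret G: function_algebra "reg Gm" by (rule function_algebra_Gm)
  interpret P: function_algebra "reg (product_variety Gm D)"
    by (rule function_algebra_product[OF G.function_algebra_axioms D.function_algebra_axioms])
  have res: "F \<in> reg (product_variety Gm D)" if F: "F \<in> reg (product_variety Gm X)" for F
    using F
  proof (rule reg_productE)
    fix n :: nat and f g
    assume "\<And>i. i < n \<Longrightarrow> f i \<in> reg Gm" "\<And>i. i < n \<Longrightarrow> g i \<in> reg X"
      "\<And>x y. x \<in> pts Gm \<Longrightarrow> y \<in> pts X \<Longrightarrow> F (x, y) = (\<Sum>i<n. f i x * g i y)"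
    then show ?thesis
      by (intro reg_productI[of "{..<n}" f _ g])
         (auto simp: D_def pts_principal_open intro: reg_principal_open_restrict)
  qed
  obtain m N :: nat where hom: "\<And>w x. w \<noteq> 0 \<Longrightarrow> x \<in> pts D \<Longrightarrow> h (act w x) = h x * (w ^ m / w ^ N)"
    using stable_principal_open_homogeneous[OF V act h ne stable] unfolding D_def by blast
  have inv: "(\<lambda>p. 1 / h (snd p) * (fst p ^ N * (1 / fst p) ^ m)) \<in> reg (product_variety Gm D)"
    using reg_principal_open_inverse[OF X.function_algebra_axioms, of h, folded D_def]
    by (intro P.mult P.power reg_product_snd[of _ "\<lambda>x. 1 / h x"] reg_product_fst[of _ "\<lambda>t. t"]
        reg_product_fst[of _ "\<lambda>t. 1 / t"] G.function_algebra_axioms D.function_algebra_axioms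
        id_reg_Gm inverse_reg_Gm)
  have "(\<lambda>p. F (act (fst p) (snd p))) \<in> reg (product_variety Gm D)" if "F \<in> reg D" for F
  proof -
    obtain g e where g: "g \<in> reg X" "\<And>x. x \<in> pts X \<Longrightarrow> h x \<noteq> 0 \<Longrightarrow> F x = g x / h x ^ e"
      using \<open>F \<in> reg D\<close> unfolding D_def by (elim reg_principal_openE) blast
    show ?thesis
    proof (rule reg_product_cong)
      show "(\<lambda>p. g (act (fst p) (snd p)) * (1 / h (snd p) * (fst p ^ N * (1 / fst p) ^ m)) ^ e)
          \<in> reg (product_variety Gm D)"
        by (intro P.mult P.power inv res Gm_action_reg[OF act g(1)])
      fix p :: "'k \<times> 'p" assume p: "p \<in> pts (product_variety Gm D)"
      obtain w x where wx: "p = (w, x)" "w \<noteq> 0" "x \<in> pts D"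
        using p by (cases p) (auto simp: pts_product pts_Gm)
      have ax: "act w x \<in> pts X" "h (act w x) \<noteq> 0"
        using stable wx Gm_action_pts[OF act, of w x]
        unfolding Gm_stable_def D_def[symmetric] by (auto simp: D pts_Gm)
      have "1 / h (act w x) = 1 / h x * (w ^ N * (1 / w) ^ m)"
        using hom[OF wx(2,3)] by (simp add: power_divide)
      then have "F (act w x) = g (act w x) * (1 / h x * (w ^ N * (1 / w) ^ m)) ^ e"
        using g(2)[OF ax] by (metis (no_types, lifting) divide_inverse inverse_eq_divide power_inverse)
      then show "F (act (fst p) (snd p)) =
          g (act (fst p) (snd p)) * (1 / h (snd p) * (fst p ^ N * (1 / fst p) ^ m)) ^ e"
        by (simp add: wx)
    qed
  qed
  moreover have "act w x \<in> pts D" if "w \<noteq> 0" "x \<in> pts D" for w x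
    using stable that unfolding Gm_stable_def D_def[symmetric] by (auto simp: pts_Gm)
  ultimately have "morphism (product_variety Gm D) D (\<lambda>(w, x). act w x)"
    unfolding morphism_def by (auto simp: pts_product pts_Gm case_prod_unfold)
  then have "Gm_action D act"
    using act unfolding Gm_action_def by (auto simp: D)
  then show ?thesis
    using VD unfolding affine_Gm_variety_def D_def by blast
qed

section \<open>Units of weight one\<close>

locale weight_one_unit =
  fixes X :: "('p, 'k::alg_closed_field) function_space" and act :: "'k \<Rightarrow> 'p \<Rightarrow> 'p" and u :: "'p \<Rightarrow> 'k"
  assumes Gm_variety: "affine_Gm_variety X act"
    and unit: "u \<in> unit_functions X"
    and weight: "semi_invariant_weight_one X act u"
begin

lemma affine: "affine_variety X" and action: "Gm_action X act"
  using Gm_variety by (auto simp: affine_Gm_variety_def)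

sublocale R: function_algebra "reg X"
  by (rule affine_variety_function_algebra[OF affine])

lemmas reg_cong = affine_variety_reg_cong[OF affine]
lemmas act_pts = Gm_action_pts[OF action]
lemmas act_one = Gm_action_one[OF action]
lemmas act_mult = Gm_action_mult[OF action]

lemma u_reg: "u \<in> reg X"
  using unit by (simp add: unit_functions_def)

lemma u_nonzero: "x \<in> pts X \<Longrightarrow> u x \<noteq> 0"
  using unit unfolding unit_functions_def by auto

lemma u_inverse_reg: "(\<lambda>x. 1 / u x) \<in> reg X"
proof -
  obtain v where v: "v \<in> reg X" "\<forall>x\<in>pts X. u x * v x = 1"
    using unit unfolding unit_functions_def by auto
  show ?thesis
    by (rule reg_cong[OF v(1)]) (use v(2) u_nonzero in \<open>auto simp: field_simps\<close>)
qed

lemma u_act: "w \<noteq> 0 \<Longrightarrow> x \<in> pts X \<Longrightarrow> u (act w x) = w * u x"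
  using weight by (simp add: semi_invariant_weight_one_def pts_Gm)

text \<open>
  Moving points along their orbits by a unit \<open>t\<close> is a morphism, being the action after \<open>x \<mapsto> (t x, x)\<close>.
\<close>

lemma act_twisted_reg:
  assumes f: "f \<in> reg X" and t: "t \<in> reg X" "t' \<in> reg X" "\<And>x. x \<in> pts X \<Longrightarrow> t x * t' x = 1"
  shows "(\<lambda>x. f (act (t x) x)) \<in> reg X"
proof -
  have "(\<lambda>x. g (t x)) \<in> reg X" if "g \<in> reg Gm" for g
  proof -
    have "\<exists>G\<in>reg X. \<forall>x. t x * t' x = 1 \<longrightarrow> g (t x) = G x"
      by (rule reg_Gm_pullback[OF R.function_algebra_axioms t(1,2) \<open>g \<in> reg Gm\<close>])
    then obtain G where G: "G \<in> reg X" "\<forall>x. t x * t' x = 1 \<longrightarrow> g (t x) = G x" ..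
    show ?thesis using t(3) G(2) by (intro reg_cong[OF G(1)]) auto
  qed
  then have "\<exists>G\<in>reg X. \<forall>x. t x \<in> pts Gm \<longrightarrow> x \<in> pts X \<longrightarrow>
      (\<lambda>p. f (act (fst p) (snd p))) (t x, x) = G x"
    by (intro reg_product_pullback[OF R.function_algebra_axioms Gm_action_reg[OF action f]])
  then obtain G where G: "G \<in> reg X"
    "\<forall>x. t x \<in> pts Gm \<longrightarrow> x \<in> pts X \<longrightarrow> f (act (t x) x) = G x"
    by auto
  have "t x \<noteq> 0" if "x \<in> pts X" for x using t(3)[OF that] by auto
  then show ?thesis using G by (intro reg_cong[OF G(1)]) (auto simp: pts_Gm)
qed

text \<open>The retraction of \<open>X\<close> onto the fibre of \<open>u\<close> over \<open>1\<close> along the orbits.\<close>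

definition retract :: "'p \<Rightarrow> 'p" where
  "retract x = act (1 / u x) x"

lemma retract_pts: "x \<in> pts X \<Longrightarrow> retract x \<in> pts X"
  unfolding retract_def using u_nonzero by (intro act_pts) auto

lemma u_retract: "x \<in> pts X \<Longrightarrow> u (retract x) = 1"
  unfolding retract_def using u_nonzero by (simp add: u_act)

lemma act_retract: "x \<in> pts X \<Longrightarrow> act (u x) (retract x) = x"
  unfolding retract_def using u_nonzero by (simp add: act_mult act_one)

lemma retract_act: "w \<noteq> 0 \<Longrightarrow> x \<in> pts X \<Longrightarrow> retract (act w x) = retract x"
  unfolding retract_def using u_nonzero by (simp add: act_mult act_pts u_act)

lemma retract_reg: "f \<in> reg X \<Longrightarrow> (\<lambda>x. f (retract x)) \<in> reg X"
  unfolding retract_def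
  by (rule act_twisted_reg[OF _ u_inverse_reg u_reg]) (auto dest: u_nonzero)

lemma morphism_u: "morphism X Gm u"
  unfolding morphism_def
proof (intro conjI ballI)
  show "u ` pts X \<subseteq> pts Gm" using u_nonzero by (auto simp: pts_Gm)
  fix f :: "'k \<Rightarrow> 'k" assume "f \<in> reg Gm"
  then have "\<exists>G\<in>reg X. \<forall>x. u x * (1 / u x) = 1 \<longrightarrow> f (u x) = G x"
    by (rule reg_Gm_pullback[OF R.function_algebra_axioms u_reg u_inverse_reg])
  then obtain G where G: "G \<in> reg X" "\<forall>x. u x * (1 / u x) = 1 \<longrightarrow> f (u x) = G x" ..
  show "(\<lambda>x. f (u x)) \<in> reg X" using G(2) u_nonzero by (intro reg_cong[OF G(1)]) auto
qed

lemma equivariant_u: "Gm_equivariant X act (*) u"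
  by (simp add: Gm_equivariant_def pts_Gm u_act)

lemma dominant_u: "dominant X Gm u"
proof -
  obtain x where x: "x \<in> pts X" using affine_variety_nonempty[OF affine] by blast
  have "u ` pts X = pts Gm"
  proof
    show "u ` pts X \<subseteq> pts Gm" using u_nonzero by (auto simp: pts_Gm)
    show "pts Gm \<subseteq> u ` pts X"
    proof
      fix t :: 'k assume t: "t \<in> pts Gm"
      have "u (act (t / u x) x) = t" "act (t / u x) x \<in> pts X"
        using t x u_nonzero[OF x] by (auto simp: pts_Gm u_act act_pts)
      then show "t \<in> u ` pts X" by force
    qed
  qed
  then show ?thesis
    unfolding dominant_def topspace_zariski[OF function_algebra_Gm, symmetric]
    by (simp add: closure_of_topspace)
qed

text \<open>
  Retracting \<open>X\<close> onto the fibre along the orbits turns a product that vanishes on the fibre into one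
  that vanishes on \<open>X\<close>, where one factor must be zero.
\<close>

lemma fibre_integral:
  assumes y: "y \<noteq> 0"
  shows "integral_on {x \<in> pts X. u x = y} (reg X)"
  unfolding integral_on_def
proof (intro ballI impI)
  fix f g assume fg: "f \<in> reg X" "g \<in> reg X" and 0: "\<forall>z\<in>{x \<in> pts X. u x = y}. f z * g z = 0"
  define T where "T = (\<lambda>x. act (y * (1 / u x)) x)"
  have T: "T x \<in> {x \<in> pts X. u x = y}" if "x \<in> pts X" for x
    using that u_nonzero[OF that] y by (simp add: T_def act_pts u_act)
  have fix_T: "T x = x" if "x \<in> pts X" "u x = y" for x
    using that y by (simp add: T_def act_one)
  have reg_T: "(\<lambda>x. f (T x)) \<in> reg X" if "f \<in> reg X" for f
    unfolding T_def
    by (rule act_twisted_reg[OF that R.mult[OF R.const u_inverse_reg] R.mult[OF R.const u_reg, of "1 / y"]])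
       (use y u_nonzero in auto)
  have "(\<forall>x\<in>pts X. f (T x) = 0) \<or> (\<forall>x\<in>pts X. g (T x) = 0)"
    using T 0 by (intro integral_onD[OF affine_variety_integral[OF affine]] reg_T fg) auto
  then show "(\<forall>z\<in>{x \<in> pts X. u x = y}. f z = 0) \<or> (\<forall>z\<in>{x \<in> pts X. u x = y}. g z = 0)"
    using fix_T by fastforce
qed

lemma connected_fibres_u: "connected_fibres X Gm u"
  unfolding connected_fibres_def
  by (intro ballI integral_on_connectedin R.function_algebra_axioms fibre_integral) (auto simp: pts_Gm)

text \<open>
  The algebra of invariants is finitely generated: it is the image of the coordinate ring under
  composition with the retraction. Its generators embed the quotient into affine space.
\<close>

lemma invariant_coordinates:
  "\<exists>n s. (\<forall>x i. n \<le> i \<longrightarrow> s x i = 0) \<and> (\<forall>i. (\<lambda>x. s x i) \<in> reg X) \<and>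
     (\<forall>w x. w \<noteq> 0 \<longrightarrow> x \<in> pts X \<longrightarrow> s (act w x) = s x) \<and>
     (\<forall>f\<in>reg X. \<exists>g\<in>polys {..<n}. \<forall>x\<in>pts X. f (retract x) = g (s x))"
proof -
  obtain S where S: "finite S" "reg X = functions_gen (pts X) S"
    using affine unfolding affine_variety_def by auto
  obtain n :: nat and c where c: "S = c ` {i. i < n}"
    using finite_imp_nat_seg_image_inj_on[OF S(1)] by blast
  define s where "s = (\<lambda>x i. if i < n then c i (retract x) else 0)"
  interpret P: function_algebra "polys {..<n} :: ((nat \<Rightarrow> 'k) \<Rightarrow> 'k) set"
    by (rule function_algebra_polys)
  have cX: "c i \<in> reg X" if "i < n" for i
    using that c functions_gen_superset[of S "pts X"] S(2) by auto
  have 1: "(\<lambda>x. s x i) \<in> reg X" for i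
    using retract_reg[OF cX, of i] R.const[of 0] by (cases "i < n") (simp_all add: s_def)
  have 2: "s (act w x) = s x" if "w \<noteq> 0" "x \<in> pts X" for w x
    unfolding s_def retract_act[OF that] ..
  have 3: "\<exists>g\<in>polys {..<n}. \<forall>x\<in>pts X. f (retract x) = g (s x)" if f: "f \<in> reg X" for f
  proof -
    obtain f0 where f0: "f0 \<in> algebra_gen S" "\<forall>x\<in>pts X. f x = f0 x"
      using f unfolding S(2) functions_gen_def by auto
    have "\<exists>g\<in>polys {..<n}. \<forall>x. f0 (retract x) = g (s x)"
      using f0(1)
    proof induction
      case (const a)
      show ?case by (rule bexI[OF _ P.const[of a]]) simp
    next
      case (gen f)
      then obtain i where "i < n" "f = c i" using c by auto
      then show ?case
        by (intro bexI[OF _ coord_in_polys[of i "{..<n}"]]) (auto simp: s_def)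
    next
      case (add f f')
      then obtain g g' where "g \<in> polys {..<n}" "g' \<in> polys {..<n}"
        "\<forall>x. f (retract x) = g (s x)" "\<forall>x. f' (retract x) = g' (s x)" by blast
      then show ?case by (intro bexI[OF _ P.add[of g g']]) auto
    next
      case (mult f f')
      then obtain g g' where "g \<in> polys {..<n}" "g' \<in> polys {..<n}"
        "\<forall>x. f (retract x) = g (s x)" "\<forall>x. f' (retract x) = g' (s x)" by blast
      then show ?case by (intro bexI[OF _ P.mult[of g g']]) auto
    qed
    then show ?thesis using f0(2) retract_pts by metis
  qed
  show ?thesis
    by (rule exI[of _ n], rule exI[of _ s]) (use 1 2 3 in \<open>auto simp: s_def\<close>)
qed

end

section \<open>The quotient and the trivial bundle\<close>

locale invariant_embedding = weight_one_unit X act u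
  for X :: "('p, 'k::alg_closed_field) function_space" and act u +
  fixes n :: nat and s :: "'p \<Rightarrow> nat \<Rightarrow> 'k"
  assumes s_beyond: "n \<le> i \<Longrightarrow> s x i = 0"
    and s_reg: "(\<lambda>x. s x i) \<in> reg X"
    and s_act: "w \<noteq> 0 \<Longrightarrow> x \<in> pts X \<Longrightarrow> s (act w x) = s x"
    and s_generates: "f \<in> reg X \<Longrightarrow> \<exists>g\<in>polys {..<n}. \<forall>x\<in>pts X. f (retract x) = g (s x)"
begin

lemma polys_s_reg: "g \<in> polys I \<Longrightarrow> (\<lambda>x. g (s x)) \<in> reg X"
  unfolding polys_def by (rule R.pullback[of _ "(\<lambda>i z. z i) ` I"]) (auto intro: s_reg)

lemma s_retract: "x \<in> pts X \<Longrightarrow> s (retract x) = s x"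
  unfolding retract_def using u_nonzero by (simp add: s_act)

lemma integral_on_image: "integral_on (s ` pts X) (polys I)"
  unfolding integral_on_def
proof (intro ballI impI)
  fix f g :: "(nat \<Rightarrow> 'k) \<Rightarrow> 'k"
  assume fg: "f \<in> polys I" "g \<in> polys I" "\<forall>z\<in>s ` pts X. f z * g z = 0"
  have "(\<forall>x\<in>pts X. f (s x) = 0) \<or> (\<forall>x\<in>pts X. g (s x) = 0)"
    using fg by (intro integral_onD[OF affine_variety_integral[OF affine]] polys_s_reg) auto
  then show "(\<forall>z\<in>s ` pts X. f z = 0) \<or> (\<forall>z\<in>s ` pts X. g z = 0)" by auto
qed

text \<open>
  The invariants separate orbits: all functions of the retraction are polynomials in them, and
  functions separate points.
\<close>

lemma retract_eq:
  assumes "x \<in> pts X" "y \<in> pts X" "s x = s y"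
  shows "retract x = retract y"
proof (rule affine_variety_separates[OF affine])
  show "f (retract x) = f (retract y)" if "f \<in> reg X" for f
    using s_generates[OF that] assms by metis
qed (use assms retract_pts in auto)

text \<open>
  The spectrum of the ring of invariants, realised as the image of \<open>X\<close> in affine space.
\<close>

definition quotient :: "(nat \<Rightarrow> 'k, 'k) function_space" where
  "quotient = \<lparr>pts = s ` pts X, reg = functions_gen (s ` pts X) ((\<lambda>i z. z i) ` {..<n})\<rparr>"

text \<open>
  Any point over \<open>q\<close> will do, since the retraction sends all of them to the same point.
\<close>

definition section_map :: "(nat \<Rightarrow> 'k) \<Rightarrow> 'p" where
  "section_map q = retract (SOME x. x \<in> pts X \<and> s x = q)"

lemma pts_quotient: "pts quotient = s ` pts X"
  by (simp add: quotient_def)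

lemma reg_quotient: "f \<in> reg quotient \<longleftrightarrow> (\<exists>g\<in>polys {..<n}. \<forall>x\<in>pts X. f (s x) = g (s x))"
  by (simp add: quotient_def functions_gen_def polys_def)

lemma function_algebra_quotient: "function_algebra (reg quotient)"
  by (simp add: quotient_def function_algebra_functions_gen)

lemma section_s: "x \<in> pts X \<Longrightarrow> section_map (s x) = retract x"
  unfolding section_map_def by (rule someI2[of _ x]) (auto intro: retract_eq)

lemma morphism_section: "morphism quotient X section_map"
  unfolding morphism_def
proof (intro conjI ballI)
  show "section_map ` pts quotient \<subseteq> pts X"
    by (auto simp: pts_quotient section_s retract_pts)
  show "(\<lambda>q. f (section_map q)) \<in> reg quotient" if "f \<in> reg X" for f
    using s_generates[OF that] by (simp add: reg_quotient section_s)
qed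

lemma morphism_s: "morphism X quotient s"
  unfolding morphism_def
proof (intro conjI ballI)
  show "s ` pts X \<subseteq> pts quotient" by (simp add: pts_quotient)
  fix f assume "f \<in> reg quotient"
  then obtain g where g: "g \<in> polys {..<n}" "\<forall>x\<in>pts X. f (s x) = g (s x)"
    by (auto simp: reg_quotient)
  then show "(\<lambda>x. f (s x)) \<in> reg X"
    by (intro reg_cong[OF polys_s_reg[OF g(1)]]) auto
qed

text \<open>A character of the quotient becomes one of \<open>X\<close> by restriction along the section.\<close>

lemma affine_variety_quotient: "affine_variety quotient"
proof -
  have "\<exists>!q. q \<in> pts quotient \<and> (\<forall>f\<in>reg quotient. \<theta> f = f q)"
    if \<theta>: "algebra_character quotient \<theta>" for \<theta>
  proof -
    have sec: "(\<lambda>q. f (section_map q)) \<in> reg quotient" if "f \<in> reg X" for f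
      by (rule morphism_reg[OF morphism_section that])
    have pts: "section_map q \<in> pts X" if "q \<in> pts quotient" for q
      by (rule morphism_pts[OF morphism_section that])
    have eq: "\<theta> f = \<theta> g"
      if "f \<in> reg quotient" "g \<in> reg quotient" "\<And>q. q \<in> pts quotient \<Longrightarrow> f q = g q" for f g
      using \<theta> that unfolding algebra_character_def by blast
    have "algebra_character X (\<lambda>f. \<theta> (\<lambda>q. f (section_map q)))"
      using \<theta> sec pts unfolding algebra_character_def by auto
    from affine_variety_character[OF affine this] obtain x where
      x: "x \<in> pts X" "\<And>f. f \<in> reg X \<Longrightarrow> \<theta> (\<lambda>q. f (section_map q)) = f x" by blast
    have val: "\<theta> f = f (s x)" if f: "f \<in> reg quotient" for f
    proof -
      have fs: "(\<lambda>x. f (s x)) \<in> reg X" by (rule morphism_reg[OF morphism_s f])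
      have "\<theta> f = \<theta> (\<lambda>q. f (s (section_map q)))"
        by (rule eq[OF f sec[OF fs]]) (auto simp: pts_quotient section_s s_retract)
      then show ?thesis using x(2)[OF fs] by simp
    qed
    have uniq: "q = s x" if q: "q \<in> pts quotient" "\<forall>f\<in>reg quotient. \<theta> f = f q" for q
    proof
      fix i
      show "q i = s x i"
      proof (cases "i < n")
        case True
        then have "(\<lambda>z. z i) \<in> reg quotient"
          unfolding reg_quotient by (intro bexI[OF _ coord_in_polys[of i]]) auto
        then show ?thesis using q(2) val by metis
      next
        case False
        then show ?thesis using q(1) s_beyond by (auto simp: pts_quotient)
      qed
    qed
    show ?thesis
    proof (rule ex1I[of _ "s x"])
      show "s x \<in> pts quotient \<and> (\<forall>f\<in>reg quotient. \<theta> f = f (s x))"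
        using x(1) val by (simp add: pts_quotient)
    qed (use uniq in blast)
  qed
  moreover have "(\<forall>z\<in>pts quotient. f z = 0) \<or> (\<forall>z\<in>pts quotient. g z = 0)"
    if "f \<in> reg quotient" "g \<in> reg quotient" "\<forall>z\<in>pts quotient. f z * g z = 0" for f g
  proof -
    have "(\<forall>x\<in>pts X. f (s x) = 0) \<or> (\<forall>x\<in>pts X. g (s x) = 0)"
      using that by (intro integral_onD[OF affine_variety_integral[OF affine]]
          morphism_reg[OF morphism_s]) (auto simp: pts_quotient)
    then show ?thesis by (auto simp: pts_quotient)
  qed
  moreover have "\<exists>S. finite S \<and> reg quotient = functions_gen (pts quotient) S"
    by (rule exI[of _ "(\<lambda>i z. z i) ` {..<n}"]) (simp add: quotient_def)
  moreover have "pts quotient \<noteq> {}"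
    using affine_variety_nonempty[OF affine] by (simp add: pts_quotient)
  ultimately show ?thesis unfolding affine_variety_def by blast
qed

text \<open>
  An invariant morphism factors through its restriction to the section, since every orbit meets
  the section exactly once.
\<close>

lemma categorical_quotient_s: "categorical_quotient X act quotient s"
  unfolding categorical_quotient_def
proof (intro conjI allI impI)
  show "affine_variety quotient" by (rule affine_variety_quotient)
  show "morphism X quotient s" by (rule morphism_s)
  show "Gm_invariant X act s" by (simp add: Gm_invariant_def pts_Gm s_act)
  fix Z :: "(nat \<Rightarrow> 'k, 'k) function_space set" and \<psi>
  assume "variety Z" and \<psi>: "morphism_to_atlas X Z \<psi>" and inv: "Gm_invariant X act \<psi>"
  show "\<exists>\<eta>. morphism_to_atlas quotient Z \<eta> \<and> (\<forall>x\<in>pts X. \<psi> x = \<eta> (s x)) \<and>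
           (\<forall>\<eta>'. morphism_to_atlas quotient Z \<eta>' \<longrightarrow> (\<forall>x\<in>pts X. \<psi> x = \<eta>' (s x)) \<longrightarrow>
              (\<forall>q\<in>pts quotient. \<eta>' q = \<eta> q))"
  proof (rule exI[of _ "\<lambda>q. \<psi> (section_map q)"], intro conjI)
    show "morphism_to_atlas quotient Z (\<lambda>q. \<psi> (section_map q))"
      by (rule morphism_to_atlas_comp[OF function_algebra_quotient R.function_algebra_axioms
            morphism_section \<psi>])
    show *: "\<forall>x\<in>pts X. \<psi> x = \<psi> (section_map (s x))"
      using inv u_nonzero by (simp add: section_s retract_def Gm_invariant_def pts_Gm)
    show "\<forall>\<eta>'. morphism_to_atlas quotient Z \<eta>' \<longrightarrow> (\<forall>x\<in>pts X. \<psi> x = \<eta>' (s x)) \<longrightarrow>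
              (\<forall>q\<in>pts quotient. \<eta>' q = \<psi> (section_map q))"
      using * by (auto simp: pts_quotient)
  qed
qed

text \<open>
  A point is recovered from its value \<open>t\<close> under \<open>u\<close> and its orbit: it is the result of moving the
  representative of the orbit in the section by \<open>t\<close>.
\<close>

lemma isomorphism_product: "isomorphism X (product_variety Gm quotient) (\<lambda>x. (u x, s x))"
proof -
  define \<psi> where "\<psi> = (\<lambda>p. act (fst p) (section_map (snd p)))"
  interpret P: function_algebra "reg (product_variety Gm quotient)"
    by (rule function_algebra_product[OF function_algebra_Gm function_algebra_quotient])
  have "morphism X (product_variety Gm quotient) (\<lambda>x. (u x, s x))"
    unfolding morphism_def
  proof (intro conjI ballI)
    show "(\<lambda>x. (u x, s x)) ` pts X \<subseteq> pts (product_variety Gm quotient)"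
      using u_nonzero by (auto simp: pts_product pts_Gm pts_quotient)
    fix F assume F: "F \<in> reg (product_variety Gm (quotient :: (nat \<Rightarrow> 'k, 'k) function_space))"
    have "\<exists>G\<in>reg X. \<forall>x. u x \<in> pts Gm \<longrightarrow> s x \<in> pts quotient \<longrightarrow> F (u x, s x) = G x"
      by (rule reg_product_pullback[OF R.function_algebra_axioms F morphism_reg[OF morphism_u]
            morphism_reg[OF morphism_s]])
    then obtain G where G: "G \<in> reg X"
      "\<forall>x. u x \<in> pts Gm \<longrightarrow> s x \<in> pts quotient \<longrightarrow> F (u x, s x) = G x" ..
    show "(\<lambda>x. F (u x, s x)) \<in> reg X"
      using u_nonzero G(2) by (intro reg_cong[OF G(1)]) (auto simp: pts_Gm pts_quotient)
  qed
  moreover have "morphism (product_variety Gm quotient) X \<psi>"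
    unfolding morphism_def
  proof (intro conjI ballI)
    show "\<psi> ` pts (product_variety Gm quotient) \<subseteq> pts X"
      using morphism_pts[OF morphism_section] by (auto simp: \<psi>_def pts_product pts_Gm intro!: act_pts)
    fix f assume f: "f \<in> reg X"
    have "\<exists>G\<in>reg (product_variety Gm quotient). \<forall>p. fst p \<in> pts Gm \<longrightarrow>
        section_map (snd p) \<in> pts X \<longrightarrow> (\<lambda>p. f (act (fst p) (snd p))) (fst p, section_map (snd p)) = G p"
      by (intro reg_product_pullback[OF P.function_algebra_axioms Gm_action_reg[OF action f]]
          reg_product_fst[OF function_algebra_quotient]
          reg_product_snd[OF function_algebra_Gm, of "\<lambda>q. g (section_map q)" for g]
          morphism_reg[OF morphism_section])
    then obtain G where G: "G \<in> reg (product_variety Gm quotient)"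
      "\<forall>p. fst p \<in> pts Gm \<longrightarrow> section_map (snd p) \<in> pts X \<longrightarrow> f (\<psi> p) = G p"
      by (auto simp: \<psi>_def)
    show "(\<lambda>p. f (\<psi> p)) \<in> reg (product_variety Gm quotient)"
      using G(2) morphism_pts[OF morphism_section]
      by (intro reg_product_cong[OF G(1)]) (auto simp: pts_product)
  qed
  moreover have "\<forall>x\<in>pts X. \<psi> (u x, s x) = x"
    by (simp add: \<psi>_def section_s act_retract)
  moreover have "\<forall>p\<in>pts (product_variety Gm quotient). (u (\<psi> p), s (\<psi> p)) = p"
    by (auto simp: \<psi>_def pts_product pts_Gm pts_quotient section_s u_act s_act retract_pts
        u_retract s_retract)
  ultimately show ?thesis unfolding isomorphism_def by blast
qed

lemma trivial_bundle: "trivial_Gm_bundle X act"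
  unfolding trivial_Gm_bundle_def
  using categorical_quotient_s isomorphism_product
  by (auto simp: Gm_equivariant_def pts_Gm u_act s_act
      intro!: exI[of _ quotient] exI[of _ s] exI[of _ "\<lambda>x. (u x, s x)"])

end

section \<open>Generic smoothness of a unit of weight one\<close>

text \<open>
  The polynomial that \<open>partial_deriv\<close> picks is unique because the field is infinite.
\<close>

lemma partial_deriv_eqI:
  fixes F :: "'q \<times> (nat \<Rightarrow> 'k::alg_closed_field) \<Rightarrow> 'k"
  assumes "\<And>\<tau>. poly q \<tau> = F (t, z(m := \<tau>))"
  shows "partial_deriv F m (t, z) = poly (pderiv q) (z m)"
proof -
  have "(THE q. \<forall>\<tau>. poly q \<tau> = F (t, z(m := \<tau>))) = q"
    using assms by (intro the_equality poly_eq_of_cofinite[of "{}"]) auto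
  then show ?thesis by (simp add: partial_deriv_def)
qed

text \<open>
  Along the variable of the last equation with a nonzero coefficient, the derivatives of all earlier
  equations vanish, which leaves a diagonal entry of the Jacobian matrix.
\<close>

lemma triangular_equations_independent:
  fixes V :: "(nat \<Rightarrow> 'k::alg_closed_field) set"
  assumes T: "triangular_equations {..<n} V r e G"
    and diag: "\<And>i. i < r \<Longrightarrow> poly (pderiv (G i z)) (z (e i)) \<noteq> 0"
    and dep: "\<And>m. m < n \<Longrightarrow> (\<Sum>i<r. l i * partial_deriv (\<lambda>p. local_equation e G i (snd p)) m (t, z)) = 0"
  shows "\<forall>i<r. l i = 0"
proof (rule ccontr)
  assume "\<not> ?thesis"
  then have ne: "{i. i < r \<and> l i \<noteq> 0} \<noteq> {}" by auto
  define k where "k = Max {i. i < r \<and> l i \<noteq> 0}"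
  have k: "k < r" "l k \<noteq> 0"
    using Max_in[OF _ ne] unfolding k_def by auto
  have after: "l i = 0" if "k < i" "i < r" for i
  proof (rule ccontr)
    assume "l i \<noteq> 0"
    then have "i \<le> k" unfolding k_def using that by (intro Max_ge) auto
    then show False using that by simp
  qed
  let ?d = "\<lambda>i. partial_deriv (\<lambda>p. local_equation e G i (snd p)) (e k) (t, z)"
  have kk: "?d k = poly (pderiv (G k z)) (z (e k))"
    by (rule partial_deriv_eqI) (use T k in \<open>simp add: local_equation_def triangular_equations_def\<close>)
  have before: "?d i = 0" if "i < k" for i
  proof -
    have "?d i = poly (pderiv [:local_equation e G i z:]) (z (e k))"
      by (rule partial_deriv_eqI) (use T k that in \<open>simp add: triangular_equations_def\<close>)
    then show ?thesis by (simp add: pderiv_pCons)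
  qed
  have "(\<Sum>i<r. l i * ?d i) = (\<Sum>i\<in>{k}. l i * ?d i)"
    using k before after by (intro sum.mono_neutral_right) (auto, metis nat_neq_iff)
  moreover have "e k < n" using T k by (auto simp: triangular_equations_def)
  ultimately show False using dep[of "e k"] k diag kk by simp
qed

lemma pts_affine_space: "pts (affine_space m) = {z. \<forall>i\<ge>m. z i = 0}"
  by (simp add: affine_space_def Let_def)

lemma reg_affine_space:
  "f \<in> reg (affine_space m) \<longleftrightarrow> (\<exists>g\<in>polys {..<m}. \<forall>z\<in>pts (affine_space m). f z = g z)"
  by (simp add: affine_space_def Let_def functions_gen_def polys_def)

lemma function_algebra_affine_space: "function_algebra (reg (affine_space m))"
  by (simp add: affine_space_def Let_def function_algebra_functions_gen)

lemma polys_reg_affine_space: "g \<in> polys {..<m} \<Longrightarrow> g \<in> reg (affine_space m)"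
  unfolding reg_affine_space by blast

context invariant_embedding
begin

abbreviation ambient :: "('k \<times> (nat \<Rightarrow> 'k), 'k) function_space" where
  "ambient \<equiv> product_variety Gm (affine_space n)"

lemma function_algebra_ambient: "function_algebra (reg ambient)"
  by (rule function_algebra_product[OF function_algebra_Gm function_algebra_affine_space])

lemma embedding_pts: "x \<in> pts X \<Longrightarrow> (u x, s x) \<in> pts ambient"
  using u_nonzero s_beyond by (simp add: pts_product pts_Gm pts_affine_space)

lemma embedding_pullback:
  assumes F: "F \<in> reg ambient"
  shows "(\<lambda>x. F (u x, s x)) \<in> reg X"
proof -
  have "(\<lambda>x. g (s x)) \<in> reg X" if g: "g \<in> reg (affine_space n)" for g
  proof -
    obtain g0 where g0: "g0 \<in> polys {..<n}" "\<forall>z\<in>pts (affine_space n). g z = g0 z"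
      using g unfolding reg_affine_space by blast
    show ?thesis
      using g0(2) s_beyond by (intro reg_cong[OF polys_s_reg[OF g0(1)]]) (auto simp: pts_affine_space)
  qed
  then have "\<exists>G\<in>reg X. \<forall>x. u x \<in> pts Gm \<longrightarrow> s x \<in> pts (affine_space n) \<longrightarrow> F (u x, s x) = G x"
    by (intro reg_product_pullback[OF R.function_algebra_axioms F morphism_reg[OF morphism_u]])
  then obtain G where G: "G \<in> reg X"
    "\<forall>x. u x \<in> pts Gm \<longrightarrow> s x \<in> pts (affine_space n) \<longrightarrow> F (u x, s x) = G x" ..
  show ?thesis
    using G(2) u_nonzero s_beyond by (intro reg_cong[OF G(1)]) (auto simp: pts_Gm pts_affine_space)
qed

text \<open>
  A function is evaluated at \<open>x = act (u x) (retract x)\<close>; the action splits it into functions of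
  \<open>u x\<close> and of \<open>retract x\<close>, and the latter are polynomials in the invariants.
\<close>

lemma embedding_surjective:
  assumes f: "f \<in> reg X"
  shows "\<exists>F\<in>reg ambient. \<forall>x\<in>pts X. f x = F (u x, s x)"
proof -
  obtain m :: nat and a b where ab: "\<And>i. i < m \<Longrightarrow> a i \<in> reg Gm" "\<And>i. i < m \<Longrightarrow> b i \<in> reg X"
    "\<And>w x. w \<in> pts Gm \<Longrightarrow> x \<in> pts X \<Longrightarrow>
       (\<lambda>p. f (act (fst p) (snd p))) (w, x) = (\<Sum>i<m. a i w * b i x)"
    by (rule reg_productE[OF Gm_action_reg[OF action f]]) blast
  have "\<forall>i. \<exists>g. i < m \<longrightarrow> g \<in> polys {..<n} \<and> (\<forall>x\<in>pts X. b i (retract x) = g (s x))"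
    using s_generates ab(2) by blast
  then obtain g where g: "\<And>i. i < m \<Longrightarrow> g i \<in> polys {..<n}"
    "\<And>i x. i < m \<Longrightarrow> x \<in> pts X \<Longrightarrow> b i (retract x) = g i (s x)"
    unfolding choice_iff by blast
  show ?thesis
  proof (intro bexI ballI)
    show "(\<lambda>p. \<Sum>i<m. a i (fst p) * g i (snd p)) \<in> reg ambient"
      by (rule reg_productI[of "{..<m}" a _ g]) (use ab(1) g(1) polys_reg_affine_space in auto)
    show "f x = (\<Sum>i<m. a i (fst (u x, s x)) * g i (snd (u x, s x)))" if "x \<in> pts X" for x
      using ab(3)[of "u x" "retract x"] g(2) that u_nonzero[OF that]
      by (simp add: pts_Gm retract_pts act_retract)
  qed
qed

lemma pts_principal_open_one: "pts (principal_open X (\<lambda>_. 1)) = pts X"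
  by (simp add: pts_principal_open)

lemma closed_immersion_embedding:
  "closed_immersion (principal_open X (\<lambda>_. 1)) ambient (\<lambda>x. (u x, s x))"
  unfolding closed_immersion_def morphism_def pts_principal_open_one
proof (intro conjI ballI)
  show "(\<lambda>x. (u x, s x)) ` pts X \<subseteq> pts ambient" using embedding_pts by auto
  show "(\<lambda>x. F (u x, s x)) \<in> reg (principal_open X (\<lambda>_. 1))" if "F \<in> reg ambient" for F
    by (rule reg_principal_open_restrict[OF embedding_pullback[OF that]])
  fix g assume "g \<in> reg (principal_open X (\<lambda>_. 1))"
  then obtain f e where f: "f \<in> reg X" "\<And>x. x \<in> pts X \<Longrightarrow> (1::'k) \<noteq> 0 \<Longrightarrow> g x = f x / 1 ^ (e::nat)"
    by (rule reg_principal_openE) blast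
  then show "\<exists>F\<in>reg ambient. \<forall>x\<in>pts X. g x = F (u x, s x)"
    using embedding_surjective[OF f(1)] by simp
qed

text \<open>
  The image of the embedding is the product of \<open>Gm\<close> with the quotient, because \<open>Gm\<close> moves the
  first coordinate freely; hence its ideal is generated by functions of the second coordinate.
\<close>

lemma vanishing_ideal_locally_generated:
  assumes x: "x \<in> pts X" and E: "\<And>i. i < r \<Longrightarrow> E i \<in> polys {..<n}"
    and gen: "generate_locally {..<n} (s ` pts X) r E (s x)"
    and F: "F \<in> reg ambient" "\<forall>y\<in>pts X. F (u y, s y) = 0"
  shows "F \<in> generated_ideal_at (reg ambient) (pts ambient) r (\<lambda>i p. E i (snd p)) (u x, s x)"
proof -
  define L where "L = generated_ideal_at (reg ambient) (pts ambient) r (\<lambda>i p. E i (snd p)) (u x, s x)"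
  interpret L: local_ideal "reg ambient" "(u x, s x)" L
    unfolding L_def by (rule local_ideal_generated_ideal_at[OF function_algebra_ambient])
  have snd_reg: "(\<lambda>p. g (snd p)) \<in> reg ambient" if "g \<in> reg (affine_space n)" for g
    by (rule reg_product_snd[OF function_algebra_Gm that])
  have fst_reg: "(\<lambda>p. fst p) \<in> reg ambient"
    by (rule reg_product_fst[OF function_algebra_affine_space id_reg_Gm])
  have ideal_poly: "(\<lambda>p. g (snd p)) \<in> L" if "g \<in> polys {..<n}" "\<forall>y\<in>pts X. g (s y) = 0" for g
  proof -
    have "local_ideal (polys {..<n}) (snd (u x, s x)) {g. (\<lambda>p. g (snd p)) \<in> L}"
      by (rule local_ideal_pullback[OF L.local_ideal_axioms function_algebra_polys])
         (rule snd_reg[OF polys_reg_affine_space])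
    moreover have "\<forall>i<r. E i \<in> {g. (\<lambda>p. g (snd p)) \<in> L}"
      using generator_in_generated_ideal_at[OF function_algebra_ambient,
          of _ r "\<lambda>i p. E i (snd p)"] by (simp add: L_def)
    moreover have "\<forall>z\<in>s ` pts X. g z = 0" using that(2) by simp
    ultimately have "g \<in> {g. (\<lambda>p. g (snd p)) \<in> L}"
      using generate_locallyD[OF gen, of "{g. (\<lambda>p. g (snd p)) \<in> L}" g] that(1) by simp
    then show ?thesis by simp
  qed
  obtain N C where C: "C \<in> poly_family (reg (affine_space n))"
    and FC: "\<forall>t. t \<noteq> 0 \<longrightarrow> (\<forall>z\<in>pts (affine_space n). F (t, z) = poly (C z) t / t ^ N)"
    using reg_Gm_product_Laurent[OF function_algebra_affine_space F(1)] by blast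
  have C0: "C (s y) = 0" if y: "y \<in> pts X" for y
  proof (rule poly_zero_of_cofinite_roots[of "{0}"])
    fix t :: 'k assume t: "t \<notin> {0}"
    (* Every nonzero t is the first coordinate of a point with the same invariants as y. *)
    define y' where "y' = act (t / u y) y"
    have y': "y' \<in> pts X" "u y' = t" "s y' = s y"
      using t y u_nonzero[OF y] by (auto simp: y'_def act_pts u_act s_act)
    then have "F (t, s y) = 0" using F(2) by force
    then show "poly (C (s y)) t = 0"
      using FC t s_beyond by (auto simp: pts_affine_space)
  qed simp
  have "(\<lambda>p. coeff (C (snd p)) j) \<in> L" for j
  proof -
    obtain g where g: "g \<in> polys {..<n}" "\<forall>z\<in>pts (affine_space n). coeff (C z) j = g z"
      using poly_family_coeff[OF C, of j] unfolding reg_affine_space by blast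
    have "g (s y) = 0" if "y \<in> pts X" for y
    proof -
      have "s y \<in> pts (affine_space n)" using s_beyond by (simp add: pts_affine_space)
      then show ?thesis using g(2) C0[OF that] by (metis coeff_0)
    qed
    then have "(\<lambda>p. g (snd p)) \<in> L" using ideal_poly g(1) by blast
    then show ?thesis
      unfolding L_def by (rule generated_ideal_at_cong) (use g(2) in \<open>auto simp: pts_product\<close>)
  qed
  moreover have "(\<lambda>p. C (snd p)) \<in> poly_family (reg ambient)"
    using C snd_reg unfolding poly_family_def by auto
  ultimately have "(\<lambda>p. poly (C (snd p)) (fst p)) \<in> L"
    using L.poly_family_eval_ideal fst_reg by blast
  then have "(\<lambda>p. fst p ^ N * F p) \<in> L"
    unfolding L_def by (rule generated_ideal_at_cong) (use FC in \<open>auto simp: pts_product pts_Gm\<close>)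
  moreover have "fst (u x, s x) ^ N \<noteq> 0" using u_nonzero[OF x] by simp
  ultimately have "F \<in> L"
    using L.saturated[OF L.power[OF fst_reg]] by blast
  then show ?thesis by (simp add: L_def)
qed

text \<open>
  The open set is the nonvanishing locus of the function \<open>w\<close> that controls the leading coefficients
  and the diagonal of the Jacobian matrix; irreducibility makes it dense.
\<close>

theorem generically_smooth_u: "generically_smooth X Gm u"
proof -
  define V where "V = s ` pts X"
  have V: "V \<noteq> {}" unfolding V_def using affine_variety_nonempty[OF affine] by simp
  obtain xs where xs: "set xs = {..<n}" "separating_order V xs"
    using separating_order_exists[OF _ V, of "{..<n}"] by blast
  obtain r e G w where w: "w \<in> polys {..<n}" "\<exists>z\<in>V. w z \<noteq> 0"
    and T: "triangular_equations {..<n} V r e G"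
    and loc: "\<And>z. z \<in> V \<Longrightarrow> w z \<noteq> 0 \<Longrightarrow> (\<forall>i<r. poly (pderiv (G i z)) (z (e i)) \<noteq> 0) \<and>
        generate_locally {..<n} V r (local_equation e G) z"
    using generic_triangular_equations[OF V xs(2)] integral_on_image unfolding xs(1) V_def by metis
  define U where "U = {x \<in> pts X. w (s x) \<noteq> 0}"
  have U: "openin (zariski X) U"
    unfolding U_def by (rule openin_zariski_basic[OF polys_s_reg[OF w(1)]])
  have "U \<noteq> {}" using w(2) by (auto simp: U_def V_def)
  then have dense: "zariski X closure_of U = pts X"
    by (rule integral_on_dense[OF R.function_algebra_axioms affine_variety_integral[OF affine] U])
  have "smooth_at X Gm u x" if "x \<in> U" for x
  proof -
    have x: "x \<in> pts X" "s x \<in> V" "w (s x) \<noteq> 0" using that by (auto simp: U_def V_def)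
    define E where "E = (\<lambda>i p::'k \<times> (nat \<Rightarrow> 'k). local_equation e G i (snd p))"
    have eqs: "local_equation e G i \<in> polys {..<n}" "\<forall>z\<in>V. local_equation e G i z = 0" if "i < r" for i
      using T that unfolding triangular_equations_def by blast+
    have Ereg: "E i \<in> reg ambient" if "i < r" for i
      unfolding E_def
      by (rule reg_product_snd[OF function_algebra_Gm polys_reg_affine_space[OF eqs(1)[OF that]]])
    have E0: "E i (u y, s y) = 0" if "i < r" "y \<in> pts X" for i y
      using eqs(2)[OF that(1)] that(2) by (simp add: E_def V_def)
    have ideal: "\<exists>c\<in>reg ambient. c (u x, s x) \<noteq> 0 \<and> (\<exists>a. (\<forall>i<r. a i \<in> reg ambient) \<and>
        (\<forall>p\<in>pts ambient. c p * F p = (\<Sum>i<r. a i p * E i p)))"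
      if "F \<in> reg ambient" "\<forall>y\<in>pts X. F (u y, s y) = 0" for F
    proof -
      have "generate_locally {..<n} (s ` pts X) r (local_equation e G) (s x)"
        using loc[OF x(2,3)] by (simp add: V_def)
      from vanishing_ideal_locally_generated[OF x(1) eqs(1) this that]
      show ?thesis by (simp add: generated_ideal_at_def E_def)
    qed
    have indep: "\<forall>i<r. l i = 0"
      if "\<forall>m<n. (\<Sum>i<r. l i * partial_deriv (E i) m (u x, s x)) = 0" for l
      by (rule triangular_equations_independent[OF T, of "s x" l "u x"])
         (use loc[OF x(2,3)] that in \<open>auto simp: E_def\<close>)
    have equations: "\<exists>(r::nat) f. (\<forall>i<r. f i \<in> reg ambient \<and> (\<forall>y\<in>pts X. f i (u y, s y) = 0)) \<and>
        (\<forall>F\<in>reg ambient. (\<forall>y\<in>pts X. F (u y, s y) = 0) \<longrightarrow>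
          (\<exists>c\<in>reg ambient. c (u x, s x) \<noteq> 0 \<and> (\<exists>a. (\<forall>i<r. a i \<in> reg ambient) \<and>
            (\<forall>p\<in>pts ambient. c p * F p = (\<Sum>i<r. a i p * f i p))))) \<and>
        (\<forall>l. (\<forall>m<n. (\<Sum>i<r. l i * partial_deriv (f i) m (u x, s x)) = 0) \<longrightarrow> (\<forall>i<r. l i = 0))"
      by (intro exI[of _ r] exI[of _ E]) (use Ereg E0 ideal indep in blast)
    show ?thesis
      unfolding smooth_at_def Let_def
      (* The embedding is closed on all of X, so the neighbourhood of x need not be shrunk. *)
      by (rule bexI[OF _ R.const[of 1]], rule conjI, rule one_neq_zero, rule exI[of _ n],
          rule exI[of _ s], rule conjI, rule closed_immersion_embedding,
          rule equations[folded pts_principal_open_one])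
  qed
  then show ?thesis
    unfolding generically_smooth_def using U dense by blast
qed

end

lemma (in weight_one_unit) invariant_embedding_exists:
  "\<exists>n s. invariant_embedding X act u n s"
proof -
  obtain n s where s: "\<forall>x i. n \<le> i \<longrightarrow> s x i = 0" "\<forall>i. (\<lambda>x. s x i) \<in> reg X"
    "\<forall>w x. w \<noteq> 0 \<longrightarrow> x \<in> pts X \<longrightarrow> s (act w x) = s x"
    "\<forall>f\<in>reg X. \<exists>g\<in>polys {..<n}. \<forall>x\<in>pts X. f (retract x) = g (s x)"
    using invariant_coordinates by blast
  have "invariant_embedding X act u n s"
    by unfold_locales (use s in auto)
  then show ?thesis by blast
qed

section \<open>The equivalence\<close>

lemma weight_one_unit_of_trivial_bundle:
  fixes X :: "('p, 'k::alg_closed_field) function_space" and act :: "'k \<Rightarrow> 'p \<Rightarrow> 'p"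
  assumes X: "affine_Gm_variety X act" and triv: "trivial_Gm_bundle X act"
  shows "\<exists>u\<in>unit_functions X. semi_invariant_weight_one X act u"
proof -
  obtain Q \<pi> \<phi> where Q: "categorical_quotient X act (Q :: (nat \<Rightarrow> 'k, 'k) function_space) \<pi>"
    and iso: "isomorphism X (product_variety Gm Q) \<phi>"
    and eq: "Gm_equivariant X act (\<lambda>w (s, q). (w * s, q)) \<phi>"
    using triv unfolding trivial_Gm_bundle_def by blast
  have algQ: "function_algebra (reg Q)"
    using Q unfolding categorical_quotient_def by (auto intro: affine_variety_function_algebra)
  have \<phi>: "morphism X (product_variety Gm Q) \<phi>" using iso by (simp add: isomorphism_def)
  have "(\<lambda>x. fst (\<phi> x)) \<in> reg X" "(\<lambda>x. 1 / fst (\<phi> x)) \<in> reg X"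
    using morphism_reg[OF \<phi> reg_product_fst[OF algQ id_reg_Gm]]
      morphism_reg[OF \<phi> reg_product_fst[OF algQ inverse_reg_Gm]] by simp_all
  moreover have "fst (\<phi> x) \<noteq> 0" if "x \<in> pts X" for x
    using morphism_pts[OF \<phi> that] by (auto simp: pts_product pts_Gm)
  ultimately have "(\<lambda>x. fst (\<phi> x)) \<in> unit_functions X"
    unfolding unit_functions_def by (auto intro!: bexI[of _ "\<lambda>x. 1 / fst (\<phi> x)"])
  moreover have "semi_invariant_weight_one X act (\<lambda>x. fst (\<phi> x))"
    using eq unfolding semi_invariant_weight_one_def Gm_equivariant_def by (simp add: case_prod_unfold)
  ultimately show ?thesis by blast
qed

lemma weight_one_unit_of_morphism:
  assumes \<Psi>: "morphism X Gm \<Psi>" and eq: "Gm_equivariant X act (*) \<Psi>"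
  shows "\<Psi> \<in> unit_functions X" and "semi_invariant_weight_one X act \<Psi>"
proof -
  have "\<Psi> \<in> reg X" "(\<lambda>x. 1 / \<Psi> x) \<in> reg X"
    using morphism_reg[OF \<Psi> id_reg_Gm] morphism_reg[OF \<Psi> inverse_reg_Gm] by simp_all
  moreover have "\<Psi> x \<noteq> 0" if "x \<in> pts X" for x
    using morphism_pts[OF \<Psi> that] by (simp add: pts_Gm)
  ultimately show "\<Psi> \<in> unit_functions X"
    unfolding unit_functions_def by (auto intro!: bexI[of _ "\<lambda>x. 1 / \<Psi> x"])
  show "semi_invariant_weight_one X act \<Psi>"
    using eq unfolding semi_invariant_weight_one_def Gm_equivariant_def by simp
qed

lemma semi_invariant_fraction:
  assumes u: "u \<in> unit_functions (principal_open X h)"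
    and weight: "semi_invariant_weight_one (principal_open X h) act u"
    and stable: "Gm_stable act (pts (principal_open X h))"
  shows "\<exists>g\<in>reg X. \<exists>e::nat. (\<lambda>x. g x / h x ^ e) \<in> unit_functions (principal_open X h) \<and>
     semi_invariant_weight_one (principal_open X h) act (\<lambda>x. g x / h x ^ e)"
proof -
  let ?D = "principal_open X h"
  have "u \<in> reg ?D" using u by (simp add: unit_functions_def)
  then obtain g e where g: "g \<in> reg X" "\<And>x. x \<in> pts X \<Longrightarrow> h x \<noteq> 0 \<Longrightarrow> u x = g x / h x ^ e"
    by (rule reg_principal_openE) blast
  have eq: "u x = g x / h x ^ e" if "x \<in> pts ?D" for x
    using g(2) that by (simp add: pts_principal_open)
  have "(\<lambda>x. g x / h x ^ e) \<in> reg ?D" by (rule reg_principal_openI[OF g(1), of _ _ e]) simp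
  then have "(\<lambda>x. g x / h x ^ e) \<in> unit_functions ?D"
    using u eq unfolding unit_functions_def by auto
  moreover have "semi_invariant_weight_one ?D act (\<lambda>x. g x / h x ^ e)"
    using weight stable unfolding semi_invariant_weight_one_def Gm_stable_def
    by (metis eq)
  ultimately show ?thesis using g(1) by blast
qed

theorem proposition1p1:
  fixes X :: "('p, 'k::alg_closed_field) function_space"
    and act :: "'k \<Rightarrow> 'p \<Rightarrow> 'p"
    and h :: "'p \<Rightarrow> 'k"
  assumes "affine_Gm_variety X act"
    and "h \<in> reg X"
    and "pts (principal_open X h) \<noteq> {}"
    and "Gm_stable act (pts (principal_open X h))"
  shows "(trivial_Gm_bundle (principal_open X h) act \<longleftrightarrow>
          (\<exists>\<Psi>. morphism (principal_open X h) Gm \<Psi> \<and>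
               Gm_equivariant (principal_open X h) act (*) \<Psi> \<and>
               generically_smooth (principal_open X h) Gm \<Psi> \<and>
               dominant (principal_open X h) Gm \<Psi> \<and>
               connected_fibres (principal_open X h) Gm \<Psi>))
       \<and> ((\<exists>\<Psi>. morphism (principal_open X h) Gm \<Psi> \<and>
               Gm_equivariant (principal_open X h) act (*) \<Psi> \<and>
               generically_smooth (principal_open X h) Gm \<Psi> \<and>
               dominant (principal_open X h) Gm \<Psi> \<and>
               connected_fibres (principal_open X h) Gm \<Psi>) \<longleftrightarrow>
          (\<exists>g\<in>reg X. \<exists>e::nat.
               (\<lambda>x. g x / h x ^ e) \<in> unit_functions (principal_open X h) \<and>
               semi_invariant_weight_one (principal_open X h) act (\<lambda>x. g x / h x ^ e)))"
    (is "(?a \<longleftrightarrow> ?b) \<and> (?b \<longleftrightarrow> ?c)")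
proof -
  define D where "D = principal_open X h"
  have D: "affine_Gm_variety D act"
    unfolding D_def by (rule affine_Gm_variety_principal_open[OF assms])
  define unit where
    "unit \<longleftrightarrow> (\<exists>u\<in>unit_functions D. semi_invariant_weight_one D act u)"
  have "unit \<Longrightarrow> ?c"
    unfolding unit_def D_def using semi_invariant_fraction assms(4) by blast
  moreover have "?c \<Longrightarrow> unit"
    unfolding unit_def D_def by blast
  moreover have "?a \<Longrightarrow> unit"
    unfolding unit_def D_def[symmetric] by (rule weight_one_unit_of_trivial_bundle[OF D])
  moreover have "?b \<Longrightarrow> unit"
    unfolding unit_def D_def[symmetric] using weight_one_unit_of_morphism by blast
  moreover have "?a \<and> ?b" if ex: unit
  proof -
    obtain u where u: "u \<in> unit_functions D" "semi_invariant_weight_one D act u"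
      using ex unfolding unit_def by blast
    interpret weight_one_unit D act u
      using D u by unfold_locales
    obtain n s where "invariant_embedding D act u n s"
      using invariant_embedding_exists by blast
    then interpret invariant_embedding D act u n s .
    show ?thesis
      unfolding D_def[symmetric]
      using trivial_bundle morphism_u equivariant_u generically_smooth_u dominant_u connected_fibres_u
      by blast
  qed
  ultimately show ?thesis by blast
qed

end
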